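(* Let $p$ be a prime number, let $m\ge 1$ and $n\ge1$ be integers, and let $G_{m,p}=SU(p)^{m}/\Delta(\mathbb{Z}/p)$. Then the moduli space $\mathrm{Rep}(\mathbb{Z}^{n},G_{m,p})=\mathrm{Hom}(\mathbb{Z}^{n},G_{m,p})/G_{m,p}$ (of isomorphism classes of flat connections on principal $G_{m,p}$-bundles over the $n$-torus) has \[ N(n,m,p)=\frac{p^{(m-1)(n-2)}(p^{n}-1)(p^{n-1}-1)}{p^{2}-1}+1 \] path-connected components, and \[ \mathrm{Rep}(\mathbb{Z}^{n},G_{m,p})\cong \big((\mathbb{S}^{1})^{(p-1)mn}/(\Sigma_{p})^{m}\big)\sqcup X_{n,m,p}, \] where $X_{n,m,p}$ is a finite set with $N(n,m,p)-1$ points.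
   Context: $\Delta(\mathbb{Z}/p)$ denotes the image of the diagonal embedding of $\mathbb{Z}/p=Z(SU(p))$ into $(\mathbb{Z}/p)^{m}=Z(SU(p)^{m})$. $\mathrm{Hom}(\mathbb{Z}^{n},G)$ is the space of commuting $n$-tuples in $G^n$ with the subspace topology, and $G$ acts on it by simultaneous conjugation. In $(\mathbb{S}^{1})^{(p-1)mn}/(\Sigma_{p})^{m}$, $(\mathbb{S}^{1})^{(p-1)m}$ is a maximal torus $T$ of $G_{m,p}$ with Weyl group $(\Sigma_{p})^{m}$ (each factor $\Sigma_p$ acting as the Weyl group of a maximal torus of $SU(p)$), and $(\Sigma_{p})^{m}$ acts diagonally on $T^{n}=(\mathbb{S}^{1})^{(p-1)mn}$. *)

theory Defs
  imports "HOL-Analysis.Analysis" "HOL-Computational_Algebra.Primes"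
begin

definition qtop :: "'a topology \<Rightarrow> ('a \<Rightarrow> 'b) \<Rightarrow> 'b topology" where
  "qtop X f = topology (\<lambda>U. U \<subseteq> f ` topspace X \<and> openin X {x \<in> topspace X. f x \<in> U})"

definition dunion :: "'a topology \<Rightarrow> 'b topology \<Rightarrow> ('a + 'b) topology" where
  "dunion X Y = topology (\<lambda>U. U \<subseteq> Inl ` topspace X \<union> Inr ` topspace Y
      \<and> openin X (Inl -` U) \<and> openin Y (Inr -` U))"

type_synonym ('p,'m) elt = "(complex^'p^'p)^'m"

definition ctrans :: "complex^('p::finite)^'p \<Rightarrow> complex^'p^'p" where
  "ctrans A = (\<chi> i j. cnj (A $ j $ i))"

definition SU :: "(complex^('p::finite)^'p) set" where
  "SU = {A. A ** ctrans A = mat 1 \<and> det A = 1}"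

definition SUm :: "('p::finite,'m::finite) elt set" where
  "SUm = {g. \<forall>k. g $ k \<in> SU}"

definition gmul :: "('p::finite,'m::finite) elt \<Rightarrow> ('p,'m) elt \<Rightarrow> ('p,'m) elt" where
  "gmul g h = (\<chi> k. g $ k ** h $ k)"

definition ginv :: "('p::finite,'m::finite) elt \<Rightarrow> ('p,'m) elt" where
  "ginv g = (\<chi> k. matrix_inv (g $ k))"

text \<open>Delta(Z/p): diagonal copy of the centre Z/p = {w I | w^p = 1} of SU(p) in SU(p)^m.\<close>
definition Delta :: "('p::finite,'m::finite) elt set" where
  "Delta = {(\<chi> k. mat w) | w. w ^ CARD('p) = 1}"

definition gclass :: "('p::finite,'m::finite) elt \<Rightarrow> ('p,'m) elt set" where
  "gclass g = {gmul z g | z. z \<in> (Delta :: ('p,'m) elt set)}"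

definition Gtop :: "('p::finite,'m::finite) elt set topology" where
  "Gtop = qtop (subtopology euclidean (SUm :: ('p,'m) elt set)) gclass"

definition Gcarrier :: "('p::finite,'m::finite) elt set set" where
  "Gcarrier = gclass ` SUm"

definition cmul :: "('p::finite,'m::finite) elt set \<Rightarrow> ('p,'m) elt set \<Rightarrow> ('p,'m) elt set" where
  "cmul a b = {gmul x y | x y. x \<in> a \<and> y \<in> b}"

definition cinv :: "('p::finite,'m::finite) elt set \<Rightarrow> ('p,'m) elt set" where
  "cinv a = ginv ` a"

definition cconj :: "('p::finite,'m::finite) elt set \<Rightarrow> ('p,'m) elt set \<Rightarrow> ('p,'m) elt set" where
  "cconj x a = cmul (cmul x a) (cinv x)"

definition HomTop :: "('n \<Rightarrow> ('p::finite,'m::finite) elt set) topology" where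
  "HomTop = subtopology (product_topology (\<lambda>_. Gtop) UNIV)
     {t. (\<forall>i. t i \<in> Gcarrier) \<and> (\<forall>i j. cmul (t i) (t j) = cmul (t j) (t i))}"

definition conj_orbit :: "('n \<Rightarrow> ('p::finite,'m::finite) elt set) \<Rightarrow> ('n \<Rightarrow> ('p,'m) elt set) set" where
  "conj_orbit t = {s. \<exists>x \<in> Gcarrier. \<forall>i. s i = cconj x (t i)}"

definition RepTop :: "('n \<Rightarrow> ('p::finite,'m::finite) elt set) set topology" where
  "RepTop = qtop HomTop conj_orbit"

definition diag_mat :: "complex^('p::finite)^'p \<Rightarrow> bool" where
  "diag_mat A \<longleftrightarrow> (\<forall>i j. i \<noteq> j \<longrightarrow> A $ i $ j = 0)"

definition Tcarrier :: "('p::finite,'m::finite) elt set set" where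
  "Tcarrier = gclass ` {g \<in> SUm. \<forall>k. diag_mat (g $ k)}"

text \<open>Action of a permutation on a matrix (conjugation by the permutation matrix);
  on diagonal matrices it permutes the diagonal entries.\<close>
definition permmat :: "('p \<Rightarrow> 'p) \<Rightarrow> complex^('p::finite)^'p \<Rightarrow> complex^'p^'p" where
  "permmat s A = (\<chi> i j. A $ s i $ s j)"

definition Weyl :: "('m \<Rightarrow> 'p \<Rightarrow> 'p) set" where
  "Weyl = {s. \<forall>k. s k permutes (UNIV :: 'p set)}"

definition wact :: "('m \<Rightarrow> 'p \<Rightarrow> 'p) \<Rightarrow> ('p::finite,'m::finite) elt set \<Rightarrow> ('p,'m) elt set" where
  "wact s a = (\<lambda>g. \<chi> k. permmat (s k) (g $ k)) ` a"

definition Tn_top :: "('n \<Rightarrow> ('p::finite,'m::finite) elt set) topology" where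
  "Tn_top = product_topology (\<lambda>_. subtopology Gtop Tcarrier) UNIV"

definition weyl_orbit :: "('n \<Rightarrow> ('p::finite,'m::finite) elt set) \<Rightarrow> ('n \<Rightarrow> ('p,'m) elt set) set" where
  "weyl_orbit t = {(\<lambda>i. wact s (t i)) | s. s \<in> (Weyl :: ('m \<Rightarrow> 'p \<Rightarrow> 'p) set)}"

definition TWTop :: "('n \<Rightarrow> ('p::finite,'m::finite) elt set) set topology" where
  "TWTop = qtop Tn_top weyl_orbit"

end

theory Submission
  imports Defs "HOL-Computational_Algebra.Fundamental_Theorem_Algebra"
begin

text \<open>Lift a commuting tuple in \<open>SU(p)\<^sup>m / \<Delta>\<close> to \<open>SU(p)\<^sup>m\<close>: the commutators of the lifts are
  \<open>p\<close>-th roots of unity that are the same in every factor. If all of them are 1, the lifts are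
  simultaneously diagonalizable, and the conjugacy classes of such tuples are the Weyl orbits on
  \<open>T\<^sup>n\<close>. Otherwise some two members \<open>A, C\<close> satisfy \<open>A C = z C A\<close> with \<open>z\<close> a primitive root of unity.
  As \<open>p\<close> is prime, such a pair acts irreducibly on the \<open>p\<close>-dimensional space and is unique up to
  conjugation (clock and shift matrices), so by Schur's lemma every other member is a scalar
  multiple of some \<open>A\<^sup>u C\<^sup>v\<close>. Choosing \<open>A, C\<close> as the first possible members of the tuple gives an
  echelon normal form, and counting normal forms gives the number of these classes.

  Closedness in the quotient needs no analysis of nearby tuples: the saturation of a compact set of
  lifts is compact, hence closed. So the torus part and each of the finitely many remaining classes
  are closed, and therefore also open.\<close>

subsection \<open>Eigenvectors and unitary matrices\<close>

text \<open>The origin of the count: as powers of z, the commutators of the lifts have exponents u_i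
  v_j - v_i u_j mod p, a nonzero alternating form of rank two on F_p^n. Such a form amounts to a
  plane spanned by rows u, v together with a nonzero multiple. The echelon normal form is the
  reduced echelon basis of the plane and z plays the part of the multiple, so there are p - 1 times
  as many forms as planes in F_p^n, that is (p^n - 1)(p^(n-1) - 1)/(p^2 - 1). What remains is one
  p-th root of unity for each member of the tuple and each of the m factors. Conjugation removes it
  at the two pivots, since the pivot pair can be carried exactly to the standard pair, and
  \<open>Delta\<close> removes it in one factor; this leaves (m - 1)(n - 2) free roots.

  That pairs with the same z are conjugate with no scalar correction rests on the determinant being
  1: it fixes the set of eigenvalues of A and the scalar C^p. Scaling A or C by a p-th root of unity
  changes neither, which is why the roots at the pivots disappear.\<close>

lemma power_orbit_relation:
  fixes A :: "complex^'p^'p::finite"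
  shows "\<exists>a. (\<exists>i\<le>CARD('p). a i \<noteq> 0) \<and> (\<Sum>i\<le>CARD('p). a i *s (((*v) A) ^^ i) x) = 0"
proof -
  let ?N = "CARD('p)" and ?f = "\<lambda>i. (((*v) A) ^^ i) x"
  show ?thesis
  proof (cases "inj_on ?f {..?N}")
    case True
    have "card (?f ` {..?N}) = Suc ?N"
      using True by (simp add: card_image)
    then have "\<not> vec.independent (?f ` {..?N})"
      using vec.independent_bound_general[of "?f ` {..?N}"] vec.dim_subset_UNIV[of "?f ` {..?N}"]
      by (auto simp: card_cart_basis vec.dimension_def)
    then obtain u where u: "\<exists>v\<in>?f ` {..?N}. u v \<noteq> 0" "(\<Sum>v\<in>?f ` {..?N}. u v *s v) = 0"
      using vec.dependent_finite[of "?f ` {..?N}"] by auto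
    have "(\<Sum>i\<le>?N. u (?f i) *s ?f i) = 0"
      using u(2) sum.reindex[OF True, of "\<lambda>v. u v *s v"] by (simp add: o_def)
    then show ?thesis
      using u(1) by (intro exI[of _ "\<lambda>i. u (?f i)"]) auto
  next
    case False
    \<comment> \<open>Two equal iterates already give the relation \<open>?f i - ?f j = 0\<close>;
      linear dependence of the set of iterates would not see a repetition.\<close>
    then obtain i j where ij: "i \<le> ?N" "j \<le> ?N" "i \<noteq> j" "?f i = ?f j"
      by (auto simp: inj_on_def)
    let ?a = "\<lambda>k. (if k = i then 1 else 0) - (if k = j then 1 else 0) :: complex"
    have "(\<Sum>k\<le>?N. ?a k *s ?f k) = (\<Sum>k\<le>?N. (if k = i then ?f k else 0) - (if k = j then ?f k else 0))"
      by (intro sum.cong) (auto simp: vector_sub_rdistrib)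
    also have "\<dots> = 0"
      using ij by (simp add: sum_subtractf)
    finally show ?thesis
      using ij by (intro exI[of _ ?a]) auto
  qed
qed

text \<open>A polynomial \<open>q\<close> of least degree with q(A) x = 0 has a complex root
  \<open>c\<close>. Writing q = (X - c) r, the vector r(A) x is nonzero by minimality and is an
  eigenvector. It stays in \<open>V\<close> with the iterates of \<open>x\<close>, so
  \<open>A\<close> never has to be rewritten as a smaller matrix on \<open>V\<close>.\<close>

lemma eigenvector_in_invariant_subspace:
  fixes A :: "complex^'p^'p::finite"
  assumes V: "vec.subspace V" and x: "x \<in> V" "x \<noteq> 0" and inv: "\<And>y. y \<in> V \<Longrightarrow> A *v y \<in> V"
  shows "\<exists>v\<in>V. \<exists>c. v \<noteq> 0 \<and> A *v v = c *s v"
proof -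
  let ?N = "CARD('p)" and ?f = "\<lambda>i. (((*v) A) ^^ i) x"
  define act where "act q = (\<Sum>i\<le>?N. coeff q i *s ?f i)" for q :: "complex poly"
  define P where "P q \<longleftrightarrow> q \<noteq> 0 \<and> degree q \<le> ?N \<and> act q = 0" for q
  have fV: "?f i \<in> V" for i
    by (induction i) (auto simp: x inv)
  have actV: "act q \<in> V" for q
    unfolding act_def by (intro vec.subspace_sum V vec.subspace_scale fV)
  obtain a where a: "\<exists>i\<le>?N. a i \<noteq> 0" "(\<Sum>i\<le>?N. a i *s ?f i) = 0"
    using power_orbit_relation[of A x] by blast
  define q0 where "q0 = (\<Sum>i\<le>?N. monom (a i) i)"
  have c0: "coeff q0 i = (if i \<le> ?N then a i else 0)" for i
    unfolding q0_def by (simp add: coeff_sum)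
  have "P q0"
    unfolding P_def
  proof (intro conjI)
    show "q0 \<noteq> 0" using a(1) c0 by (metis coeff_0)
    show "degree q0 \<le> ?N" by (rule degree_le) (simp add: c0)
    show "act q0 = 0" using a(2) by (simp add: act_def c0)
  qed
  define q where "q = arg_min degree P"
  have q: "P q" "\<And>r. P r \<Longrightarrow> degree q \<le> degree r"
    unfolding q_def using arg_min_nat_lemma[of P q0 degree] \<open>P q0\<close> by auto
  have "degree q \<noteq> 0"
  proof
    assume "degree q = 0"
    then obtain b where b: "q = [:b:]" by (metis degree_eq_zeroE)
    have "act q = (\<Sum>i\<le>?N. if i = 0 then b *s x else 0)"
      unfolding act_def b by (intro sum.cong) (auto simp: coeff_pCons split: nat.splits)
    then have "act q = b *s x"
      by simp
    with q(1) b x show False by (auto simp: P_def)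
  qed
  then have "\<not> constant (poly q)"
    by (simp add: constant_degree)
  then obtain c where "poly q c = 0"
    using fundamental_theorem_of_algebra by blast
  then obtain r where r: "q = [:- c, 1:] * r"
    by (auto simp: poly_eq_0_iff_dvd)
  have r0: "r \<noteq> 0" using q(1) r by (auto simp: P_def)
  have dq: "degree q = Suc (degree r)"
    unfolding r using r0 by (subst degree_mult_eq) auto
  have dN: "degree r < ?N" using dq q(1) by (simp add: P_def)
  have "act q = A *v act r - c *s act r"
  proof -
    \<comment> \<open>Multiplication by X shifts the coefficients up by one; the extra top term of
      the shifted sum vanishes because \<open>degree r < ?N\<close>.\<close>
    obtain M where M: "?N = Suc M"
      by (metis not0_implies_Suc zero_less_card_finite less_not_refl)
    have cq: "coeff q i = coeff (pCons 0 r) i - c * coeff r i" for i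
      unfolding r by simp
    have "(\<Sum>i\<le>?N. coeff (pCons 0 r) i *s ?f i) = (\<Sum>i\<le>M. coeff r i *s ?f (Suc i))"
      unfolding M sum.atMost_Suc_shift by simp
    also have "\<dots> = (\<Sum>i\<le>?N. coeff r i *s ?f (Suc i))"
      using dN by (simp add: M coeff_eq_0)
    also have "\<dots> = A *v act r"
      by (simp add: act_def vec.sum vec.scale)
    finally have "(\<Sum>i\<le>?N. coeff (pCons 0 r) i *s ?f i) = A *v act r" .
    moreover have "(\<Sum>i\<le>?N. (c * coeff r i) *s ?f i) = c *s act r"
      unfolding act_def vec.scale_sum_right by (intro sum.cong) (auto simp: vector_smult_assoc)
    ultimately show ?thesis
      unfolding act_def[of q] cq vector_sub_rdistrib sum_subtractf by simp
  qed
  moreover have "act q = 0" using q(1) by (simp add: P_def)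
  moreover have "act r \<noteq> 0"
    using q(2)[of r] dq dN r0 by (auto simp: P_def)
  ultimately show ?thesis
    using actV[of r] by (metis eq_iff_diff_eq_0)
qed

section \<open>Hermitian form and unitary matrices\<close>

text \<open>Conjugate-linear in the first argument, with \<open>inner\<close> as its real part.
  Complex orthogonality is what makes complements of eigenvectors invariant under unitary
  matrices.\<close>

definition cip :: "complex^'p \<Rightarrow> complex^'p::finite \<Rightarrow> complex" where
  "cip x y = (\<Sum>i\<in>UNIV. cnj (x $ i) * y $ i)"

lemma cip_add_right: "cip x (y + z) = cip x y + cip x z"
  by (simp add: cip_def algebra_simps sum.distrib)

lemma cip_diff_right: "cip x (y - z) = cip x y - cip x z"
  by (simp add: cip_def algebra_simps sum_subtractf)

lemma cip_scale_right: "cip x (c *s y) = c * cip x y"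
  by (simp add: cip_def algebra_simps sum_distrib_left)

lemma cip_scale_left: "cip (c *s x) y = cnj c * cip x y"
  by (simp add: cip_def algebra_simps sum_distrib_left)

lemma cip_zero_right [simp]: "cip x 0 = 0"
  by (simp add: cip_def)

lemma cip_sum_right: "cip x (\<Sum>i\<in>S. f i) = (\<Sum>i\<in>S. cip x (f i))"
  by (induction S rule: infinite_finite_induct) (auto simp: cip_add_right)

lemma cnj_cip: "cnj (cip x y) = cip y x"
  by (simp add: cip_def mult.commute)

lemma cip_self: "cip x x = of_real ((norm x)\<^sup>2)"
proof -
  have "cip x x = (\<Sum>i\<in>UNIV. of_real ((norm (x $ i))\<^sup>2))"
    unfolding cip_def by (intro sum.cong refl) (metis complex_norm_square mult.commute of_real_power)
  also have "\<dots> = of_real ((norm x)\<^sup>2)"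
    by (simp add: norm_vec_def L2_set_def sum_nonneg)
  finally show ?thesis .
qed

lemma cip_self_eq_0 [simp]: "cip x x = 0 \<longleftrightarrow> x = 0"
  by (simp add: cip_self)

lemma cip_adjoint: "cip (A *v x) y = cip x (ctrans A *v y)"
proof -
  have "cip (A *v x) y = (\<Sum>i\<in>UNIV. \<Sum>j\<in>UNIV. cnj (A $ i $ j) * cnj (x $ j) * y $ i)"
    by (simp add: cip_def matrix_vector_mult_def sum_distrib_right)
  also have "\<dots> = (\<Sum>j\<in>UNIV. \<Sum>i\<in>UNIV. cnj (A $ i $ j) * cnj (x $ j) * y $ i)"
    by (rule sum.swap)
  also have "\<dots> = cip x (ctrans A *v y)"
    by (simp add: cip_def matrix_vector_mult_def ctrans_def sum_distrib_left mult_ac)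
  finally show ?thesis .
qed

lemma ctrans_ctrans [simp]: "ctrans (ctrans A) = A"
  by (simp add: ctrans_def vec_eq_iff)

lemma ctrans_mult: "ctrans (A ** B) = ctrans B ** ctrans A"
  by (simp add: ctrans_def matrix_matrix_mult_def vec_eq_iff mult.commute)

lemma ctrans_mat: "ctrans (mat c) = mat (cnj c)"
  by (simp add: ctrans_def mat_def vec_eq_iff)

lemma det_ctrans: "det (ctrans A) = cnj (det A)"
proof -
  have "ctrans A = transpose (\<chi> i j. cnj (A $ i $ j))"
    by (simp add: ctrans_def transpose_def vec_eq_iff)
  then have "det (ctrans A) = det (\<chi> i j. cnj (A $ i $ j))"
    by (simp add: det_transpose)
  also have "\<dots> = cnj (det A)"
    by (simp add: det_def)
  finally show ?thesis .
qed

definition unitary :: "complex^'p^'p::finite \<Rightarrow> bool" where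
  "unitary A \<longleftrightarrow> A ** ctrans A = mat 1"

lemma unitary_left: "unitary A \<Longrightarrow> ctrans A ** A = mat 1"
  by (simp add: unitary_def matrix_left_right_inverse)

lemma unitary_ctrans: "unitary A \<Longrightarrow> unitary (ctrans A)"
  using unitary_left by (simp add: unitary_def)

lemma unitary_mult: "unitary A \<Longrightarrow> unitary B \<Longrightarrow> unitary (A ** B)"
proof -
  assume A: "unitary A" and B: "unitary B"
  have "A ** B ** ctrans (A ** B) = A ** (B ** ctrans B) ** ctrans A"
    by (simp only: ctrans_mult matrix_mul_assoc)
  then show ?thesis
    using A B by (simp add: unitary_def)
qed

lemma unitary_cip: "unitary A \<Longrightarrow> cip (A *v x) (A *v y) = cip x y"
  by (simp add: cip_adjoint matrix_vector_mul_assoc unitary_left)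

lemma mat_mult_left: "mat c ** A = (\<chi> i j. c * (A::complex^'p^'p::finite) $ i $ j)"
proof -
  have "(\<Sum>k\<in>UNIV. (if i = k then c else 0) * A $ k $ j) = (\<Sum>k\<in>UNIV. if k = i then c * A $ i $ j else 0)" for i j
    by (intro sum.cong) auto
  then show ?thesis
    by (simp add: matrix_matrix_mult_def mat_def vec_eq_iff)
qed

lemma mat_mult_right: "A ** mat c = (\<chi> i j. c * (A::complex^'p^'p::finite) $ i $ j)"
proof -
  have "(\<Sum>k\<in>UNIV. A $ i $ k * (if k = j then c else 0)) = (\<Sum>k\<in>UNIV. if k = j then c * A $ i $ j else 0)" for i j
    by (intro sum.cong) auto
  then show ?thesis
    by (simp add: matrix_matrix_mult_def mat_def vec_eq_iff)
qed

lemma mat_commute: "mat c ** A = (A::complex^'p^'p::finite) ** mat c"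
  by (simp add: mat_mult_left mat_mult_right)

lemma mat_mat: "mat c ** mat d = (mat (c * d) :: complex^'p^'p::finite)"
  by (simp add: mat_mult_left) (simp add: mat_def vec_eq_iff)

lemma det_mat: "det (mat c :: complex^'p^'p::finite) = c ^ CARD('p)"
  by (subst det_diagonal) (auto simp: mat_def)

lemma mat_vec: "mat c *v x = c *s (x :: complex^'p::finite)"
proof -
  have "(\<Sum>k\<in>UNIV. (if i = k then c else 0) * x $ k) = (\<Sum>k\<in>UNIV. if k = i then c * x $ i else 0)" for i
    by (intro sum.cong) auto
  then show ?thesis
    by (simp add: matrix_vector_mult_def mat_def vec_eq_iff)
qed

lemma unitary_mat: "norm c = 1 \<Longrightarrow> unitary (mat c)"
  using complex_norm_square[of c] by (simp add: unitary_def ctrans_mat mat_mat)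

lemma norm_det_unitary: "unitary A \<Longrightarrow> norm (det A) = 1"
proof -
  assume "unitary A"
  then have "det A * cnj (det A) = 1"
    by (metis unitary_def det_mul det_ctrans det_I)
  then show ?thesis
    by (metis complex_mod_mult_cnj norm_one power2_eq_1_iff norm_ge_zero abs_norm_cancel abs_1 abs_minus)
qed

lemma SU_iff: "A \<in> SU \<longleftrightarrow> unitary A \<and> det A = 1"
  by (simp add: SU_def unitary_def)

lemma complex_root_exists:
  assumes "n > 0" "z \<noteq> 0"
  obtains c :: complex where "c ^ n = z"
  using card_nth_roots[OF assms(2,1)] assms(1) by (metis (mono_tags) card.empty empty_Collect_eq less_not_refl)

section \<open>Simultaneous diagonalization of commuting unitary matrices\<close>

text \<open>Take a nonzero invariant subspace of \<open>V\<close> of least dimension. Inside it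
  every eigenspace of one \<open>A i\<close> is again invariant under the whole family by
  commutativity, hence is everything; so each \<open>A i\<close> acts on it as a scalar.\<close>

lemma common_eigenvector:
  fixes A :: "'i \<Rightarrow> complex^'p^'p::finite"
  assumes comm: "\<And>i j. A i ** A j = A j ** A i"
    and V: "vec.subspace V" and x: "x \<in> V" "x \<noteq> 0" and inv: "\<And>i y. y \<in> V \<Longrightarrow> A i *v y \<in> V"
  shows "\<exists>v\<in>V. v \<noteq> 0 \<and> (\<forall>i. \<exists>c. A i *v v = c *s v)"
proof -
  define P where "P W \<longleftrightarrow> vec.subspace W \<and> W \<subseteq> V \<and> (\<exists>x\<in>W. x \<noteq> 0) \<and> (\<forall>i. \<forall>y\<in>W. A i *v y \<in> W)" for W
  have "P V" using assms by (auto simp: P_def)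
  define W where "W = arg_min vec.dim P"
  have W: "P W" "\<And>W'. P W' \<Longrightarrow> vec.dim W \<le> vec.dim W'"
    unfolding W_def using arg_min_nat_lemma[of P V vec.dim] \<open>P V\<close> by auto
  obtain w where w: "w \<in> W" "w \<noteq> 0" using W(1) by (auto simp: P_def)
  have "\<exists>c. A i *v w = c *s w" for i
  proof -
    obtain v c where v: "v \<in> W" "v \<noteq> 0" "A i *v v = c *s v"
      using eigenvector_in_invariant_subspace[of W w "A i"] W(1) w by (auto simp: P_def)
    let ?W = "{y \<in> W. A i *v y = c *s y}"
    have "P ?W"
      unfolding P_def
    proof (intro conjI allI ballI)
      show "vec.subspace ?W"
        using W(1) unfolding P_def vec.subspace_def
        by (auto simp: matrix_vector_right_distrib vector_add_ldistrib matrix_vector_mult_scaleR vec.scale vector_smult_assoc mult.commute)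
      show "?W \<subseteq> V" "\<exists>x\<in>?W. x \<noteq> 0" using W(1) v by (auto simp: P_def)
      fix j y assume y: "y \<in> ?W"
      have "A i *v (A j *v y) = A j *v (A i *v y)"
        by (simp add: matrix_vector_mul_assoc comm)
      then show "A j *v y \<in> ?W"
        using y W(1) by (auto simp: P_def vec.scale)
    qed
    then have "vec.dim W \<le> vec.dim ?W" by (rule W(2))
    then have "?W = W"
      using W(1) \<open>P ?W\<close> vec.subspace_dim_equal[of ?W W] by (auto simp: P_def)
    then show ?thesis using w by auto
  qed
  then show ?thesis
    using w W(1) by (auto simp: P_def)
qed

definition cols :: "('p \<Rightarrow> complex^'p) \<Rightarrow> complex^'p^'p::finite" where
  "cols f = (\<chi> i j. f j $ i)"

definition diagm :: "('p \<Rightarrow> complex) \<Rightarrow> complex^'p^'p::finite" where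
  "diagm d = (\<chi> i j. if i = j then d i else 0)"

lemma mult_cols: "A ** cols f = cols (\<lambda>j. A *v f j)"
  by (simp add: cols_def matrix_matrix_mult_def matrix_vector_mult_def)

lemma cols_scale: "cols (\<lambda>j. d j *s f j) = cols f ** diagm d"
proof -
  have "(\<Sum>k\<in>UNIV. f k $ i * (if k = j then d k else 0)) = (\<Sum>k\<in>UNIV. if k = j then d j * f j $ i else 0)" for i j
    by (intro sum.cong) auto
  then show ?thesis
    by (simp add: cols_def diagm_def matrix_matrix_mult_def vec_eq_iff)
qed

lemma ctrans_mult_cols: "ctrans (cols f) ** cols g = (\<chi> i j. cip (f i) (g j))"
  by (simp add: cols_def ctrans_def cip_def matrix_matrix_mult_def)

lemma cols_mult_vec: "cols f *v x = (\<Sum>j\<in>UNIV. x $ j *s f j)"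
  by (simp add: cols_def matrix_vector_mult_def vec_eq_iff sum_component mult.commute)

definition orthonormal :: "('p \<Rightarrow> complex^'p::finite) \<Rightarrow> bool" where
  "orthonormal f \<longleftrightarrow> (\<forall>i j. cip (f i) (f j) = (if i = j then 1 else 0))"

lemma unitary_cols: "orthonormal f \<Longrightarrow> unitary (cols f)"
proof -
  assume "orthonormal f"
  then have "ctrans (cols f) ** cols f = mat 1"
    by (simp add: ctrans_mult_cols orthonormal_def mat_def)
  then show ?thesis
    by (simp add: unitary_def matrix_left_right_inverse)
qed

lemma subspace_orthonormal_eq_UNIV:
  assumes "orthonormal f" "vec.subspace V" "\<And>j. f j \<in> V"
  shows "V = UNIV"
proof -
  have "y \<in> V" for y
  proof -
    have "y = cols f *v (ctrans (cols f) *v y)"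
      using unitary_cols[OF assms(1)] by (simp add: matrix_vector_mul_assoc unitary_def)
    also have "\<dots> \<in> V"
      unfolding cols_mult_vec by (intro vec.subspace_sum vec.subspace_scale assms)
    finally show ?thesis .
  qed
  then show ?thesis by auto
qed

lemma unitary_eigen_orthogonal:
  assumes "unitary A" "A *v x = c *s x" "A *v y = d *s y" "x \<noteq> 0" "c \<noteq> d"
  shows "cip x y = 0"
proof (rule ccontr)
  assume n: "cip x y \<noteq> 0"
  have "cnj c * d * cip x y = cip x y" "cnj c * c * cip x x = cip x x"
    using unitary_cip[OF assms(1), of x y] unitary_cip[OF assms(1), of x x]
    by (simp_all add: assms(2,3) cip_scale_left cip_scale_right mult_ac)
  then have "cnj c * d = 1" "cnj c * c = 1"
    using n assms(4) by auto
  then have "c = d"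
    by (metis mult.commute mult.left_commute mult.right_neutral)
  then show False using assms(5) by simp
qed

lemma normalize_vector:
  assumes "x \<noteq> (0::complex^'p::finite)"
  obtains c where "c \<noteq> 0" "cip (c *s x) (c *s x) = 1"
proof
  let ?c = "of_real (inverse (norm x)) :: complex"
  show "?c \<noteq> 0" using assms by simp
  show "cip (?c *s x) (?c *s x) = 1"
  proof -
    have "cip (?c *s x) (?c *s x) = cnj ?c * (?c * cip x x)"
      by (simp only: cip_scale_left cip_scale_right mult_ac)
    also have "\<dots> = of_real ((inverse (norm x) * norm x)\<^sup>2)"
      unfolding cip_self complex_cnj_complex_of_real of_real_mult of_real_power
      by (simp only: power2_eq_square mult_ac)
    finally show ?thesis
      using assms by simp
  qed
qed

lemma orthonormal_set_independent:
  fixes S :: "(complex^'p::finite) set"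
  assumes "finite S" and o: "\<And>x y. x \<in> S \<Longrightarrow> y \<in> S \<Longrightarrow> cip x y = (if x = y then 1 else 0)"
  shows "vec.independent S"
proof (rule vec.independent_if_scalars_zero[OF assms(1)])
  fix u x assume u: "(\<Sum>x\<in>S. u x *s x) = 0" and x: "x \<in> S"
  have "cip x (\<Sum>x\<in>S. u x *s x) = (\<Sum>y\<in>S. if x = y then u y else 0)"
    unfolding cip_sum_right by (intro sum.cong) (auto simp: cip_scale_right o x)
  then show "u x = 0"
    using u x assms(1) by simp
qed

text \<open>An orthonormal set of common eigenvectors of largest size must span: its orthogonal
  complement is invariant, because a unitary matrix preserves \<open>cip\<close> and has nonzero
  eigenvalues, so a nonzero complement would contain a further common eigenvector.\<close>

lemma commuting_unitaries_orthonormal_eigenbasis: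
  fixes A :: "'i \<Rightarrow> complex^'p^'p::finite"
  assumes comm: "\<And>i j. A i ** A j = A j ** A i" and uni: "\<And>i. unitary (A i)"
  shows "\<exists>f d. orthonormal f \<and> (\<forall>i j. A i *v f j = d i j *s f j)"
proof -
  define P where "P S \<longleftrightarrow> finite S \<and> (\<forall>x\<in>S. \<forall>y\<in>S. cip x y = (if x = y then 1 else 0))
     \<and> (\<forall>x\<in>S. \<forall>i. \<exists>c. A i *v x = c *s x)" for S :: "(complex^'p) set"
  have indep: "vec.independent S" if "P S" for S
    using that orthonormal_set_independent[of S] by (simp add: P_def)
  have bound: "card S \<le> CARD('p)" if "P S" for S
    using vec.independent_card_le_dim[of S UNIV] indep[OF that] by (auto simp: card_cart_basis)
  have "P {}" by (simp add: P_def)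
  then obtain S where S: "P S" "\<And>S'. P S' \<Longrightarrow> card S' \<le> card S"
    using Lattices_Big.ex_has_greatest_nat[of P "{}" card "Suc CARD('p)"] bound by (metis le_imp_less_Suc)
  have S': "finite S" "\<And>x y. x \<in> S \<Longrightarrow> y \<in> S \<Longrightarrow> cip x y = (if x = y then 1 else 0)"
    using S(1) by (auto simp: P_def)
  have "y \<in> vec.span S" for y
  proof (rule ccontr)
    assume y: "y \<notin> vec.span S"
    let ?V = "{x. \<forall>s\<in>S. cip s x = 0}"
    \<comment> \<open>The residual of \<open>y\<close> after projection to the span, which witnesses
      that the complement is nonzero.\<close>
    define x where "x = y - (\<Sum>s\<in>S. cip s y *s s)"
    have "(\<Sum>s\<in>S. cip s y *s s) \<in> vec.span S"
      by (intro vec.span_sum vec.span_scale vec.span_base)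
    then have x0: "x \<noteq> 0" using y by (auto simp: x_def)
    have xV: "x \<in> ?V"
    proof (clarify)
      fix s assume s: "s \<in> S"
      have "cip s (\<Sum>t\<in>S. cip t y *s t) = (\<Sum>t\<in>S. if s = t then cip t y else 0)"
        unfolding cip_sum_right by (intro sum.cong) (auto simp: cip_scale_right S' s)
      then show "cip s x = 0"
        using s S'(1) by (simp add: x_def cip_diff_right)
    qed
    have V: "vec.subspace ?V"
      by (auto simp: vec.subspace_def cip_add_right cip_scale_right)
    have inv: "A i *v z \<in> ?V" if z: "z \<in> ?V" for i z
    proof clarify
      fix s assume s: "s \<in> S"
      then obtain c where c: "A i *v s = c *s s" using S(1) unfolding P_def by blast
      have "cip (A i *v s) (A i *v z) = 0"
        using z s by (simp add: unitary_cip[OF uni])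
      moreover have "c \<noteq> 0"
        using unitary_cip[OF uni, of i s s] S'(2)[OF s s] c by (auto simp: cip_scale_left)
      ultimately show "cip s (A i *v z) = 0"
        by (simp add: c cip_scale_left)
    qed
    obtain v where v: "v \<in> ?V" "v \<noteq> 0" "\<forall>i. \<exists>c. A i *v v = c *s v"
      using common_eigenvector[of A ?V x] comm V xV x0 inv by blast
    obtain c where c: "c \<noteq> 0" "cip (c *s v) (c *s v) = 1"
      using normalize_vector[OF v(2)] by blast
    let ?w = "c *s v"
    have w: "cip s ?w = 0" "cip ?w s = 0" if "s \<in> S" for s
    proof -
      show "cip s ?w = 0" using v(1) that by (simp add: cip_scale_right)
      then show "cip ?w s = 0" by (metis cnj_cip complex_cnj_zero)
    qed
    have "?w \<notin> S" using w c by auto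
    have ev: "\<exists>d. A i *v ?w = d *s ?w" for i
    proof -
      obtain d where "A i *v v = d *s v" using v(3) by auto
      then show ?thesis
        by (intro exI[of _ d]) (simp add: vec.scale mult.commute)
    qed
    have "P (insert ?w S)"
      using S(1) w c(2) ev \<open>?w \<notin> S\<close> unfolding P_def by auto
    from S(2)[OF this] show False
      using \<open>?w \<notin> S\<close> S'(1) by simp
  qed
  then have "vec.span S = UNIV" by auto
  then have "card S = CARD('p)"
    using vec.dim_span_eq_card_independent[OF indep[OF S(1)]] by (simp add: card_cart_basis)
  then obtain f where f: "bij_betw f (UNIV::'p set) S"
    using finite_same_card_bij[OF finite S'(1)] by metis
  have fS: "f j \<in> S" for j using f by (auto simp: bij_betw_def)
  have "orthonormal f"
    unfolding orthonormal_def using fS S'(2) f by (auto simp: bij_betw_def inj_on_def)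
  moreover have "\<forall>i j. \<exists>c. A i *v f j = c *s f j"
    using fS S(1) by (auto simp: P_def)
  then obtain d where "\<forall>i j. A i *v f j = d i j *s f j" by metis
  ultimately show ?thesis by blast
qed

text \<open>A \<open>CARD('p)\<close>-th root of the inverse determinant has modulus 1. As
  conjugation ignores such a scalar (\<open>scale_conj\<close>), every unitary conjugation can be
  carried out inside \<open>SU\<close>.\<close>

lemma unitary_scale_SU:
  assumes "unitary (U :: complex^'p^'p::finite)"
  obtains c where "norm c = 1" "mat c ** U \<in> SU"
proof -
  have n: "norm (det U) = 1" by (rule norm_det_unitary[OF assms])
  then obtain c where c: "c ^ CARD('p) = inverse (det U)"
    using complex_root_exists[of "CARD('p)" "inverse (det U)"] by (metis norm_zero zero_neq_one inverse_nonzero_iff_nonzero zero_less_card_finite)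
  then have "norm c ^ CARD('p) = 1"
    by (metis n norm_power norm_inverse inverse_1)
  then have "norm c = 1"
    using power_eq_iff_eq_base[of "CARD('p)" "norm c" 1] by simp
  moreover from this have "mat c ** U \<in> SU"
  proof -
    have "det U \<noteq> 0" using n by auto
    then show ?thesis
      using c \<open>norm c = 1\<close> assms by (simp add: SU_iff unitary_mult unitary_mat det_mul det_mat)
  qed
  ultimately show ?thesis using that by blast
qed

lemma scale_conj:
  assumes "norm c = 1"
  shows "(mat c ** U) ** A ** ctrans (mat c ** U) = U ** A ** ctrans (U::complex^'p^'p::finite)"
proof -
  have "c * cnj c = 1" using complex_norm_square[of c] assms by simp
  have "(mat c ** U) ** A ** ctrans (mat c ** U) = mat c ** (U ** A ** ctrans U ** mat (cnj c))"
    by (simp add: ctrans_mult ctrans_mat matrix_mul_assoc)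
  also have "\<dots> = mat c ** mat (cnj c) ** (U ** A ** ctrans U)"
    unfolding mat_commute[of "cnj c" "U ** A ** ctrans U", symmetric] by (simp only: matrix_mul_assoc)
  finally show ?thesis
    using \<open>c * cnj c = 1\<close> by (simp add: mat_mat)
qed

lemma commuting_SU_diagonalizable:
  fixes A :: "'i \<Rightarrow> complex^'p^'p::finite"
  assumes comm: "\<And>i j. A i ** A j = A j ** A i" and uni: "\<And>i. A i \<in> SU"
  shows "\<exists>U\<in>SU. \<forall>i. diag_mat (U ** A i ** ctrans U)"
proof -
  obtain f d where f: "orthonormal f" "\<And>i j. A i *v f j = d i j *s f j"
    using commuting_unitaries_orthonormal_eigenbasis[of A] assms by (metis SU_iff)
  let ?U = "cols f"
  have U: "unitary ?U" by (rule unitary_cols[OF f(1)])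
  have "A i ** ?U = ?U ** diagm (d i)" for i
    by (simp add: mult_cols f(2) cols_scale)
  then have "ctrans ?U ** A i ** ?U = diagm (d i)" for i
    by (metis matrix_mul_assoc unitary_left[OF U] matrix_mul_lid)
  then have D: "diag_mat (ctrans ?U ** A i ** ctrans (ctrans ?U))" for i
    by (simp add: diag_mat_def diagm_def)
  obtain c where "norm c = 1" "mat c ** ctrans ?U \<in> SU"
    using unitary_scale_SU[OF unitary_ctrans[OF U]] by blast
  with D show ?thesis
    by (intro bexI[of _ "mat c ** ctrans ?U"] allI) (simp only: scale_conj)
qed

section \<open>Diagonal tuples and permutation matrices\<close>

text \<open>A nonzero determinant has a nonzero Leibniz term, that is a permutation \<open>s\<close>
  with all x_{a, s a} nonzero. Comparing the entries (a, s a) of \<open>x ** D i = E i ** x\<close>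
  and cancelling gives the claim. The permutation depends on \<open>x\<close> alone, so one
  \<open>s\<close> serves the whole family.\<close>

lemma diagonal_conj_permutation:
  fixes D E :: "'i \<Rightarrow> complex^'p^'p::finite"
  assumes x: "det x \<noteq> 0" and D: "\<And>i. diag_mat (D i)" "\<And>i. diag_mat (E i)" and eq: "\<And>i. x ** D i = E i ** x"
  shows "\<exists>s. s permutes UNIV \<and> (\<forall>i. E i = permmat s (D i))"
proof -
  obtain s where s: "s permutes UNIV" "(\<Prod>a\<in>UNIV. x $ a $ s a) \<noteq> 0"
    using x unfolding det_def by (metis (no_types, lifting) mem_Collect_eq mult_zero_right sum.neutral)
  then have x0: "x $ a $ s a \<noteq> 0" for a by simp
  have "E i = permmat s (D i)" for i
  proof -
    have l: "(x ** D i) $ a $ b = x $ a $ b * D i $ b $ b" for a b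
    proof -
      have "(\<Sum>k\<in>UNIV. x $ a $ k * D i $ k $ b) = (\<Sum>k\<in>UNIV. if k = b then x $ a $ b * D i $ b $ b else 0)"
        using D(1)[of i] by (intro sum.cong) (auto simp: diag_mat_def)
      then show ?thesis by (simp add: matrix_matrix_mult_def)
    qed
    have r: "(E i ** x) $ a $ b = E i $ a $ a * x $ a $ b" for a b
    proof -
      have "(\<Sum>k\<in>UNIV. E i $ a $ k * x $ k $ b) = (\<Sum>k\<in>UNIV. if k = a then E i $ a $ a * x $ a $ b else 0)"
        using D(2)[of i] by (intro sum.cong) (auto simp: diag_mat_def)
      then show ?thesis by (simp add: matrix_matrix_mult_def)
    qed
    have "D i $ s a $ s a = E i $ a $ a" for a
      using l[of a "s a"] r[of a "s a"] x0[of a] eq[of i] by simp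
    moreover have "D i $ s a $ s b = 0" "E i $ a $ b = 0" if "a \<noteq> b" for a b
      using that D s(1) by (auto simp: diag_mat_def permutes_inj inj_eq)
    ultimately show ?thesis
      unfolding permmat_def vec_eq_iff by (metis vec_lambda_beta)
  qed
  then show ?thesis using s by blast
qed

text \<open>The permutation matrix itself may have determinant -1, so it is rescaled; conjugation
  does not notice.\<close>

lemma permmat_conj_SU:
  assumes s: "s permutes (UNIV::'p::finite set)"
  obtains U where "U \<in> SU" "\<And>A. permmat s A = U ** A ** ctrans U"
proof -
  let ?P = "(\<chi> i j. if j = s i then 1 else 0) :: complex^'p^'p"
  have sum1: "(\<Sum>k\<in>UNIV. (if k = b then 1 else 0) * f k) = f b" for f :: "'p \<Rightarrow> complex" and b
  proof -
    have "(\<Sum>k\<in>UNIV. (if k = b then 1 else 0) * f k) = (\<Sum>k\<in>UNIV. if k = b then f b else 0)"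
      by (intro sum.cong) auto
    then show ?thesis by simp
  qed
  have PA: "?P ** A = (\<chi> i j. A $ s i $ j)" for A
    by (simp add: matrix_matrix_mult_def sum1)
  have AP: "A ** ctrans ?P = (\<chi> i j. A $ i $ s j)" for A
  proof -
    have "(A ** ctrans ?P) $ i $ j = (\<Sum>k\<in>UNIV. (if k = s j then 1 else 0) * A $ i $ k)" for i j
      unfolding matrix_matrix_mult_def ctrans_def by (auto intro!: sum.cong)
    then show ?thesis by (simp add: sum1 vec_eq_iff)
  qed
  have "unitary ?P"
    unfolding unitary_def PA using s by (auto simp: ctrans_def mat_def vec_eq_iff permutes_inj inj_eq)
  then obtain c where c: "norm c = 1" "mat c ** ?P \<in> SU"
    using unitary_scale_SU by blast
  have "permmat s A = (mat c ** ?P) ** A ** ctrans (mat c ** ?P)" for A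
    unfolding scale_conj[OF c(1)] PA AP by (simp add: permmat_def)
  then show ?thesis using c that by blast
qed

subsection \<open>Pairs of unitary matrices commuting up to a root of unity\<close>

text \<open>If two powers agreed, then z^(j - i) = 1 with j - i invertible modulo the prime p, and
  Bezout would give z = 1. In other words, every nontrivial p-th root of unity is primitive.\<close>

lemma prime_root_of_unity_inj:
  fixes z :: complex
  assumes p: "prime p" and z: "z ^ p = 1" "z \<noteq> 1"
  shows "inj_on (\<lambda>i. z ^ i) {..<p}"
proof (rule linorder_inj_onI)
  fix i j assume ij: "i < j" "i \<in> {..<p}" "j \<in> {..<p}"
  show "z ^ i \<noteq> z ^ j"
  proof
    assume eq: "z ^ i = z ^ j"
    have "z \<noteq> 0" using z p by (metis power_0_left prime_gt_0_nat less_not_refl zero_neq_one)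
    have "z ^ j = z ^ i * z ^ (j - i)" using ij by (simp flip: power_add)
    then have 1: "z ^ (j - i) = 1" using eq \<open>z \<noteq> 0\<close> by simp
    have "coprime (j - i) p"
      using p ij by (metis coprime_commute diff_less_mono2 dvd_imp_le lessThan_iff less_imp_diff_less not_less prime_imp_coprime zero_less_diff)
    then obtain x y where "(j - i) * x = p * y + 1"
      using ij bezout_add_strong_nat[of "j - i" p] by (metis coprime_imp_gcd_eq_1 bezout_nat zero_less_diff less_not_refl)
    then have "z ^ ((j - i) * x) = z ^ (p * y + 1)" by simp
    then show False using 1 z by (simp add: power_mult power_add)
  qed
qed auto

lemma prime_root_of_unity_eq_power:
  fixes z w :: complex
  assumes p: "prime p" and z: "z ^ p = 1" "z \<noteq> 1" and w: "w ^ p = 1"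
  obtains u where "u < p" "w = z ^ u"
proof -
  have "(\<lambda>i. z ^ i) ` {..<p} = {w. w ^ p = 1}"
  proof (rule card_subset_eq)
    show "finite {w::complex. w ^ p = 1}"
      using finite_roots_unity[of p] p prime_gt_0_nat[of p] by simp
    show "(\<lambda>i. z ^ i) ` {..<p} \<subseteq> {w. w ^ p = 1}"
      using z(1) by (auto simp: power_mult mult.commute power_commutes simp flip: power_mult) (metis power_mult mult.commute power_one)
    show "card ((\<lambda>i. z ^ i) ` {..<p}) = card {w::complex. w ^ p = 1}"
      using card_image[OF prime_root_of_unity_inj[OF p z]] card_roots_unity_eq[of p] p prime_gt_0_nat[of p] by simp
  qed
  then show ?thesis using w that by (auto simp: set_eq_iff image_iff)
qed

definition zcomm :: "complex \<Rightarrow> complex^'p^'p::finite \<Rightarrow> complex^'p^'p \<Rightarrow> bool" where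
  "zcomm z A C \<longleftrightarrow> A ** C = mat z ** (C ** A)"

lemma zcomm_vec: "zcomm z A C \<Longrightarrow> A *v (C *v y) = z *s (C *v (A *v y))"
  by (simp add: zcomm_def matrix_vector_mul_assoc flip: mat_vec)

lemma zcomm_orbit_eigen:
  assumes zc: "zcomm z A C" and w: "A *v w = l *s w"
  shows "A *v (((*v) C ^^ i) w) = (z ^ i * l) *s ((*v) C ^^ i) w"
  by (induction i) (simp_all add: w zcomm_vec[OF zc] vec.scale vector_smult_assoc mult_ac)

text \<open>Each application of \<open>C\<close> multiplies the eigenvalue of \<open>A\<close> by
  \<open>z\<close>. The p iterates of \<open>w\<close> thus belong to distinct eigenvalues of a
  unitary matrix and are orthogonal; \<open>e\<close> numbers the matrix indices so that they form a
  basis.\<close>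

lemma zcomm_orbit_orthonormal:
  fixes A C :: "complex^'p^'p::finite" and e :: "'p \<Rightarrow> nat"
  assumes p: "prime CARD('p)" and z: "z ^ CARD('p) = 1" "z \<noteq> 1" and zc: "zcomm z A C"
    and AC: "unitary A" "unitary C" and w: "A *v w = l *s w" "cip w w = 1"
    and e: "bij_betw e UNIV {..<CARD('p)}"
  shows "orthonormal (\<lambda>j. ((*v) C ^^ e j) w)"
  unfolding orthonormal_def
proof (intro allI)
  fix i j
  let ?f = "\<lambda>i. ((*v) C ^^ i) w"
  have l0: "l \<noteq> 0"
    using unitary_cip[OF AC(1), of w w] w by (auto simp: cip_scale_left)
  have nrm: "cip (?f k) (?f k) = 1" for k
    by (induction k) (simp_all add: w unitary_cip[OF AC(2)])
  show "cip (?f (e i)) (?f (e j)) = (if i = j then 1 else 0)"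
  proof (cases "i = j")
    case False
    have lt: "e i < CARD('p)" "e j < CARD('p)" using e by (auto simp: bij_betw_def)
    have "e i \<noteq> e j" using False e by (auto simp: bij_betw_def inj_on_def)
    then have "z ^ e i \<noteq> z ^ e j"
      using prime_root_of_unity_inj[OF p z] lt by (auto simp: inj_on_def)
    then have "cip (?f (e i)) (?f (e j)) = 0"
      using l0 nrm[of "e i"]
      by (intro unitary_eigen_orthogonal[OF AC(1) zcomm_orbit_eigen[OF zc w(1)] zcomm_orbit_eigen[OF zc w(1)]]) auto
    then show ?thesis using False by simp
  qed (simp add: nrm)
qed

lemma unit_eigenvector:
  fixes A :: "complex^'p^'p::finite"
  assumes V: "vec.subspace V" and x: "x \<in> V" "x \<noteq> 0" and inv: "\<And>y. y \<in> V \<Longrightarrow> A *v y \<in> V"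
  obtains w l where "w \<in> V" "A *v w = l *s w" "cip w w = 1"
proof -
  obtain v l where v: "v \<in> V" "v \<noteq> 0" "A *v v = l *s v"
    using eigenvector_in_invariant_subspace[OF assms] by blast
  obtain c where c: "c \<noteq> 0" "cip (c *s v) (c *s v) = 1"
    using normalize_vector[OF v(2)] by blast
  show ?thesis
  proof (rule that)
    show "c *s v \<in> V" using V v by (simp add: vec.subspace_scale)
    show "A *v (c *s v) = l *s (c *s v)" using v by (simp add: vec.scale mult.commute)
  qed fact
qed

lemma nat_enum: obtains e :: "'p::finite \<Rightarrow> nat" where "bij_betw e UNIV {..<CARD('p)}"
  using finite_same_card_bij[of "UNIV::'p set" "{..<CARD('p)}"] by auto

text \<open>An invariant subspace contains an eigenvector of \<open>A\<close>, hence its iterates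
  under \<open>C\<close>, hence an orthonormal basis.\<close>

lemma zcomm_irreducible:
  fixes A C :: "complex^'p^'p::finite"
  assumes p: "prime CARD('p)" and z: "z ^ CARD('p) = 1" "z \<noteq> 1" and zc: "zcomm z A C"
    and AC: "unitary A" "unitary C"
    and V: "vec.subspace V" "x \<in> V" "x \<noteq> 0" "\<And>y. y \<in> V \<Longrightarrow> A *v y \<in> V" "\<And>y. y \<in> V \<Longrightarrow> C *v y \<in> V"
  shows "V = UNIV"
proof -
  obtain w l where w: "w \<in> V" "A *v w = l *s w" "cip w w = 1"
    using unit_eigenvector[OF V(1-4)] by blast
  obtain e :: "'p \<Rightarrow> nat" where e: "bij_betw e UNIV {..<CARD('p)}" by (rule nat_enum)
  have "((*v) C ^^ i) w \<in> V" for i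
    by (induction i) (auto simp: w V)
  then show ?thesis
    by (intro subspace_orthonormal_eq_UNIV[OF zcomm_orbit_orthonormal[OF p z zc AC w(2,3) e] V(1)])
qed

text \<open>An eigenspace of \<open>X\<close> is invariant under both matrices, so irreducibility
  makes it the whole space.\<close>

lemma zcomm_schur:
  fixes A C X :: "complex^'p^'p::finite"
  assumes p: "prime CARD('p)" and z: "z ^ CARD('p) = 1" "z \<noteq> 1" and zc: "zcomm z A C"
    and AC: "unitary A" "unitary C" and X: "X ** A = A ** X" "X ** C = C ** X"
  obtains c where "X = mat c"
proof -
  obtain v c where v: "v \<noteq> 0" "X *v v = c *s v"
    using eigenvector_in_invariant_subspace[of UNIV "axis undefined 1" X] by (auto simp: axis_eq_0_iff)
  let ?V = "{x. X *v x = c *s x}"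
  have "X *v (A *v y) = A *v (X *v y)" "X *v (C *v y) = C *v (X *v y)" for y
    by (simp_all add: matrix_vector_mul_assoc X)
  then have "?V = UNIV"
    using v by (intro zcomm_irreducible[OF p z zc AC, of _ v])
      (auto simp: vec.subspace_def matrix_vector_right_distrib vec.scale vector_add_ldistrib mult.commute)
  then have "X *v x = mat c *v x" for x by (auto simp: mat_vec)
  then show ?thesis using that by (metis matrix_eq)
qed

lemma diagm_mult: "diagm a ** diagm b = diagm (\<lambda>i. a i * b i)"
proof -
  have "(\<Sum>k\<in>UNIV. (if i = k then a i else 0) * (if k = j then b k else 0)) =
      (\<Sum>k\<in>UNIV. if k = i then (if i = j then a i * b i else 0) else 0)" for i j
    by (intro sum.cong) auto
  then show ?thesis
    by (simp add: diagm_def matrix_matrix_mult_def vec_eq_iff)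
qed

lemma ctrans_diagm: "ctrans (diagm a) = diagm (\<lambda>i. cnj (a i))"
  by (simp add: diagm_def ctrans_def vec_eq_iff)

lemma det_diagm: "det (diagm d) = (\<Prod>i\<in>UNIV. d i)"
  by (subst det_diagonal) (auto simp: diagm_def)

lemma zcomm_pow_right:
  assumes "zcomm z A C" shows "A *v ((*v) C ^^ i) y = (z ^ i) *s ((*v) C ^^ i) (A *v y)"
  by (induction i) (simp_all add: zcomm_vec[OF assms] vec.scale vector_smult_assoc mult_ac)

text \<open>Choose unit eigenvectors of \<open>A\<close> and \<open>A'\<close> for the same
  eigenvalue and send the basis of iterates under \<open>C\<close> to the one under
  \<open>C'\<close>. This intertwines \<open>A\<close> with \<open>A'\<close> at once, and
  \<open>C\<close> with \<open>C'\<close> except where the cycle of iterates closes; the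
  determinants settle that last vector.\<close>

lemma zcomm_pair_conjugate:
  fixes A C A' C' :: "complex^'p^'p::finite"
  assumes p: "prime CARD('p)" and z: "z ^ CARD('p) = 1" "z \<noteq> 1"
    and zc: "zcomm z A C" "zcomm z A' C'" and S: "A \<in> SU" "C \<in> SU" "A' \<in> SU" "C' \<in> SU"
  obtains U where "U \<in> SU" "U ** A ** ctrans U = A'" "U ** C ** ctrans U = C'"
proof -
  let ?p = "CARD('p)"
  obtain e :: "'p \<Rightarrow> nat" where e: "bij_betw e UNIV {..<?p}" by (rule nat_enum)
  have U: "unitary A" "unitary C" "unitary A'" "unitary C'" using S by (auto simp: SU_iff)
  have eig: "\<exists>w l. A *v w = l *s w \<and> cip w w = 1" for A :: "complex^'p^'p"
    using unit_eigenvector[of UNIV "axis undefined 1" A] by (metis UNIV_I vec.subspace_UNIV axis_eq_0_iff one_neq_zero)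
  obtain w l where w: "A *v w = l *s w" "cip w w = 1" using eig by blast
  obtain w0 l0 where w0: "A' *v w0 = l0 *s w0" "cip w0 w0 = 1" using eig by blast
  \<comment> \<open>In the basis of iterates \<open>A\<close> is diagonal with entries z^i l, so det
    A = 1 fixes l^p. The product of the powers of \<open>z\<close> is the same for both
    pairs.\<close>
  have dd: "l ^ ?p * (\<Prod>i\<in>(UNIV::'p set). z ^ e i) = 1"
    if "A *v w = l *s w" "cip w w = 1" "zcomm z A C" "A \<in> SU" "C \<in> SU" for A C :: "complex^'p^'p" and l w
  proof -
    let ?f = "\<lambda>j. ((*v) C ^^ e j) w"
    have uA: "unitary A" "unitary C" using that by (auto simp: SU_iff)
    have "A ** cols ?f = cols ?f ** diagm (\<lambda>j. z ^ e j * l)"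
      by (simp add: mult_cols zcomm_orbit_eigen[OF that(3,1)] cols_scale)
    then have "det A * det (cols ?f) = det (cols ?f) * det (diagm (\<lambda>j. z ^ e j * l))"
      by (metis det_mul)
    moreover have "norm (det (cols ?f)) = 1"
      by (intro norm_det_unitary unitary_cols zcomm_orbit_orthonormal[OF p z that(3) uA that(1,2) e])
    ultimately have "det (diagm (\<lambda>j. z ^ e j * l)) = 1"
      using that(4) by (auto simp: SU_iff)
    then show ?thesis
      by (simp add: det_diagm prod.distrib mult.commute)
  qed
  have l1: "l ^ ?p * (\<Prod>i\<in>(UNIV::'p set). z ^ e i) = 1" by (rule dd[OF w zc(1) S(1,2)])
  have l2: "l0 ^ ?p * (\<Prod>i\<in>(UNIV::'p set). z ^ e i) = 1" by (rule dd[OF w0 zc(2) S(3,4)])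
  have "l ^ ?p = l0 ^ ?p" using l1 l2 by (metis mult_right_cancel mult_zero_right zero_neq_one)
  moreover have l00: "l0 \<noteq> 0" using l2 by (metis mult_zero_left power_0_left zero_less_card_finite less_not_refl zero_neq_one)
  ultimately have "(l / l0) ^ ?p = 1" by (simp add: power_divide)
  then obtain u where u: "l / l0 = z ^ u" using prime_root_of_unity_eq_power[OF p z] by metis
  \<comment> \<open>The ratio of the two eigenvalues is \<open>z ^ u\<close>, and each step along
    \<open>C'\<close> multiplies the eigenvalue of \<open>A'\<close> by \<open>z\<close>;
    \<open>u\<close> steps turn \<open>l0\<close> into \<open>l\<close>.\<close>
  define w' where "w' = ((*v) C' ^^ u) w0"
  have w': "A' *v w' = l *s w'"
    using zcomm_orbit_eigen[OF zc(2) w0(1), of u] l00 by (simp add: w'_def flip: u)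
  have n': "cip w' w' = 1"
    unfolding w'_def by (induction u) (simp_all add: w0 unitary_cip[OF U(4)])
  let ?f = "\<lambda>i. ((*v) C ^^ i) w" and ?g = "\<lambda>i. ((*v) C' ^^ i) w'"
  let ?F = "cols (\<lambda>j. ?f (e j))" and ?G = "cols (\<lambda>j. ?g (e j))"
  have F: "unitary ?F" by (intro unitary_cols zcomm_orbit_orthonormal[OF p z zc(1) U(1,2) w e])
  have G: "unitary ?G" by (intro unitary_cols zcomm_orbit_orthonormal[OF p z zc(2) U(3,4) w' n' e])
  define V where "V = ?G ** ctrans ?F"
  have V: "unitary V" by (simp add: V_def unitary_mult G F unitary_ctrans)
  have VF: "V ** ?F = ?G"
    unfolding V_def by (simp add: unitary_left[OF F] flip: matrix_mul_assoc)
  then have Vf: "V *v ?f (e j) = ?g (e j)" for j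
    unfolding mult_cols by (simp add: cols_def vec_eq_iff)
  have Vfi: "V *v ?f i = ?g i" if "i < ?p" for i
    using Vf that e by (metis (no_types, lifting) bij_betw_def imageE lessThan_iff)
  have eqI: "X = Y" if "\<And>i. i < ?p \<Longrightarrow> X *v ?f i = Y *v ?f i" for X Y :: "complex^'p^'p"
  proof -
    have "?p > e j" for j using e by (auto simp: bij_betw_def)
    then have "X ** ?F = Y ** ?F" unfolding mult_cols by (simp add: that)
    then have "X ** (?F ** ctrans ?F) = Y ** (?F ** ctrans ?F)" by (simp only: matrix_mul_assoc)
    then show ?thesis using F by (simp add: unitary_def)
  qed
  have VA: "V ** A = A' ** V"
    by (rule eqI) (simp add: zcomm_orbit_eigen[OF zc(1) w(1)] zcomm_orbit_eigen[OF zc(2) w'] Vfi vec.scale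
        flip: matrix_vector_mul_assoc)
  \<comment> \<open>The p-th power of \<open>C\<close> commutes with \<open>A\<close> because z^p =
    1, and with \<open>C\<close>; by Schur it is a scalar. It describes how the cycle of iterates
    closes.\<close>
  have scal: "\<exists>m. \<forall>y. ((*v) C ^^ ?p) y = m *s y" if h: "zcomm z A C" "unitary A" "unitary C" for A C :: "complex^'p^'p"
  proof -
    obtain X where X: "\<And>y. ((*v) C ^^ ?p) y = X *v y"
    proof -
      have "\<exists>X. \<forall>y. ((*v) C ^^ k) y = X *v y" for k
      proof (induction k)
        case 0 show ?case by (intro exI[of _ "mat 1"]) simp
      next
        case (Suc k)
        then obtain X where "\<forall>y. ((*v) C ^^ k) y = X *v y" by blast
        then show ?case by (intro exI[of _ "C ** X"]) (simp add: matrix_vector_mul_assoc)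
      qed
      then show ?thesis using that by blast
    qed
    have "X *v (A *v y) = A *v (X *v y)" for y
      using zcomm_pow_right[OF h(1), of ?p y] z by (simp add: X)
    moreover have "X *v (C *v y) = C *v (X *v y)" for y
      by (simp add: funpow_swap1 flip: X)
    ultimately have "X ** A = A ** X" "X ** C = C ** X"
      by (simp_all add: matrix_eq flip: matrix_vector_mul_assoc)
    then obtain c where "X = mat c" using zcomm_schur[OF p z h] by blast
    then show ?thesis using X by (auto simp: mat_vec)
  qed
  obtain a where a: "\<And>y. ((*v) C ^^ ?p) y = a *s y" using scal[OF zc(1) U(1,2)] by blast
  obtain b where b: "\<And>y. ((*v) C' ^^ ?p) y = b *s y" using scal[OF zc(2) U(3,4)] by blast
  have "b \<noteq> 0"
  proof
    assume "b = 0"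
    have "cip (((*v) C' ^^ k) w') (((*v) C' ^^ k) w') = 1" for k
      by (induction k) (simp_all add: n' unitary_cip[OF U(4)])
    from this[of ?p] show False using \<open>b = 0\<close> by (simp add: b)
  qed
  \<comment> \<open>\<open>V ** C\<close> and \<open>C' ** V\<close> can differ only on the last
    iterate, by the ratio \<open>a / b\<close> of the two closing scalars. This ratio is the
    determinant of \<open>diagm r\<close>, and comparing determinants shows that it is 1.\<close>
  define r where "r j = (if Suc (e j) = ?p then a / b else 1)" for j
  have "V *v (C *v ?f (e j)) = r j *s (C' *v ?g (e j))" for j
  proof (cases "Suc (e j) = ?p")
    case True
    have "C *v ?f (e j) = ((*v) C ^^ Suc (e j)) w" by simp
    also have "\<dots> = a *s w" unfolding True by (rule a)
    finally have "V *v (C *v ?f (e j)) = a *s (V *v w)" by (simp only: vec.scale)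
    also have "V *v w = w'" using Vfi[of 0] by simp
    also have "a *s w' = r j *s (b *s w')"
      using True \<open>b \<noteq> 0\<close> by (simp add: r_def)
    also have "b *s w' = ?g (Suc (e j))"
      unfolding True by (rule b[symmetric])
    finally show ?thesis by simp
  next
    case False
    have "e j < ?p" using e by (auto simp: bij_betw_def)
    then have "Suc (e j) < ?p" using False by simp
    from Vfi[OF this] show ?thesis using False by (simp add: r_def)
  qed
  then have VC: "V ** C ** ?F = C' ** ?G ** diagm r"
    by (simp add: mult_cols cols_scale flip: matrix_mul_assoc matrix_vector_mul_assoc)
  then have "det V * det C * det ?F = det C' * det ?G * det (diagm r)"
    by (metis det_mul)
  moreover have "det V * det ?F = det ?G" using VF by (metis det_mul)
  moreover have "det ?G \<noteq> 0" using norm_det_unitary[OF G] by auto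
  ultimately have "det (diagm r) = 1" using S by (auto simp: SU_iff)
  moreover have "det (diagm r) = a / b"
  proof -
    have "?p - 1 \<in> e ` UNIV" using e by (simp add: bij_betw_def)
    then obtain j0 where "e j0 = ?p - 1" by auto
    then have j0: "Suc (e j0) = ?p" by (metis Suc_pred' zero_less_card_finite)
    have "Suc (e j) = ?p \<longleftrightarrow> j = j0" for j
      using j0 e by (auto simp: bij_betw_def inj_on_def)
    then show ?thesis by (simp add: det_diagm r_def)
  qed
  ultimately have "r = (\<lambda>_. 1)" by (auto simp: r_def)
  then have "diagm r = mat 1" by (simp add: diagm_def mat_def)
  then have "(V ** C) ** ?F = (C' ** V) ** ?F"
    using VC VF by (simp flip: matrix_mul_assoc)
  then have "(V ** C) ** (?F ** ctrans ?F) = (C' ** V) ** (?F ** ctrans ?F)" by (simp only: matrix_mul_assoc)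
  then have VC: "V ** C = C' ** V" using F by (simp add: unitary_def)
  have fin: "V ** A ** ctrans V = A'" "V ** C ** ctrans V = C'"
    using V by (simp_all add: VA VC unitary_def flip: matrix_mul_assoc)
  obtain c where "norm c = 1" "mat c ** V \<in> SU" using unitary_scale_SU[OF V] by blast
  then show ?thesis using that[of "mat c ** V"] fin by (simp add: scale_conj)
qed

text \<open>Conjugating the clock matrix diag(1, z, z^2, ...) by the cyclic shift multiplies it by
  \<open>z\<close>, consistently at the wrap-around since z^p = 1. Rescaling to determinant 1 keeps
  the relation. The shift is the first matrix of the pair, the clock the second.\<close>

lemma zcomm_pair_exists:
  assumes z: "z ^ CARD('p) = 1"
  obtains A C :: "complex^'p^'p::finite" where "A \<in> SU" "C \<in> SU" "zcomm z A C"
proof -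
  let ?p = "CARD('p)"
  obtain e :: "'p \<Rightarrow> nat" where e: "bij_betw e UNIV {..<?p}" by (rule nat_enum)
  define s where "s i = inv_into UNIV e (Suc (e i) mod ?p)" for i
  have es: "e (s i) = Suc (e i) mod ?p" for i
    unfolding s_def using e by (intro f_inv_into_f) (auto simp: bij_betw_def)
  have elt: "e i < ?p" for i using e by (auto simp: bij_betw_def)
  have "inj s"
  proof (rule injI)
    fix i j assume "s i = s j"
    then have "Suc (e i) mod ?p = Suc (e j) mod ?p" by (metis es)
    then have "e i = e j"
      using elt[of i] elt[of j] by (auto simp: mod_Suc split: if_splits)
    then show "i = j" using e by (auto simp: bij_betw_def inj_on_def)
  qed
  then have s: "s permutes UNIV"
    by (intro bij_imp_permutes) (auto simp: bij_def finite_UNIV_inj_surj)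
  let ?A = "diagm (\<lambda>i. z ^ e i)"
  have nz: "norm z = 1"
    using arg_cong[OF z, of norm] power_eq_iff_eq_base[of ?p "norm z" 1] by (simp add: norm_power)
  have uA: "unitary ?A"
  proof -
    have "z ^ k * cnj (z ^ k) = 1" for k
      using complex_norm_square[of "z ^ k"] nz by (simp add: norm_power)
    then show ?thesis
      unfolding unitary_def diagm_mult ctrans_diagm by (simp add: diagm_def mat_def)
  qed
  obtain U where U: "U \<in> SU" "\<And>A. permmat s A = U ** A ** ctrans U"
    using permmat_conj_SU[OF s] by blast
  obtain c where c: "norm c = 1" "mat c ** ?A \<in> SU"
    using unitary_scale_SU[OF uA] by blast
  have zs: "z ^ e (s i) = z * z ^ e i" for i
  proof -
    have "z ^ (Suc (e i) mod ?p) = z ^ Suc (e i)"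
      using div_mult_mod_eq[of "Suc (e i)" ?p] z
      by (metis mult.commute mult_1 power_add power_mult power_one)
    then show ?thesis by (simp add: es)
  qed
  have "permmat s ?A = mat z ** ?A"
    using permutes_inj[OF s] by (auto simp: permmat_def diagm_def mat_mult_left vec_eq_iff zs inj_eq)
  then have "U ** ?A ** (ctrans U ** U) = mat z ** ?A ** U"
    unfolding U(2) by (simp only: matrix_mul_assoc)
  then have UA: "U ** ?A = mat z ** (?A ** U)"
    using unitary_left[of U] U(1) by (simp add: SU_iff flip: matrix_mul_assoc)
  have "zcomm z U (mat c ** ?A)"
  proof -
    have "U ** (mat c ** ?A) = mat c ** (U ** ?A)"
      by (simp only: matrix_mul_assoc mat_commute[of c U])
    also have "\<dots> = mat z ** (mat c ** ?A ** U)"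
      unfolding UA by (simp only: matrix_mul_assoc mat_commute[of c "mat z"])
    finally show ?thesis by (simp add: zcomm_def)
  qed
  then show ?thesis using that U(1) c(2) by blast
qed

subsection \<open>Quotient and sum topologies\<close>

lemma openin_qtop:
  "openin (qtop X f) U \<longleftrightarrow> U \<subseteq> f ` topspace X \<and> openin X {x \<in> topspace X. f x \<in> U}"
proof -
  have "istopology (\<lambda>U. U \<subseteq> f ` topspace X \<and> openin X {x \<in> topspace X. f x \<in> U})"
    unfolding istopology_def
  proof (intro conjI allI impI)
    fix S T assume "S \<subseteq> f ` topspace X \<and> openin X {x \<in> topspace X. f x \<in> S}"
      and "T \<subseteq> f ` topspace X \<and> openin X {x \<in> topspace X. f x \<in> T}"
    moreover have "{x \<in> topspace X. f x \<in> S \<inter> T} = {x \<in> topspace X. f x \<in> S} \<inter> {x \<in> topspace X. f x \<in> T}"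
      by auto
    ultimately show "S \<inter> T \<subseteq> f ` topspace X" "openin X {x \<in> topspace X. f x \<in> S \<inter> T}"
      by auto
  next
    fix K assume K: "\<forall>S\<in>K. S \<subseteq> f ` topspace X \<and> openin X {x \<in> topspace X. f x \<in> S}"
    then show "\<Union>K \<subseteq> f ` topspace X" by auto
    have "{x \<in> topspace X. f x \<in> \<Union>K} = (\<Union>S\<in>K. {x \<in> topspace X. f x \<in> S})"
      by auto
    then show "openin X {x \<in> topspace X. f x \<in> \<Union>K}"
      using K by auto
  qed
  then show ?thesis
    by (simp add: qtop_def)
qed

lemma topspace_qtop [simp]: "topspace (qtop X f) = f ` topspace X"
proof -
  have "openin (qtop X f) (f ` topspace X)"
  proof -
    have "{x \<in> topspace X. f x \<in> f ` topspace X} = topspace X" by auto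
    then show ?thesis by (simp add: openin_qtop)
  qed
  moreover have "topspace (qtop X f) \<subseteq> f ` topspace X"
    by (metis openin_qtop openin_topspace)
  ultimately show ?thesis
    using openin_subset by blast
qed

lemma quotient_map_qtop: "quotient_map X (qtop X f) f"
  by (auto simp: quotient_map_def openin_qtop)

lemma closedin_qtop:
  assumes "C \<subseteq> f ` topspace X"
  shows "closedin (qtop X f) C \<longleftrightarrow> closedin X {x \<in> topspace X. f x \<in> C}"
  using quotient_map_qtop[of X f] assms by (simp add: quotient_map_closedin)

lemma openin_dunion:
  "openin (dunion X Y) U \<longleftrightarrow> U \<subseteq> Inl ` topspace X \<union> Inr ` topspace Y
      \<and> openin X (Inl -` U) \<and> openin Y (Inr -` U)"
proof -
  have "istopology (\<lambda>U. U \<subseteq> Inl ` topspace X \<union> Inr ` topspace Y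
      \<and> openin X (Inl -` U) \<and> openin Y (Inr -` U))"
    unfolding istopology_def
  proof (intro conjI allI impI)
    fix K assume K: "\<forall>S\<in>K. S \<subseteq> Inl ` topspace X \<union> Inr ` topspace Y \<and> openin X (Inl -` S) \<and> openin Y (Inr -` S)"
    then show "\<Union>K \<subseteq> Inl ` topspace X \<union> Inr ` topspace Y" by auto
    show "openin X (Inl -` \<Union>K)" "openin Y (Inr -` \<Union>K)"
      unfolding vimage_Union using K by auto
  qed (auto simp: vimage_Int)
  then show ?thesis
    by (simp add: dunion_def)
qed

lemma topspace_dunion [simp]: "topspace (dunion X Y) = Inl ` topspace X \<union> Inr ` topspace Y"
proof -
  have "Inl -` (Inl ` topspace X \<union> Inr ` topspace Y) = topspace X"
    "Inr -` (Inl ` topspace X \<union> Inr ` topspace Y) = topspace Y" by auto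
  then have "openin (dunion X Y) (Inl ` topspace X \<union> Inr ` topspace Y)"
    by (simp add: openin_dunion)
  moreover have "topspace (dunion X Y) \<subseteq> Inl ` topspace X \<union> Inr ` topspace Y"
    by (metis openin_dunion openin_topspace)
  ultimately show ?thesis
    using openin_subset by blast
qed

lemma closedin_dunion_Inl: "closedin (dunion X Y) C \<Longrightarrow> closedin X (Inl -` C)"
proof -
  assume C: "closedin (dunion X Y) C"
  then have "openin X (Inl -` (topspace (dunion X Y) - C))"
    by (simp add: closedin_def openin_dunion)
  moreover have "Inl -` (topspace (dunion X Y) - C) = topspace X - Inl -` C"
    by auto
  moreover have "Inl -` C \<subseteq> topspace X"
    using closedin_subset[OF C] by auto
  ultimately show ?thesis by (simp add: closedin_def)
qed

text \<open>The two maps combine to a continuous closed bijection. Closedness on the discrete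
  summand costs nothing: every subset of the finite set \<open>P\<close> is a finite union of closed
  points.\<close>

lemma homeomorphic_dunion_discrete:
  assumes f: "continuous_map X R f" "closed_map X R f" "inj_on f (topspace X)"
    and P: "finite P" "\<And>x. x \<in> P \<Longrightarrow> closedin R {x}"
    and R: "topspace R = f ` topspace X \<union> P" "f ` topspace X \<inter> P = {}"
    and h: "bij_betw h Y P"
  shows "R homeomorphic_space dunion X (discrete_topology Y)"
proof -
  let ?F = "case_sum f h" and ?D = "dunion X (discrete_topology Y)"
  have PR: "P \<subseteq> topspace R" using R by auto
  have hP: "h ` Y = P" "inj_on h Y" using h by (auto simp: bij_betw_def)
  have "homeomorphic_map ?D R ?F"
  proof (rule bijective_closed_imp_homeomorphic_map)
    show "continuous_map ?D R ?F"
      unfolding continuous_map_def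
    proof (intro conjI allI impI)
      show "?F \<in> topspace ?D \<rightarrow> topspace R"
        using R hP by auto
      fix U assume U: "openin R U"
      have "Inl -` {x \<in> topspace ?D. ?F x \<in> U} = {x \<in> topspace X. f x \<in> U}"
        "Inr -` {x \<in> topspace ?D. ?F x \<in> U} = {x \<in> Y. h x \<in> U}" by auto
      then show "openin ?D {x \<in> topspace ?D. ?F x \<in> U}"
        using f(1) U by (auto simp: openin_dunion continuous_map_def)
    qed
    show "closed_map ?D R ?F"
      unfolding closed_map_def
    proof (intro allI impI)
      fix C assume C: "closedin ?D C"
      have "?F ` C = f ` (Inl -` C) \<union> h ` (Inr -` C)"
        by (force simp: image_iff split: sum.splits)
      moreover have "closedin R (f ` (Inl -` C))"
        using f(2) closedin_dunion_Inl[OF C] by (simp add: closed_map_def)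
      moreover have "closedin R (h ` (Inr -` C))"
      proof -
        have "h ` (Inr -` C) \<subseteq> P" using closedin_subset[OF C] hP by auto
        then have "closedin R (\<Union>x\<in>h ` (Inr -` C). {x})"
          using P by (intro closedin_Union) (auto intro: finite_subset)
        then show ?thesis by simp
      qed
      ultimately show "closedin R (?F ` C)" by (metis closedin_Un)
    qed
    show "?F ` topspace ?D = topspace R"
      using R hP by (auto simp: image_Un image_image)
    have ne: "f x \<noteq> h y" if "x \<in> topspace X" "y \<in> Y" for x y
      using R(2) hP that by blast
    show "inj_on ?F (topspace ?D)"
    proof (rule inj_onI)
      fix a b assume "a \<in> topspace ?D" "b \<in> topspace ?D" "?F a = ?F b"
      then show "a = b"
        using ne ne[symmetric] inj_onD[OF f(3)] inj_onD[OF hP(2)] by (cases a; cases b) auto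
    qed
  qed
  then show ?thesis
    using homeomorphic_map_imp_homeomorphic_space homeomorphic_space_sym by blast
qed

text \<open>Finitely many disjoint closed pieces cover the space, so each piece is also open, and a
  path-connected clopen set is a full path component.\<close>

lemma path_components_of_isolated_points:
  assumes P: "finite P" "\<And>x. x \<in> P \<Longrightarrow> closedin R {x}"
    and Z: "closedin R Z" "path_connectedin R Z" "Z \<noteq> {}"
    and R: "topspace R = Z \<union> P" "Z \<inter> P = {}"
  shows "path_components_of R = insert Z ((\<lambda>x. {x}) ` P)"
proof -
  have cl: "closedin R Q" if "Q \<subseteq> P" for Q
  proof -
    have "closedin R (\<Union>x\<in>Q. {x})"
      using P that by (intro closedin_Union) (auto intro: finite_subset)
    then show ?thesis by simp
  qed
  have opZ: "openin R Z"
  proof -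
    have "topspace R - Z = P" using R by auto
    then show ?thesis using cl[of P] R by (simp add: openin_closedin_eq)
  qed
  have opP: "openin R {x}" if "x \<in> P" for x
  proof -
    have "topspace R - {x} = Z \<union> (P - {x})" using R that by auto
    then show ?thesis
      using cl[of "P - {x}"] Z(1) that R by (auto simp: openin_closedin_eq)
  qed
  \<comment> \<open>A path component is connected and cannot leave a clopen set that it meets;
    conversely it contains every path-connected set through \<open>x\<close>.\<close>
  have comp: "path_component_of_set R x = S"
    if S: "openin R S" "closedin R S" "path_connectedin R S" "x \<in> S" for x S
  proof
    show "S \<subseteq> path_component_of_set R x"
      using S by (simp add: path_component_of_maximal)
    have "connectedin R (path_component_of_set R x)"
      by (simp add: path_connectedin_path_component_of path_connectedin_imp_connectedin)
    moreover have "x \<in> path_component_of_set R x"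
      using S closedin_subset path_component_of_refl by (metis mem_Collect_eq subsetD)
    ultimately show "path_component_of_set R x \<subseteq> S"
      using connectedin_clopen_cases[of R "path_component_of_set R x" S] S by (auto simp: disjnt_iff)
  qed
  have "path_components_of R = path_component_of_set R ` (Z \<union> P)"
    by (simp add: path_components_of_def R)
  also have "\<dots> = path_component_of_set R ` Z \<union> path_component_of_set R ` P"
    by auto
  also have "path_component_of_set R ` Z = {Z}"
    using comp[OF opZ Z(1,2)] Z(3) by auto
  also have "path_component_of_set R ` P = (\<lambda>x. {x}) ` P"
  proof (rule image_cong[OF refl])
    fix x assume "x \<in> P"
    then show "path_component_of_set R x = {x}"
      using comp[of "{x}" x] opP P(2) R by simp
  qed
  finally show ?thesis by simp
qed

subsection \<open>The group and its conjugation action\<close>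

lemma SU_mult: "A \<in> SU \<Longrightarrow> B \<in> SU \<Longrightarrow> A ** B \<in> SU"
  by (simp add: SU_iff unitary_mult det_mul)

lemma SU_ctrans: "A \<in> SU \<Longrightarrow> ctrans A \<in> SU"
  by (simp add: SU_iff unitary_ctrans det_ctrans)

lemma SU_inverse: "A \<in> SU \<Longrightarrow> A ** ctrans A = mat 1" "A \<in> SU \<Longrightarrow> ctrans A ** A = mat 1"
  by (simp_all add: SU_iff unitary_left) (simp add: unitary_def)

lemma SU_matrix_inv: "A \<in> SU \<Longrightarrow> matrix_inv A = ctrans A"
proof -
  assume A: "A \<in> SU"
  then have "A ** matrix_inv A = mat 1"
    unfolding matrix_inv_def using SU_inverse[OF A] by (metis (mono_tags, lifting) someI_ex)
  then have "ctrans A ** A ** matrix_inv A = ctrans A"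
    by (simp flip: matrix_mul_assoc)
  then show ?thesis using A by (simp add: SU_inverse)
qed

lemma root_of_unity_norm: "w ^ CARD('p::finite) = 1 \<Longrightarrow> norm (w::complex) = 1"
  using power_eq_iff_eq_base[of "CARD('p)" "norm w" 1] by (metis norm_power norm_one power_one zero_less_card_finite norm_ge_zero zero_le_one)

lemma SU_mat: "w ^ CARD('p) = 1 \<Longrightarrow> (mat w :: complex^'p^'p::finite) \<in> SU"
  by (simp add: SU_iff det_mat unitary_mat root_of_unity_norm)

lemma SU_mat_iff: "(mat w :: complex^'p^'p::finite) \<in> SU \<longleftrightarrow> w ^ CARD('p) = 1"
  using SU_mat[of w] by (auto simp: SU_iff det_mat)

text \<open>For \<open>w\<close> a \<open>CARD('p)\<close>-th root of unity this is multiplication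
  by an element of \<open>Delta\<close>; cosets thereby become explicit scalar ambiguities.\<close>

definition smul :: "complex \<Rightarrow> ('p::finite,'m::finite) elt \<Rightarrow> ('p,'m) elt" where
  "smul w g = (\<chi> k. mat w ** g $ k)"

text \<open>Written with \<open>ctrans\<close> in place of an inverse: on \<open>SUm\<close> it is
  conjugation, and it is visibly continuous on all matrices.\<close>

definition gconj :: "('p::finite,'m::finite) elt \<Rightarrow> ('p,'m) elt \<Rightarrow> ('p,'m) elt" where
  "gconj x g = (\<chi> k. x $ k ** g $ k ** ctrans (x $ k))"

definition gone :: "('p::finite,'m::finite) elt" where
  "gone = (\<chi> k. mat 1)"

lemma smul_1 [simp]: "smul 1 g = g"
  by (simp add: smul_def)

lemma smul_smul: "smul v (smul w g) = smul (v * w) g"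
  by (simp add: smul_def matrix_mul_assoc mat_mat)

lemma gclass_smul: "gclass (g :: ('p::finite,'m::finite) elt) = {smul w g |w. w ^ CARD('p) = 1}"
proof -
  have "gmul (\<chi> k. mat w) g = smul w g" for w by (simp add: gmul_def smul_def)
  then show ?thesis unfolding gclass_def Delta_def by (auto; metis)
qed

lemma gmul_smul: "gmul (smul v g) (smul w h) = smul (v * w) (gmul g (h :: ('p::finite,'m::finite) elt))"
proof -
  have "mat v ** A ** (mat w ** B) = mat (v * w) ** (A ** B)" for A B :: "complex^'p^'p"
  proof -
    have "mat v ** A ** (mat w ** B) = mat v ** (A ** mat w) ** B"
      by (simp only: matrix_mul_assoc)
    also have "\<dots> = mat v ** mat w ** (A ** B)"
      unfolding mat_commute[of w A, symmetric] by (simp only: matrix_mul_assoc)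
    finally show ?thesis by (simp only: mat_mat)
  qed
  then show ?thesis by (simp add: gmul_def smul_def)
qed

lemma gclass_eq_iff:
  fixes g h :: "('p::finite,'m::finite) elt"
  shows "gclass g = gclass h \<longleftrightarrow> (\<exists>w. w ^ CARD('p) = 1 \<and> g = smul w h)"
proof
  have "g = smul 1 g" by simp
  then have "g \<in> gclass g" unfolding gclass_smul by (metis (mono_tags, lifting) mem_Collect_eq power_one)
  moreover assume "gclass g = gclass h"
  ultimately show "\<exists>w. w ^ CARD('p) = 1 \<and> g = smul w h" by (auto simp: gclass_smul)
next
  assume "\<exists>w. w ^ CARD('p) = 1 \<and> g = smul w h"
  then obtain w where w: "w ^ CARD('p) = 1" "g = smul w h" by blast
  have w0: "w \<noteq> 0" using w(1) by (metis power_0_left zero_less_card_finite less_not_refl zero_neq_one)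
  have "\<exists>v'. smul v g = smul v' h \<and> v' ^ CARD('p) = 1" if "v ^ CARD('p) = 1" for v
    using that w by (intro exI[of _ "v * w"]) (simp add: smul_smul power_mult_distrib)
  moreover have "\<exists>v'. smul v h = smul v' g \<and> v' ^ CARD('p) = 1" if "v ^ CARD('p) = 1" for v
    using that w w0 by (intro exI[of _ "v / w"]) (simp add: smul_smul power_divide)
  ultimately show "gclass g = gclass h" unfolding gclass_smul by auto
qed

lemma smul_SUm: "w ^ CARD('p) = 1 \<Longrightarrow> (g :: ('p::finite,'m::finite) elt) \<in> SUm \<Longrightarrow> smul w g \<in> SUm"
  by (simp add: SUm_def smul_def SU_mult SU_mat)

lemma gmul_SUm: "g \<in> SUm \<Longrightarrow> h \<in> SUm \<Longrightarrow> gmul g h \<in> SUm"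
  by (simp add: SUm_def gmul_def SU_mult)

lemma gconj_SUm: "x \<in> SUm \<Longrightarrow> g \<in> SUm \<Longrightarrow> gconj x g \<in> SUm"
  by (simp add: SUm_def gconj_def SU_mult SU_ctrans)

lemma gone_SUm: "gone \<in> SUm"
  by (simp add: SUm_def gone_def SU_mat)

lemma gconj_gone [simp]: "gconj gone g = g"
  by (simp add: gconj_def gone_def ctrans_mat)

lemma gconj_gmul: "gconj x (gconj y g) = gconj (gmul x y) g"
  by (simp add: gconj_def gmul_def ctrans_mult matrix_mul_assoc)

lemma gconj_inverse:
  assumes "x \<in> SUm"
  obtains y where "y \<in> SUm" "\<And>g. gconj y (gconj x g) = g" "\<And>g. gconj x (gconj y g) = g"
proof
  let ?y = "(\<chi> k. ctrans (x $ k))"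
  show "?y \<in> SUm" using assms by (simp add: SUm_def SU_ctrans)
  have "gmul ?y x = gone" "gmul x ?y = gone"
    using assms by (simp_all add: gmul_def gone_def SUm_def SU_inverse)
  then show "gconj ?y (gconj x g) = g" "gconj x (gconj ?y g) = g" for g
    by (simp_all add: gconj_gmul)
qed

lemma gconj_smul: "gconj x (smul w g) = smul w (gconj x (g :: ('p::finite,'m::finite) elt))"
proof -
  have "A ** (mat w ** B) ** C = mat w ** (A ** B ** C)" for A B C :: "complex^'p^'p"
    unfolding matrix_mul_assoc mat_commute[of w A] ..
  then show ?thesis by (simp add: gconj_def smul_def)
qed

lemma cmul_gclass: "cmul (gclass g) (gclass h) = gclass (gmul g (h :: ('p::finite,'m::finite) elt))"
proof -
  have "\<exists>v. gmul (smul a g) (smul b h) = smul v (gmul g h) \<and> v ^ CARD('p) = 1"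
    if "a ^ CARD('p) = 1" "b ^ CARD('p) = 1" for a b
    using that by (intro exI[of _ "a * b"]) (simp add: gmul_smul power_mult_distrib)
  moreover have "smul a (gmul g h) = gmul (smul a g) (smul 1 h)" for a
    unfolding gmul_smul by simp
  ultimately show ?thesis
    unfolding cmul_def gclass_smul by (auto; metis power_one)
qed

lemma cinv_gclass:
  fixes g :: "('p::finite,'m::finite) elt"
  assumes "g \<in> SUm"
  shows "cinv (gclass g) = gclass (\<chi> k. ctrans (g $ k))"
proof -
  let ?i = "(\<chi> k. ctrans (g $ k)) :: ('p,'m) elt"
  have "ginv (smul w g) = smul (cnj w) ?i" if "w ^ CARD('p) = 1" for w
    using smul_SUm[OF that assms]
    by (simp add: ginv_def SUm_def SU_matrix_inv smul_def ctrans_mult ctrans_mat mat_commute)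
  moreover have "cnj w ^ CARD('p) = 1" if "w ^ CARD('p) = 1" for w
    using that by (metis complex_cnj_power complex_cnj_one)
  ultimately show ?thesis
    unfolding cinv_def gclass_smul by (auto simp: image_iff) (metis complex_cnj_cnj)
qed

lemma cconj_gclass:
  "x \<in> SUm \<Longrightarrow> cconj (gclass x) (gclass g) = gclass (gconj x g)"
  by (simp add: cconj_def cinv_gclass cmul_gclass) (simp add: gmul_def gconj_def)

lemma conj_orbit_gclass:
  "conj_orbit (\<lambda>i. gclass (g i)) = {\<lambda>i. gclass (gconj x (g i)) | x. x \<in> SUm}"
  by (auto simp: conj_orbit_def Gcarrier_def cconj_gclass)

lemma Gcarrier_tuple:
  assumes "\<And>i. t i \<in> Gcarrier"
  obtains g where "t = (\<lambda>i. gclass (g i))" "\<And>i. g i \<in> SUm"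
proof -
  have "\<forall>i. \<exists>g. t i = gclass g \<and> g \<in> SUm" using assms by (auto simp: Gcarrier_def)
  then obtain g where "\<forall>i. t i = gclass (g i) \<and> g i \<in> SUm" by metis
  then show ?thesis using that[of g] by auto
qed

text \<open>Each coordinate is a coset of its own, so the scalar relating \<open>g i\<close> to
  \<open>gconj x (h i)\<close> may depend on \<open>i\<close>. Scalars pass through
  \<open>gconj\<close>, and conjugating back by the inverse of \<open>x\<close> gives the second
  inclusion.\<close>

lemma conj_orbit_eq_iff:
  fixes g h :: "'n \<Rightarrow> ('p::finite,'m::finite) elt"
  assumes "\<And>i. g i \<in> SUm" "\<And>i. h i \<in> SUm"
  shows "conj_orbit (\<lambda>i. gclass (g i)) = conj_orbit (\<lambda>i. gclass (h i))
    \<longleftrightarrow> (\<exists>x\<in>SUm. \<forall>i. gclass (g i) = gclass (gconj x (h i)))"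
proof
  have "(\<lambda>i. gclass (g i)) = (\<lambda>i. gclass (gconj gone (g i)))" by simp
  then have "(\<lambda>i. gclass (g i)) \<in> conj_orbit (\<lambda>i. gclass (g i))"
    unfolding conj_orbit_gclass using gone_SUm by blast
  moreover assume "conj_orbit (\<lambda>i. gclass (g i)) = conj_orbit (\<lambda>i. gclass (h i))"
  ultimately show "\<exists>x\<in>SUm. \<forall>i. gclass (g i) = gclass (gconj x (h i))"
    unfolding conj_orbit_gclass by (auto dest: fun_cong)
next
  have gc: "gclass (gconj y a) = gclass (gconj y b)" if "gclass a = gclass b" for y a b :: "('p,'m) elt"
    using that unfolding gclass_eq_iff by (auto simp: gconj_smul)
  assume "\<exists>x\<in>SUm. \<forall>i. gclass (g i) = gclass (gconj x (h i))"
  then obtain x where x: "x \<in> SUm" "\<And>i. gclass (g i) = gclass (gconj x (h i))" by blast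
  obtain y where y: "y \<in> SUm" "\<And>g. gconj y (gconj x g) = g" "\<And>g. gconj x (gconj y g) = g"
    using gconj_inverse[OF x(1)] by blast
  have 1: "gclass (gconj a (g i)) = gclass (gconj (gmul a x) (h i))" for a i
    using gc[OF x(2)] by (simp add: gconj_gmul)
  have 2: "gclass (gconj a (h i)) = gclass (gconj (gmul a y) (g i))" for a i
    using gc[OF x(2), of "gmul a y"] by (metis gconj_gmul y(2))
  show "conj_orbit (\<lambda>i. gclass (g i)) = conj_orbit (\<lambda>i. gclass (h i))"
  proof
    show "conj_orbit (\<lambda>i. gclass (g i)) \<subseteq> conj_orbit (\<lambda>i. gclass (h i))"
      unfolding conj_orbit_gclass 1 using gmul_SUm x(1) by blast
    show "conj_orbit (\<lambda>i. gclass (h i)) \<subseteq> conj_orbit (\<lambda>i. gclass (g i))"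
      unfolding conj_orbit_gclass 2 using gmul_SUm y(1) by blast
  qed
qed

definition Hom_set :: "('n \<Rightarrow> ('p::finite,'m::finite) elt set) set" where
  "Hom_set = {t. (\<forall>i. t i \<in> Gcarrier) \<and> (\<forall>i j. cmul (t i) (t j) = cmul (t j) (t i))}"

text \<open>The scalar \<open>w\<close> is the same in all factors because \<open>Delta\<close> is
  the diagonal copy of the centre; this is what commuting of cosets means for their lifts.\<close>

definition zcommg :: "complex \<Rightarrow> ('p::finite,'m::finite) elt \<Rightarrow> ('p,'m) elt \<Rightarrow> bool" where
  "zcommg w g h \<longleftrightarrow> (\<forall>k. zcomm w (g $ k) (h $ k))"

lemma gclass_Hom_set_iff:
  fixes g :: "'n \<Rightarrow> ('p::finite,'m::finite) elt"
  assumes "\<And>i. g i \<in> SUm"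
  shows "(\<lambda>i. gclass (g i)) \<in> Hom_set \<longleftrightarrow> (\<forall>i j. \<exists>w. w ^ CARD('p) = 1 \<and> zcommg w (g i) (g j))"
  using assms by (auto simp: Hom_set_def Gcarrier_def cmul_gclass gclass_eq_iff zcommg_def zcomm_def
      gmul_def smul_def vec_eq_iff[where 'b='m])

lemma Hom_set_cases:
  assumes "t \<in> Hom_set"
  obtains g where "t = (\<lambda>i. gclass (g i))" "\<And>i. g i \<in> SUm"
  using assms Gcarrier_tuple[of t] by (auto simp: Hom_set_def)

lemma zcommg_smul:
  fixes g h :: "('p::finite,'m::finite) elt"
  shows "a \<noteq> 0 \<Longrightarrow> b \<noteq> 0 \<Longrightarrow> zcommg w (smul a g) (smul b h) \<longleftrightarrow> zcommg w g h"
proof -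
  assume ab: "a \<noteq> 0" "b \<noteq> 0"
  have c: "mat c ** X = mat c ** Y \<longleftrightarrow> X = Y" if "c \<noteq> 0" for c and X Y :: "complex^'p^'p"
    using that by (auto simp: mat_mult_left vec_eq_iff)
  have "zcommg w (smul a g) (smul b h) \<longleftrightarrow> (\<forall>k. gmul (smul a g) (smul b h) $ k = mat w ** gmul (smul b h) (smul a g) $ k)"
    by (simp add: zcommg_def zcomm_def gmul_def)
  also have "\<dots> \<longleftrightarrow> (\<forall>k. mat (a * b) ** (g $ k ** h $ k) = mat (a * b) ** (mat w ** (h $ k ** g $ k)))"
    unfolding gmul_smul by (simp add: smul_def gmul_def mult.commute matrix_mul_assoc mat_mat)
  finally show ?thesis
    using ab by (simp add: c zcommg_def zcomm_def)
qed

lemma zcommg_gconj: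
  fixes x :: "('p::finite,'m::finite) elt"
  shows "x \<in> SUm \<Longrightarrow> zcommg w (gconj x g) (gconj x h) \<longleftrightarrow> zcommg w g h"
proof -
  assume x: "x \<in> SUm"
  have i: "ctrans (x $ k) ** x $ k = mat 1" for k using x by (simp add: SUm_def SU_inverse)
  have e: "x $ k ** A ** ctrans (x $ k) ** (x $ k ** B ** ctrans (x $ k)) = x $ k ** (A ** B) ** ctrans (x $ k)" for A B k
  proof -
    have "x $ k ** A ** ctrans (x $ k) ** (x $ k ** B ** ctrans (x $ k))
      = x $ k ** A ** (ctrans (x $ k) ** x $ k) ** B ** ctrans (x $ k)" by (simp only: matrix_mul_assoc)
    then show ?thesis by (simp add: i matrix_mul_assoc)
  qed
  have c: "x $ k ** A ** ctrans (x $ k) = x $ k ** B ** ctrans (x $ k) \<longleftrightarrow> A = B" for A B k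
  proof
    assume "x $ k ** A ** ctrans (x $ k) = x $ k ** B ** ctrans (x $ k)"
    moreover have "(ctrans (x $ k) ** x $ k) ** Y ** (ctrans (x $ k) ** x $ k) = ctrans (x $ k) ** (x $ k ** Y ** ctrans (x $ k)) ** x $ k" for Y
      by (simp only: matrix_mul_assoc)
    ultimately have "(ctrans (x $ k) ** x $ k) ** A ** (ctrans (x $ k) ** x $ k) = (ctrans (x $ k) ** x $ k) ** B ** (ctrans (x $ k) ** x $ k)"
      by simp
    then show "A = B" by (simp add: i)
  qed simp
  have m: "mat w ** (x $ k ** A ** ctrans (x $ k)) = x $ k ** (mat w ** A) ** ctrans (x $ k)" for A k
    unfolding matrix_mul_assoc mat_commute[of w "x $ k"] ..
  show ?thesis
    unfolding zcommg_def zcomm_def gconj_def vec_lambda_beta e m c ..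
qed

text \<open>The scalar can be read off in any one factor by cancelling an invertible matrix. Hence
  the commutator of two lifts is a well-defined number.\<close>

lemma zcommg_unique:
  fixes g h :: "('p::finite,'m::finite) elt"
  assumes "g \<in> SUm" "h \<in> SUm" "zcommg w g h" "zcommg w' g h"
  shows "w = w'"
proof -
  fix k
  have u: "g $ k \<in> SU" "h $ k \<in> SU" using assms by (auto simp: SUm_def)
  then have s: "h $ k ** g $ k \<in> SU" by (simp add: SU_mult)
  have "mat w ** (h $ k ** g $ k) = mat w' ** (h $ k ** g $ k)"
    using assms by (metis zcommg_def zcomm_def)
  then have "mat w ** ((h $ k ** g $ k) ** ctrans (h $ k ** g $ k)) = mat w' ** ((h $ k ** g $ k) ** ctrans (h $ k ** g $ k))"
    by (simp only: matrix_mul_assoc)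
  then have "(mat w :: complex^'p^'p) = mat w'" by (simp add: SU_inverse s)
  then show ?thesis by (simp add: mat_def vec_eq_iff) metis
qed

subsection \<open>Topology of the representation space\<close>

lemma norm_row_unitary: "unitary A \<Longrightarrow> norm (A $ i) = 1"
proof -
  assume "unitary A"
  then have "(A ** ctrans A) $ i $ i = 1" by (simp add: unitary_def mat_def)
  then have "cip (A $ i) (A $ i) = 1"
    by (simp add: matrix_matrix_mult_def ctrans_def cip_def mult.commute)
  then have "(norm (A $ i))\<^sup>2 = 1"
    unfolding cip_self by (metis of_real_eq_1_iff)
  then show ?thesis by (simp add: power2_eq_1_iff) (smt (verit) norm_ge_zero)
qed

text \<open>Bounded since the rows of a unitary matrix have norm 1, closed since the conditions are
  equations between continuous functions.\<close>

lemma compact_SUm: "compact (SUm :: ('p::finite,'m::finite) elt set)"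
  unfolding compact_eq_bounded_closed
proof
  have 1: "norm A \<le> real CARD('p)" if "A \<in> SU" for A :: "complex^'p^'p"
  proof -
    have "norm A \<le> (\<Sum>i\<in>UNIV. norm (A $ i))"
      unfolding norm_vec_def[of A] by (rule L2_set_le_sum) simp
    also have "\<dots> = real CARD('p)"
      using that by (simp add: norm_row_unitary SU_iff)
    finally show ?thesis .
  qed
  have "norm g \<le> real CARD('m) * real CARD('p)" if "g \<in> SUm" for g :: "('p,'m) elt"
  proof -
    have "norm g \<le> (\<Sum>i\<in>UNIV. norm (g $ i))"
      unfolding norm_vec_def[of g] by (rule L2_set_le_sum) simp
    also have "\<dots> \<le> (\<Sum>i\<in>(UNIV::'m set). real CARD('p))"
      using that 1 by (intro sum_mono) (simp add: SUm_def)
    finally show ?thesis by simp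
  qed
  then show "bounded (SUm :: ('p,'m) elt set)" by (auto simp: bounded_iff)
  have "SUm = {g :: ('p,'m) elt. \<forall>k. (\<forall>i j. (\<Sum>l\<in>UNIV. g $ k $ i $ l * cnj (g $ k $ j $ l)) = (if i = j then 1 else 0)) \<and> det (g $ k) = 1}"
    by (simp add: SUm_def SU_def matrix_matrix_mult_def ctrans_def mat_def vec_eq_iff)
  also have "closed \<dots>"
    unfolding det_def
    by (intro closed_Collect_all closed_Collect_conj closed_Collect_eq continuous_intros)
  finally show "closed (SUm :: ('p,'m) elt set)" .
qed

lemma topspace_Gtop [simp]: "topspace Gtop = Gcarrier"
  by (simp add: Gtop_def Gcarrier_def)

lemma continuous_map_gclass: "continuous_map (top_of_set SUm) Gtop gclass"
  unfolding Gtop_def by (rule quotient_imp_continuous_map[OF quotient_map_qtop])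

text \<open>The products of an entry with the conjugate of another entry are invariant under scalars of
  modulus one, and they separate the classes.\<close>

lemma Hausdorff_Gtop: "Hausdorff_space (Gtop :: ('p::finite,'m::finite) elt set topology)"
proof -
  define I where "I g = (\<lambda>(k,i,j,k',i',j'). g $ k $ i $ j * cnj (g $ k' $ i' $ j'))"
    for g :: "('p,'m) elt"
  \<comment> \<open>\<open>I\<close> evaluated on a chosen representative; by invariance the choice
    is immaterial on classes from \<open>SUm\<close>, so \<open>J\<close> is the map that
    \<open>I\<close> induces on the quotient.\<close>
  define J where "J a = I (SOME g. g \<in> a \<and> g \<in> SUm)" for a
  have Ismul: "I (smul w g) = I g" if "w ^ CARD('p) = 1" for w g
  proof -
    have "w * cnj w = 1"
      using complex_norm_square[of w] root_of_unity_norm[OF that] by simp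
    then have "w * x * (cnj w * y) = x * y" for x y
      by (metis mult.assoc mult.commute mult_1)
    then show ?thesis
      unfolding I_def smul_def mat_mult_left by (simp only: vec_lambda_beta complex_cnj_mult)
  qed
  have J: "J (gclass g) = I g" if "g \<in> SUm" for g
  proof -
    have "g \<in> gclass g"
      unfolding gclass_smul using smul_1[of g] by (metis (mono_tags, lifting) mem_Collect_eq power_one)
    then have "(SOME h. h \<in> gclass g \<and> h \<in> SUm) \<in> gclass g"
      using that by (metis (mono_tags, lifting) someI)
    then show ?thesis by (auto simp: J_def gclass_smul Ismul)
  qed
  have "continuous_map Gtop (product_topology (\<lambda>_. euclidean) UNIV) J"
    unfolding Gtop_def
  proof (rule continuous_compose_quotient_map[OF quotient_map_qtop])
    have "continuous_map (top_of_set SUm) (product_topology (\<lambda>_. euclidean) UNIV) I"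
      unfolding continuous_map_componentwise_UNIV I_def
      by (auto intro!: continuous_intros)
    then show "continuous_map (top_of_set SUm) (product_topology (\<lambda>_. euclidean) UNIV) (J \<circ> gclass)"
      by (rule continuous_map_eq) (simp add: J)
  qed
  moreover have "inj_on J (topspace Gtop)"
  proof (rule inj_onI)
    fix a b :: "('p,'m) elt set" assume "a \<in> topspace Gtop" "b \<in> topspace Gtop" and eq: "J a = J b"
    then obtain g h where g: "g \<in> SUm" "a = gclass g" and h: "h \<in> SUm" "b = gclass h"
      by (auto simp: Gcarrier_def)
    have "I g = I h" using eq g h J by simp
    then have I: "g $ k $ i $ j * cnj (g $ k' $ i' $ j') = h $ k $ i $ j * cnj (h $ k' $ i' $ j')" for k i j k' i' j'
      by (simp add: I_def fun_eq_iff)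
    fix k0 :: 'm and i0 :: 'p
    have "norm (h $ k0 $ i0) = 1" using h by (simp add: SUm_def SU_iff norm_row_unitary)
    then have "h $ k0 $ i0 \<noteq> 0" by auto
    then obtain j0 where j0: "h $ k0 $ i0 $ j0 \<noteq> 0" by (auto simp: vec_eq_iff)
    then have g0: "g $ k0 $ i0 $ j0 \<noteq> 0" using I[of k0 i0 j0 k0 i0 j0] by auto
    \<comment> \<open>Dividing the equations by one fixed nonzero entry shows that \<open>g\<close>
      is \<open>z\<close> times \<open>h\<close> in all factors with the same \<open>z\<close>; the
      determinant then makes \<open>z\<close> a root of unity, so the classes agree.\<close>
    define z where "z = cnj (h $ k0 $ i0 $ j0) / cnj (g $ k0 $ i0 $ j0)"
    have "g $ k $ i $ j = z * h $ k $ i $ j" for k i j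
      using I[of k i j k0 i0 j0] g0 by (simp add: z_def field_simps)
    then have gz: "g = smul z h" by (simp add: smul_def mat_mult_left vec_eq_iff)
    have "det (g $ k0) = z ^ CARD('p) * det (h $ k0)"
      by (simp add: gz smul_def det_mul det_mat)
    then have "z ^ CARD('p) = 1" using g h by (simp add: SUm_def SU_iff)
    then show "a = b" using gz g h gclass_eq_iff by blast
  qed
  ultimately show ?thesis
    by (intro Hausdorff_space_injective_preimage[of "product_topology (\<lambda>_. euclidean) UNIV" Gtop J])
      (auto simp: Hausdorff_space_product_topology)
qed

lemma HomTop_eq: "HomTop = subtopology (product_topology (\<lambda>_. Gtop) UNIV) Hom_set"
  by (simp add: HomTop_def Hom_set_def)

lemma topspace_HomTop [simp]: "topspace HomTop = Hom_set"
  by (auto simp: HomTop_eq Hom_set_def PiE_UNIV_domain)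

lemma topspace_RepTop [simp]: "topspace RepTop = conj_orbit ` Hom_set"
  by (simp add: RepTop_def)

lemma Hausdorff_HomTop: "Hausdorff_space HomTop"
  unfolding HomTop_eq
  by (intro Hausdorff_space_subtopology) (simp add: Hausdorff_space_product_topology Hausdorff_Gtop)

lemma Hom_set_gconj:
  fixes g :: "'n \<Rightarrow> ('p::finite,'m::finite) elt"
  assumes "\<And>i. g i \<in> SUm" "x \<in> SUm" "(\<lambda>i. gclass (g i)) \<in> Hom_set"
  shows "(\<lambda>i. gclass (gconj x (g i))) \<in> Hom_set"
  using assms by (simp add: gclass_Hom_set_iff gconj_SUm zcommg_gconj)

text \<open>The saturation is the image of the compact set \<open>SUm \<times> K\<close> in a
  Hausdorff space. It is applied with \<open>D = SUm\<close> and a single tuple to close points, and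
  with \<open>D = DSUm\<close> to close images of closed sets of torus tuples.\<close>

lemma closedin_conj_saturation:
  fixes D :: "('p::finite,'m::finite) elt set" and K :: "('n::finite \<Rightarrow> ('p,'m) elt) set"
  assumes D: "compact D" "D \<subseteq> SUm"
    and K: "closedin (product_topology (\<lambda>_. top_of_set D) UNIV) K"
      "\<And>g. g \<in> K \<Longrightarrow> (\<lambda>i. gclass (g i)) \<in> Hom_set"
  shows "closedin HomTop {\<lambda>i. gclass (gconj x (g i)) | x g. x \<in> SUm \<and> g \<in> K}"
proof -
  let ?X = "prod_topology (top_of_set (SUm :: ('p,'m) elt set)) (product_topology (\<lambda>_::'n. top_of_set D) UNIV)"
  let ?F = "\<lambda>(x,g) i. gclass (gconj x (g i))"
  have "continuous_map ?X (product_topology (\<lambda>_. Gtop) UNIV) ?F"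
    unfolding continuous_map_componentwise_UNIV
  proof
    fix i :: 'n
    have c: "continuous_map ?X euclidean (\<lambda>p. gconj (fst p) (snd p i))"
    proof -
      have "continuous_map ?X (top_of_set D) (\<lambda>p. snd p i)"
        using continuous_map_compose[OF continuous_map_snd continuous_map_product_projection[of i UNIV]]
        by (simp add: o_def)
      then have "continuous_map ?X (prod_topology euclidean euclidean) (\<lambda>p. (fst p, snd p i))"
        by (intro continuous_map_pairedI)
          (auto intro: continuous_map_into_fulltopology continuous_map_fst)
      then have 1: "continuous_map ?X euclidean (\<lambda>p. (fst p, snd p i))"
        by simp
      have 2: "continuous_map euclidean euclidean (\<lambda>q::('p,'m) elt \<times> ('p,'m) elt. gconj (fst q) (snd q))"
        unfolding gconj_def matrix_matrix_mult_def ctrans_def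
        by (auto intro!: continuous_intros)
      show ?thesis
        using continuous_map_compose[OF 1 2] by (simp add: o_def)
    qed
    have "continuous_map ?X (top_of_set SUm) (\<lambda>p. gconj (fst p) (snd p i))"
      unfolding continuous_map_in_subtopology
      using c D(2) by (auto simp: PiE_UNIV_domain Pi_iff intro!: gconj_SUm)
    from continuous_map_compose[OF this continuous_map_gclass]
    show "continuous_map ?X Gtop (\<lambda>p. (case p of (x, g) \<Rightarrow> \<lambda>i. gclass (gconj x (g i))) i)"
      by (simp add: o_def case_prod_unfold)
  qed
  moreover have "compactin ?X (SUm \<times> K)"
  proof -
    have "compactin (top_of_set (SUm :: ('p,'m) elt set)) SUm"
      by (simp add: compactin_subtopology compact_SUm)
    moreover have "compact_space (product_topology (\<lambda>_::'n. top_of_set D) UNIV)"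
      using D by (simp add: compact_space_product_topology compact_space_subtopology)
    ultimately show ?thesis
      using K(1) by (simp add: compactin_Times closedin_compact_space)
  qed
  ultimately have "compactin (product_topology (\<lambda>_. Gtop) UNIV) (?F ` (SUm \<times> K))"
    by (rule image_compactin[rotated])
  moreover have "?F ` (SUm \<times> K) = {\<lambda>i. gclass (gconj x (g i)) | x g. x \<in> SUm \<and> g \<in> K}"
    by (auto simp: image_iff)
  moreover have "{\<lambda>i. gclass (gconj x (g i)) | x g. x \<in> SUm \<and> g \<in> K} \<subseteq> Hom_set"
  proof -
    have "g i \<in> SUm" if "g \<in> K" for g i
      using closedin_subset[OF K(1)] that D(2) by auto
    then show ?thesis using K(2) by (auto intro!: Hom_set_gconj)
  qed
  ultimately have "compactin HomTop {\<lambda>i. gclass (gconj x (g i)) | x g. x \<in> SUm \<and> g \<in> K}"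
    by (simp add: HomTop_eq compactin_subtopology)
  then show ?thesis
    by (rule compactin_imp_closedin[OF Hausdorff_HomTop])
qed

lemma closedin_RepTop_point:
  fixes t :: "'n::finite \<Rightarrow> ('p::finite,'m::finite) elt set"
  assumes "t \<in> Hom_set"
  shows "closedin RepTop {conj_orbit t}"
proof -
  obtain g where g: "t = (\<lambda>i. gclass (g i))" "\<And>i. g i \<in> SUm"
    using Hom_set_cases[OF assms] by blast
  have "closedin (product_topology (\<lambda>_. top_of_set (SUm :: ('p,'m) elt set)) UNIV) {g}"
    using g by (intro closedin_Hausdorff_singleton) (auto simp: Hausdorff_space_product_topology Hausdorff_space_subtopology)
  then have "closedin HomTop {\<lambda>i. gclass (gconj x (h i)) | x h. x \<in> SUm \<and> h \<in> {g}}"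
    using assms g by (intro closedin_conj_saturation[OF compact_SUm subset_refl]) auto
  also have "{\<lambda>i. gclass (gconj x (h i)) | x h. x \<in> SUm \<and> h \<in> {g}} = conj_orbit t"
    unfolding g(1) conj_orbit_gclass by auto
  also have "conj_orbit t = {s \<in> topspace HomTop. conj_orbit s \<in> {conj_orbit t}}"
  proof (intro set_eqI iffI)
    fix s assume "s \<in> conj_orbit t"
    then obtain x where x: "x \<in> SUm" "s = (\<lambda>i. gclass (gconj x (g i)))"
      unfolding g(1) conj_orbit_gclass by auto
    have "s \<in> Hom_set" using x g assms by (auto intro!: Hom_set_gconj)
    moreover have "conj_orbit s = conj_orbit t"
      unfolding x g(1) using x g by (subst conj_orbit_eq_iff) (auto simp: gconj_SUm)
    ultimately show "s \<in> {s \<in> topspace HomTop. conj_orbit s \<in> {conj_orbit t}}" by simp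
  next
    fix s assume "s \<in> {s \<in> topspace HomTop. conj_orbit s \<in> {conj_orbit t}}"
    then have s: "s \<in> Hom_set" "conj_orbit s = conj_orbit t" by auto
    obtain h where h: "s = (\<lambda>i. gclass (h i))" "\<And>i. h i \<in> SUm"
      using Hom_set_cases[OF s(1)] by blast
    show "s \<in> conj_orbit t"
      using s(2) unfolding g(1) h(1) by (subst (asm) conj_orbit_eq_iff) (auto simp: g h conj_orbit_gclass)
  qed
  finally show ?thesis
    unfolding RepTop_def using assms by (subst closedin_qtop) auto
qed

subsection \<open>The torus part\<close>

definition DSUm :: "('p::finite,'m::finite) elt set" where
  "DSUm = {g \<in> SUm. \<forall>k. diag_mat (g $ k)}"

lemma Tcarrier_DSUm: "Tcarrier = gclass ` DSUm"
  by (simp add: Tcarrier_def DSUm_def)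

lemma DSUm_subset: "DSUm \<subseteq> SUm"
  by (auto simp: DSUm_def)

lemma compact_DSUm: "compact (DSUm :: ('p::finite,'m::finite) elt set)"
proof -
  have "closed {g :: ('p,'m) elt. \<forall>k i j. i \<noteq> j \<longrightarrow> g $ k $ i $ j = 0}"
    by (intro closed_Collect_all closed_Collect_imp closed_Collect_eq open_Collect_const continuous_intros)
  then have "compact (SUm \<inter> {g :: ('p,'m) elt. \<forall>k i j. i \<noteq> j \<longrightarrow> g $ k $ i $ j = 0})"
    by (rule compact_Int_closed[OF compact_SUm])
  also have "SUm \<inter> {g :: ('p,'m) elt. \<forall>k i j. i \<noteq> j \<longrightarrow> g $ k $ i $ j = 0} = DSUm"
    by (auto simp: DSUm_def diag_mat_def)
  finally show ?thesis .
qed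

lemma topspace_Tn_top: "topspace Tn_top = {t. \<forall>i. t i \<in> Tcarrier}"
proof -
  have "Gcarrier \<inter> Tcarrier = Tcarrier" using DSUm_subset by (auto simp: Gcarrier_def Tcarrier_DSUm)
  then show ?thesis by (auto simp: Tn_top_def PiE_UNIV_domain)
qed

lemma Tn_cases:
  assumes "t \<in> topspace Tn_top"
  obtains g where "t = (\<lambda>i. gclass (g i))" "\<And>i. g i \<in> DSUm"
proof -
  have "\<forall>i. \<exists>g. t i = gclass g \<and> g \<in> DSUm" using assms by (auto simp: topspace_Tn_top Tcarrier_DSUm)
  then obtain g where "\<forall>i. t i = gclass (g i) \<and> g i \<in> DSUm" by metis
  then show ?thesis using that[of g] by auto
qed

lemma diag_mat_diagm: "diag_mat A \<Longrightarrow> A = diagm (\<lambda>a. A $ a $ a)"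
  by (auto simp: diag_mat_def diagm_def vec_eq_iff)

lemma diag_mat_commute: "diag_mat A \<Longrightarrow> diag_mat B \<Longrightarrow> A ** B = B ** A"
proof -
  assume "diag_mat A" "diag_mat B"
  then obtain a b where "A = diagm a" "B = diagm b"
    using diag_mat_diagm by blast
  then show ?thesis by (simp add: diagm_mult mult.commute)
qed

lemma Tn_subset_Hom_set: "topspace Tn_top \<subseteq> Hom_set"
proof
  fix t :: "'n \<Rightarrow> ('p::finite,'m::finite) elt set" assume "t \<in> topspace Tn_top"
  then obtain g where g: "t = (\<lambda>i. gclass (g i))" "\<And>i. g i \<in> DSUm" using Tn_cases by blast
  have "zcommg 1 (g i) (g j)" for i j
  proof -
    have "g i $ k ** g j $ k = g j $ k ** g i $ k" for k
      using g(2)[of i] g(2)[of j] by (intro diag_mat_commute) (auto simp: DSUm_def)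
    then show ?thesis by (simp add: zcommg_def zcomm_def)
  qed
  then show "t \<in> Hom_set"
    unfolding g(1) using g(2) DSUm_subset by (subst gclass_Hom_set_iff) (auto intro!: exI[of _ 1])
qed

definition wperm :: "('m \<Rightarrow> 'p \<Rightarrow> 'p) \<Rightarrow> ('p::finite,'m::finite) elt \<Rightarrow> ('p,'m) elt" where
  "wperm s g = (\<chi> k. permmat (s k) (g $ k))"

lemma wperm_smul: "wperm s (smul w g) = smul w (wperm s g)"
  by (simp add: wperm_def smul_def permmat_def mat_mult_left)

lemma wact_gclass: "wact s (gclass g) = gclass (wperm s g)"
proof -
  have "wact s (gclass g) = wperm s ` gclass g" by (simp add: wact_def wperm_def)
  then show ?thesis by (auto simp: gclass_smul wperm_smul image_iff) (metis wperm_smul)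
qed

lemma weyl_orbit_gclass: "weyl_orbit (\<lambda>i. gclass (g i)) = {\<lambda>i. gclass (wperm s (g i)) | s. s \<in> Weyl}"
  by (simp add: weyl_orbit_def wact_gclass)

text \<open>A right action, as permutations are substituted into the indices; hence the reversed
  order of composition.\<close>

lemma wperm_wperm: "wperm r (wperm s g) = wperm (\<lambda>k. s k \<circ> r k) g"
  by (simp add: wperm_def permmat_def)

lemma wperm_gconj:
  assumes "s \<in> Weyl"
  obtains x where "x \<in> SUm" "\<And>g :: ('p::finite,'m::finite) elt. wperm s g = gconj x g"
proof -
  have "\<forall>k. \<exists>U\<in>SU. \<forall>A :: complex^'p^'p. permmat (s k) A = U ** A ** ctrans U"
    using assms by (auto simp: Weyl_def) (metis permmat_conj_SU)
  then obtain U where "\<forall>k. U k \<in> SU \<and> (\<forall>A :: complex^'p^'p. permmat (s k) A = U k ** A ** ctrans (U k))"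
    by metis
  then show ?thesis
    by (intro that[of "\<chi> k. U k"]) (simp_all add: SUm_def wperm_def gconj_def)
qed

lemma wperm_DSUm:
  fixes g :: "('p::finite,'m::finite) elt"
  assumes "s \<in> Weyl" "g \<in> DSUm" shows "wperm s g \<in> DSUm"
proof -
  obtain x where "x \<in> SUm" "\<And>g :: ('p,'m) elt. wperm s g = gconj x g" using wperm_gconj[OF assms(1)] by blast
  then have "wperm s g \<in> SUm" using assms by (auto simp: DSUm_def gconj_SUm)
  moreover have "diag_mat (permmat (s k) (g $ k))" for k
  proof -
    have "inj (s k)" using assms(1) by (auto simp: Weyl_def intro: permutes_inj)
    then show ?thesis
      using assms(2) by (auto simp: DSUm_def diag_mat_def permmat_def inj_eq)
  qed
  ultimately show ?thesis by (simp add: DSUm_def wperm_def)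
qed

lemma weyl_orbit_eqI:
  fixes g h :: "'n \<Rightarrow> ('p::finite,'m::finite) elt"
  assumes s: "s \<in> Weyl" and eq: "\<And>i. gclass (g i) = gclass (wperm s (h i))"
  shows "weyl_orbit (\<lambda>i. gclass (g i)) = weyl_orbit (\<lambda>i. gclass (h i))"
proof -
  have 1: "gclass (wperm r (g i)) = gclass (wperm (\<lambda>k. s k \<circ> r k) (h i))" for r i
    by (metis eq wact_gclass wperm_wperm)
  have W: "(\<lambda>k. s k \<circ> r k) \<in> Weyl" if "r \<in> Weyl" for r
    using s that by (simp add: Weyl_def permutes_compose)
  have W': "(\<lambda>k. inv (s k) \<circ> r k) \<in> Weyl" if "r \<in> Weyl" for r
    using s that by (simp add: Weyl_def permutes_compose permutes_inv)
  have "(\<lambda>k. s k \<circ> (inv (s k) \<circ> r k)) = r" for r :: "'m \<Rightarrow> 'p \<Rightarrow> 'p"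
    using s by (auto simp: Weyl_def fun_eq_iff intro: permutes_inverses(1))
  then have 2: "gclass (wperm r (h i)) = gclass (wperm (\<lambda>k. inv (s k) \<circ> r k) (g i))" for r i
    unfolding 1 by simp
  show ?thesis
  proof
    show "weyl_orbit (\<lambda>i. gclass (g i)) \<subseteq> weyl_orbit (\<lambda>i. gclass (h i))"
      unfolding weyl_orbit_gclass 1 using W by blast
    show "weyl_orbit (\<lambda>i. gclass (h i)) \<subseteq> weyl_orbit (\<lambda>i. gclass (g i))"
      unfolding weyl_orbit_gclass 2 using W' by blast
  qed
qed

text \<open>Weyl elements act as conjugations by rescaled permutation matrices. Conversely, the
  scalars \<open>w i\<close> by which a conjugation holds only modulo \<open>Delta\<close> are
  absorbed into \<open>h i\<close>, which stays diagonal; then each factor yields one permutation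
  valid for all members of the tuple.\<close>

lemma weyl_orbit_conj_orbit_iff:
  fixes g h :: "'n \<Rightarrow> ('p::finite,'m::finite) elt"
  assumes g: "\<And>i. g i \<in> DSUm" and h: "\<And>i. h i \<in> DSUm"
  shows "weyl_orbit (\<lambda>i. gclass (g i)) = weyl_orbit (\<lambda>i. gclass (h i))
     \<longleftrightarrow> conj_orbit (\<lambda>i. gclass (g i)) = conj_orbit (\<lambda>i. gclass (h i))"
proof
  have S: "g i \<in> SUm" "h i \<in> SUm" for i using g h DSUm_subset by blast+
  {
    have "wperm (\<lambda>_. id) a = a" for a :: "('p,'m) elt" by (simp add: wperm_def permmat_def)
    then have "(\<lambda>i. gclass (g i)) = (\<lambda>i. gclass (wperm (\<lambda>_. id) (g i)))" by simp
    moreover have "(\<lambda>_. id) \<in> Weyl" by (simp add: Weyl_def permutes_id)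
    ultimately have "(\<lambda>i. gclass (g i)) \<in> weyl_orbit (\<lambda>i. gclass (g i))"
      unfolding weyl_orbit_gclass by blast
    moreover assume "weyl_orbit (\<lambda>i. gclass (g i)) = weyl_orbit (\<lambda>i. gclass (h i))"
    ultimately obtain s where s: "s \<in> Weyl" "(\<lambda>i. gclass (g i)) = (\<lambda>i. gclass (wperm s (h i)))"
      unfolding weyl_orbit_gclass by auto
    obtain x where x: "x \<in> SUm" "\<And>g :: ('p,'m) elt. wperm s g = gconj x g" using wperm_gconj[OF s(1)] by blast
    show "conj_orbit (\<lambda>i. gclass (g i)) = conj_orbit (\<lambda>i. gclass (h i))"
      using S x fun_cong[OF s(2)] by (subst conj_orbit_eq_iff) auto
  }
  assume "conj_orbit (\<lambda>i. gclass (g i)) = conj_orbit (\<lambda>i. gclass (h i))"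
  then obtain x where x: "x \<in> SUm" "\<And>i. gclass (g i) = gclass (gconj x (h i))"
    using conj_orbit_eq_iff[of g h] S by blast
  then obtain w where w: "\<And>i. w i ^ CARD('p) = 1" "\<And>i. g i = smul (w i) (gconj x (h i))"
    unfolding gclass_eq_iff by metis
  have "\<exists>s. s permutes UNIV \<and> (\<forall>i. g i $ k = permmat s (smul (w i) (h i) $ k))" for k
  proof (rule diagonal_conj_permutation[of "x $ k"])
    show "det (x $ k) \<noteq> 0" using x(1) by (auto simp: SUm_def SU_iff)
    show "diag_mat (smul (w i) (h i) $ k)" for i
      using h[of i] by (simp add: DSUm_def diag_mat_def smul_def mat_mult_left)
    show "diag_mat (g i $ k)" for i
      using g[of i] by (simp add: DSUm_def)
    have "ctrans (x $ k) ** x $ k = mat 1" using x(1) by (simp add: SUm_def SU_inverse)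
    moreover have "g i = gconj x (smul (w i) (h i))" for i by (simp add: w(2) gconj_smul)
    ultimately show "x $ k ** smul (w i) (h i) $ k = g i $ k ** x $ k" for i
      by (simp add: gconj_def flip: matrix_mul_assoc)
  qed
  then obtain s where s: "\<And>k. s k permutes UNIV" "\<And>k i. g i $ k = permmat (s k) (smul (w i) (h i) $ k)"
    by metis
  then have "g i = smul (w i) (wperm s (h i))" for i
    unfolding wperm_smul[symmetric] by (simp add: vec_eq_iff[where 'b='m] wperm_def)
  then have "gclass (g i) = gclass (wperm s (h i))" for i
    using w(1) gclass_eq_iff by blast
  then show "weyl_orbit (\<lambda>i. gclass (g i)) = weyl_orbit (\<lambda>i. gclass (h i))"
    using s(1) by (intro weyl_orbit_eqI[of s]) (auto simp: Weyl_def)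
qed

text \<open>The map induced by the inclusion of the torus. Taking the union avoids choosing a
  representative: all tuples in a Weyl orbit have the same conjugation orbit.\<close>

definition Phi :: "('n \<Rightarrow> ('p::finite,'m::finite) elt set) set \<Rightarrow> ('n \<Rightarrow> ('p,'m) elt set) set" where
  "Phi A = (\<Union>t\<in>A. conj_orbit t)"

lemma Phi_weyl_orbit:
  fixes t :: "'n \<Rightarrow> ('p::finite,'m::finite) elt set"
  assumes "t \<in> topspace Tn_top"
  shows "Phi (weyl_orbit t) = conj_orbit t"
proof -
  obtain g where g: "t = (\<lambda>i. gclass (g i))" "\<And>i. g i \<in> DSUm" using Tn_cases[OF assms] by blast
  have "conj_orbit s = conj_orbit t" if s: "s \<in> weyl_orbit t" for s
  proof -
    obtain r where r: "r \<in> Weyl" "s = (\<lambda>i. gclass (wperm r (g i)))"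
      using s unfolding g(1) weyl_orbit_gclass by blast
    show ?thesis
      unfolding r(2) g(1)
      using weyl_orbit_conj_orbit_iff[of "\<lambda>i. wperm r (g i)" g] weyl_orbit_eqI[OF r(1), of "\<lambda>i. wperm r (g i)" g]
        wperm_DSUm[OF r(1)] g(2) by simp
  qed
  moreover have "weyl_orbit t \<noteq> {}"
    unfolding g(1) weyl_orbit_gclass by (auto simp: Weyl_def intro!: exI[of _ "\<lambda>_. id"] permutes_id)
  ultimately show ?thesis by (auto simp: Phi_def)
qed

lemma topspace_TWTop: "topspace TWTop = weyl_orbit ` topspace Tn_top"
  by (simp add: TWTop_def)

lemma inj_Phi: "inj_on Phi (topspace TWTop)"
proof (rule inj_onI)
  fix A B :: "('n \<Rightarrow> ('p::finite,'m::finite) elt set) set"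
  assume "A \<in> topspace TWTop" "B \<in> topspace TWTop" and eq: "Phi A = Phi B"
  then obtain s t where st: "s \<in> topspace Tn_top" "t \<in> topspace Tn_top" "A = weyl_orbit s" "B = weyl_orbit t"
    by (auto simp: topspace_TWTop)
  obtain g where g: "s = (\<lambda>i. gclass (g i))" "\<And>i. g i \<in> DSUm" using Tn_cases[OF st(1)] by blast
  obtain h where h: "t = (\<lambda>i. gclass (h i))" "\<And>i. h i \<in> DSUm" using Tn_cases[OF st(2)] by blast
  show "A = B"
    using eq st weyl_orbit_conj_orbit_iff[of g h] g h by (simp add: Phi_weyl_orbit)
qed

lemma continuous_map_Phi: "continuous_map TWTop RepTop Phi"
  unfolding TWTop_def
proof (rule continuous_compose_quotient_map[OF quotient_map_qtop])
  have "continuous_map Tn_top HomTop id"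
    unfolding HomTop_eq continuous_map_in_subtopology
  proof
    show "continuous_map Tn_top (product_topology (\<lambda>_. Gtop) UNIV) id"
      unfolding continuous_map_componentwise_UNIV Tn_top_def
      by (auto intro: continuous_map_into_fulltopology continuous_map_product_projection)
    show "id \<in> topspace Tn_top \<rightarrow> Hom_set" using Tn_subset_Hom_set by auto
  qed
  moreover have "continuous_map HomTop RepTop conj_orbit"
    unfolding RepTop_def by (rule quotient_imp_continuous_map[OF quotient_map_qtop])
  ultimately have "continuous_map Tn_top RepTop (conj_orbit \<circ> id)"
    by (rule continuous_map_compose)
  then show "continuous_map Tn_top RepTop (Phi \<circ> weyl_orbit)"
    by (rule continuous_map_eq) (simp add: Phi_weyl_orbit)
qed

lemma continuous_map_gclass_Tn:
  "continuous_map (product_topology (\<lambda>_. top_of_set DSUm) UNIV) Tn_top (\<lambda>g i. gclass (g i))"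
  unfolding Tn_top_def continuous_map_componentwise_UNIV
proof
  fix i
  have "continuous_map (top_of_set DSUm) (subtopology Gtop Tcarrier) gclass"
    unfolding continuous_map_in_subtopology
    using continuous_map_from_subtopology_mono[OF continuous_map_gclass DSUm_subset]
    by (auto simp: Tcarrier_DSUm)
  from continuous_map_compose[OF continuous_map_product_projection[of i UNIV] this]
  show "continuous_map (product_topology (\<lambda>_. top_of_set DSUm) UNIV) (subtopology Gtop Tcarrier) (\<lambda>g. gclass (g i))"
    by (simp add: o_def)
qed

lemma closed_map_Phi: "closed_map TWTop (RepTop :: ('n::finite \<Rightarrow> ('p::finite,'m::finite) elt set) set topology) Phi"
  unfolding closed_map_def
proof (intro allI impI)
  fix C :: "('n \<Rightarrow> ('p,'m) elt set) set set" assume C: "closedin TWTop C"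
  let ?T = "product_topology (\<lambda>_::'n. top_of_set (DSUm :: ('p,'m) elt set)) UNIV"
  define K where "K = {g \<in> topspace ?T. weyl_orbit (\<lambda>i. gclass (g i)) \<in> C}"
  have KD: "g i \<in> DSUm" if "g \<in> K" for g i using that by (auto simp: K_def PiE_UNIV_domain)
  have wc: "continuous_map ?T TWTop (weyl_orbit \<circ> (\<lambda>g i. gclass (g i)))"
    unfolding TWTop_def
    by (rule continuous_map_compose[OF continuous_map_gclass_Tn quotient_imp_continuous_map[OF quotient_map_qtop]])
  have "closedin ?T K"
    using closedin_continuous_map_preimage[OF wc C] by (simp add: K_def)
  moreover have "(\<lambda>i. gclass (g i)) \<in> topspace Tn_top" if "\<And>i. g i \<in> DSUm" for g :: "'n \<Rightarrow> ('p,'m) elt"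
    using that by (auto simp: topspace_Tn_top Tcarrier_DSUm)
  note inT = this
  ultimately have "closedin HomTop {\<lambda>i. gclass (gconj x (g i)) | x g. x \<in> SUm \<and> g \<in> K}"
    using KD Tn_subset_Hom_set by (intro closedin_conj_saturation[OF compact_DSUm DSUm_subset]) blast+
  also have "{\<lambda>i. gclass (gconj x (g i)) | x g. x \<in> SUm \<and> g \<in> K} = {s \<in> topspace HomTop. conj_orbit s \<in> Phi ` C}"
  proof (intro set_eqI iffI)
    fix s assume "s \<in> {\<lambda>i. gclass (gconj x (g i)) | x g. x \<in> SUm \<and> g \<in> K}"
    then obtain x g where x: "x \<in> SUm" "g \<in> K" "s = (\<lambda>i. gclass (gconj x (g i)))" by blast
    have gS: "g i \<in> SUm" for i using KD[OF x(2)] DSUm_subset by blast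
    have t: "(\<lambda>i. gclass (g i)) \<in> topspace Tn_top" using inT KD[OF x(2)] by blast
    have "s \<in> Hom_set" using x gS t Tn_subset_Hom_set by (auto intro!: Hom_set_gconj)
    moreover have "conj_orbit s = conj_orbit (\<lambda>i. gclass (g i))"
      unfolding x(3) using x gS by (subst conj_orbit_eq_iff) (auto simp: gconj_SUm)
    then have "conj_orbit s = Phi (weyl_orbit (\<lambda>i. gclass (g i)))"
      by (simp add: Phi_weyl_orbit[OF t])
    ultimately show "s \<in> {s \<in> topspace HomTop. conj_orbit s \<in> Phi ` C}"
      using x(2) by (simp add: K_def)
  next
    fix s assume "s \<in> {s \<in> topspace HomTop. conj_orbit s \<in> Phi ` C}"
    then obtain A where s: "s \<in> Hom_set" "A \<in> C" "conj_orbit s = Phi A" by auto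
    then obtain t where t: "t \<in> topspace Tn_top" "A = weyl_orbit t"
      using closedin_subset[OF C] by (auto simp: topspace_TWTop)
    obtain g where g: "t = (\<lambda>i. gclass (g i))" "\<And>i. g i \<in> DSUm" using Tn_cases[OF t(1)] by blast
    have "g \<in> K" using g s(2) t(2) by (simp add: K_def PiE_UNIV_domain)
    obtain h where h: "s = (\<lambda>i. gclass (h i))" "\<And>i. h i \<in> SUm" using Hom_set_cases[OF s(1)] by blast
    have "conj_orbit (\<lambda>i. gclass (h i)) = conj_orbit (\<lambda>i. gclass (g i))"
      using s(3) t g h by (simp add: Phi_weyl_orbit)
    then obtain x where "x \<in> SUm" "\<And>i. gclass (h i) = gclass (gconj x (g i))"
      using conj_orbit_eq_iff[of h g] h g DSUm_subset by blast
    then show "s \<in> {\<lambda>i. gclass (gconj x (g i)) | x g. x \<in> SUm \<and> g \<in> K}"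
      using \<open>g \<in> K\<close> h(1) by auto
  qed
  finally show "closedin RepTop (Phi ` C)"
  proof -
    have "Phi ` C \<subseteq> conj_orbit ` Hom_set"
      using closedin_subset[OF C] continuous_map_image_subset_topspace[OF continuous_map_Phi] by fastforce
    moreover assume "closedin HomTop {s \<in> topspace HomTop. conj_orbit s \<in> Phi ` C}"
    ultimately show ?thesis
      unfolding RepTop_def by (subst closedin_qtop) auto
  qed
qed

section \<open>Path-connectedness of the torus part\<close>

lemma diagm_SU_iff: "diagm d \<in> SU \<longleftrightarrow> (\<forall>a. norm (d a) = 1) \<and> prod d UNIV = 1"
proof -
  have "unitary (diagm d) \<longleftrightarrow> (\<forall>a. d a * cnj (d a) = 1)"
    unfolding unitary_def diagm_mult ctrans_diagm by (auto simp: diagm_def mat_def vec_eq_iff)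
  moreover have "z * cnj z = 1 \<longleftrightarrow> norm z = 1" for z
    by (metis complex_norm_square norm_ge_zero of_real_1 of_real_eq_iff of_real_power one_power2 power2_eq_iff_nonneg zero_le_one)
  ultimately show ?thesis by (simp add: SU_iff det_diagm)
qed

lemma torus_log:
  fixes d :: "'p::finite \<Rightarrow> complex"
  assumes "\<And>a. norm (d a) = 1" "prod d UNIV = 1"
  obtains th :: "'p \<Rightarrow> real" where "\<And>a. d a = cis (th a)" "sum th UNIV = 0"
proof -
  define f where "f a = Arg (d a)" for a
  have f: "d a = cis (f a)" for a
    using assms(1)[of a] cis_Arg[of "d a"] by (metis f_def norm_zero sgn_eq zero_neq_one complex_sgn_def scaleR_one inverse_1 sgn_div_norm)
  have "cis (sum f UNIV) = 1"
  proof -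
    have "cis (sum f UNIV) = (\<Prod>a\<in>UNIV. cis (f a))"
      by (induction rule: infinite_finite_induct) (auto simp: cis_mult[symmetric])
    then show ?thesis using assms(2) by (simp flip: f)
  qed
  then obtain n :: int where n: "sum f UNIV = 2 * pi * n"
    using cos_one_2pi_int[of "sum f UNIV"] by (auto simp: complex_eq_iff mult_ac)
  fix a0 :: 'p
  \<comment> \<open>The angles sum to a multiple of 2 pi. Removing it at one index keeps the entries
    and makes the sum exactly 0, so that scaling all angles by \<open>t\<close> preserves
    determinant 1.\<close>
  define th where "th a = f a - (if a = a0 then 2 * pi * n else 0)" for a
  have "cis (th a) = d a" for a
    by (auto simp: th_def f cis_divide[symmetric] cis_multiple_2pi)
  moreover have "sum th UNIV = 0"
    by (simp add: th_def sum_subtractf n)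
  ultimately show ?thesis using that[of th] by metis
qed

text \<open>Shrinking logarithms of total 0 linearly gives a path of diagonal matrices of
  determinant 1 from the identity, in all factors simultaneously.\<close>

lemma path_connected_DSUm: "path_connected (DSUm :: ('p::finite,'m::finite) elt set)"
proof -
  have "path_component DSUm gone g" if g: "g \<in> DSUm" for g :: "('p,'m) elt"
  proof -
    have gd: "g $ k = diagm (\<lambda>a. g $ k $ a $ a)" for k
      using g by (intro diag_mat_diagm) (simp add: DSUm_def)
    have "diagm (\<lambda>a. g $ k $ a $ a) \<in> SU" for k
      using g unfolding gd[symmetric] by (simp add: DSUm_def SUm_def)
    then have "\<exists>th. (\<forall>a. g $ k $ a $ a = cis (th a)) \<and> sum th UNIV = 0" for k
      unfolding diagm_SU_iff by - (rule torus_log[of "\<lambda>a. g $ k $ a $ a"], auto)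
    then obtain th where th: "\<And>k a. g $ k $ a $ a = cis (th k a)" "\<And>k. sum (th k) UNIV = 0"
      by metis
    define y where "y t = (\<chi> k. diagm (\<lambda>a. cis (t * th k a)))" for t
    have "y t \<in> DSUm" for t
    proof -
      have "(\<Prod>a\<in>UNIV. cis (t * th k a)) = cis (\<Sum>a\<in>UNIV. t * th k a)" for k
        by (induction rule: infinite_finite_induct) (auto simp: cis_mult)
      then have "(\<Prod>a\<in>UNIV. cis (t * th k a)) = 1" for k
        by (simp add: th flip: sum_distrib_left)
      then show ?thesis
        by (simp add: y_def DSUm_def SUm_def diagm_SU_iff) (simp add: diag_mat_def diagm_def)
    qed
    moreover have "continuous_on {0..1} y"
    proof -
      have "continuous_on {0..1} (\<lambda>t. if i = j then cis (t * th k i) else 0)" for i j k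
        by (cases "i = j") (auto intro!: continuous_intros)
      then show ?thesis
        unfolding y_def diagm_def by (intro continuous_on_vec_lambda)
    qed
    moreover have "y 0 = gone"
      by (simp add: y_def gone_def diagm_def mat_def)
    moreover have "y 1 = g"
      using gd by (simp add: y_def vec_eq_iff[where 'b='m] flip: th(1))
    ultimately show ?thesis
      unfolding path_component_def path_def path_image_def pathstart_def pathfinish_def by blast
  qed
  then show ?thesis
    unfolding path_connected_component by (meson path_component_sym path_component_trans)
qed

lemma path_connectedin_TW:
  "path_connectedin (RepTop :: ('n \<Rightarrow> ('p::finite,'m::finite) elt set) set topology) (Phi ` topspace TWTop)"
proof -
  let ?T = "product_topology (\<lambda>_::'n. top_of_set (DSUm :: ('p,'m) elt set)) UNIV"
  have "path_connected_space ?T"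
    unfolding path_connected_space_product_topology
    by (simp add: path_connected_DSUm)
  then have 1: "path_connectedin ?T (topspace ?T)"
    by (simp only: path_connectedin_topspace)
  have 2: "continuous_map ?T (RepTop :: ('n \<Rightarrow> ('p,'m) elt set) set topology) (Phi \<circ> (weyl_orbit \<circ> (\<lambda>g i. gclass (g i))))"
    by (intro continuous_map_compose[OF _ continuous_map_Phi] continuous_map_compose[OF continuous_map_gclass_Tn])
      (simp add: TWTop_def quotient_imp_continuous_map[OF quotient_map_qtop])
  have "(\<lambda>g i. gclass (g i)) ` topspace ?T = topspace (Tn_top :: ('n \<Rightarrow> ('p,'m) elt set) topology)"
  proof
    show "(\<lambda>g i. gclass (g i)) ` topspace ?T \<subseteq> topspace Tn_top"
      by (auto simp: topspace_Tn_top Tcarrier_DSUm PiE_UNIV_domain)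
    show "topspace Tn_top \<subseteq> (\<lambda>g i. gclass (g i)) ` topspace ?T"
    proof
      fix t :: "'n \<Rightarrow> ('p,'m) elt set" assume "t \<in> topspace Tn_top"
      then obtain g where "t = (\<lambda>i. gclass (g i))" "\<And>i. g i \<in> DSUm" using Tn_cases by blast
      then show "t \<in> (\<lambda>g i. gclass (g i)) ` topspace ?T" by (auto simp: PiE_UNIV_domain)
    qed
  qed
  then have "(Phi \<circ> (weyl_orbit \<circ> (\<lambda>g i. gclass (g i)))) ` topspace ?T = Phi ` topspace (TWTop :: ('n \<Rightarrow> ('p,'m) elt set) set topology)"
    unfolding topspace_TWTop by (metis image_comp)
  then show ?thesis
    using path_connectedin_continuous_map_image[OF 2 1] by simp
qed

subsection \<open>Normal forms of the remaining classes\<close>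

primrec mpow :: "complex^'p^'p::finite \<Rightarrow> nat \<Rightarrow> complex^'p^'p" where
  "mpow A 0 = mat 1"
| "mpow A (Suc n) = A ** mpow A n"

lemma mpow_SU: "A \<in> SU \<Longrightarrow> mpow A n \<in> SU"
  by (induction n) (simp_all add: SU_mult SU_mat)

lemma mat_cancel:
  assumes "X \<in> SU" "mat a ** X = mat b ** (X :: complex^'p^'p::finite)"
  shows "a = b"
proof -
  have "mat a ** (X ** ctrans X) = mat b ** (X ** ctrans X)"
    using assms(2) by (simp add: matrix_mul_assoc)
  then have "(mat a :: complex^'p^'p) = mat b" by (simp add: SU_inverse assms)
  then show ?thesis by (simp add: mat_def vec_eq_iff) metis
qed

lemma mat_left_cancel: "a \<noteq> 0 \<Longrightarrow> mat a ** X = mat a ** Y \<longleftrightarrow> X = (Y :: complex^'p^'p::finite)"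
  by (auto simp: mat_mult_left vec_eq_iff)

lemma zcomm_self: "zcomm 1 X X"
  by (simp add: zcomm_def)

lemma zcomm_mat_left: "zcomm 1 (mat c) X"
  by (simp add: zcomm_def mat_commute)

lemma zcomm_sym: "zcomm a X Y \<Longrightarrow> a \<noteq> 0 \<Longrightarrow> zcomm (1 / a) Y X"
  by (simp add: zcomm_def matrix_mul_assoc mat_mat)

lemma zcomm_mult_left:
  assumes "zcomm a X Z" "zcomm b Y Z"
  shows "zcomm (a * b) (X ** Y) Z"
proof -
  have "X ** Y ** Z = X ** (mat b ** (Z ** Y))"
    using assms(2) by (simp add: zcomm_def flip: matrix_mul_assoc)
  also have "\<dots> = mat b ** (X ** Z) ** Y"
    by (simp only: matrix_mul_assoc mat_commute[of b X])
  also have "\<dots> = (mat b ** mat a) ** (Z ** (X ** Y))"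
    using assms(1) by (simp add: zcomm_def matrix_mul_assoc)
  finally show ?thesis by (simp add: zcomm_def mat_mat mult.commute)
qed

lemma zcomm_mult_right:
  assumes "zcomm a Z X" "zcomm b Z Y" "a \<noteq> 0" "b \<noteq> 0"
  shows "zcomm (a * b) Z (X ** Y)"
  using zcomm_sym[OF zcomm_mult_left[OF zcomm_sym[OF assms(1,3)] zcomm_sym[OF assms(2,4)]]] assms by simp

lemma zcomm_mpow_left: "zcomm a X Y \<Longrightarrow> zcomm (a ^ n) (mpow X n) Y"
  by (induction n) (simp_all add: zcomm_mat_left zcomm_mult_left)

lemma zcomm_mpow_right: "zcomm a X Y \<Longrightarrow> a \<noteq> 0 \<Longrightarrow> zcomm (a ^ n) X (mpow Y n)"
  using zcomm_sym[OF zcomm_mpow_left[OF zcomm_sym]] by (simp add: power_one_over)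

text \<open>Two matrices with the same commutator scalar against \<open>C\<close> have a quotient
  commuting with \<open>C\<close>: the scalars of \<open>X\<close> and of the inverse of
  \<open>Y\<close> cancel.\<close>

lemma zcomm_quotient_commute:
  assumes "zcomm a X C" "zcomm a Y C" "a \<noteq> 0" "Y \<in> SU"
  shows "X ** ctrans Y ** C = C ** (X ** ctrans Y)"
proof -
  have "C ** ctrans Y = (ctrans Y ** Y) ** C ** ctrans Y"
    by (simp add: SU_inverse assms)
  also have "\<dots> = ctrans Y ** (Y ** C) ** ctrans Y"
    by (simp only: matrix_mul_assoc)
  also have "\<dots> = ctrans Y ** mat a ** C ** (Y ** ctrans Y)"
    using assms(2) by (simp only: zcomm_def matrix_mul_assoc)
  finally have 1: "C ** ctrans Y = mat a ** (ctrans Y ** C)"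
    by (simp add: SU_inverse assms mat_commute matrix_mul_assoc)
  have "mat a ** (X ** ctrans Y ** C) = X ** (mat a ** (ctrans Y ** C))"
    by (simp only: matrix_mul_assoc mat_commute[of a X])
  also have "\<dots> = X ** C ** ctrans Y" unfolding 1[symmetric] by (simp only: matrix_mul_assoc)
  also have "\<dots> = mat a ** (C ** (X ** ctrans Y))"
    using assms(1) by (simp add: zcomm_def matrix_mul_assoc)
  finally show ?thesis using assms(3) by (simp add: mat_left_cancel)
qed

text \<open>One fixed choice for each \<open>z\<close>. Explicit matrices are dispensable because
  pairs in \<open>SU\<close> with the same \<open>z\<close>, for \<open>z\<close> a nontrivial root
  and \<open>CARD('p)\<close> prime, are conjugate.\<close>

definition std_pair :: "complex \<Rightarrow> (complex^'p^'p::finite) \<times> (complex^'p^'p)" where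
  "std_pair z = (SOME P. fst P \<in> SU \<and> snd P \<in> SU \<and> zcomm z (fst P) (snd P))"

lemma std_pair:
  assumes "z ^ CARD('p::finite) = 1"
  shows "fst (std_pair z :: (complex^'p^'p) \<times> _) \<in> SU" "snd (std_pair z :: (complex^'p^'p) \<times> _) \<in> SU"
    "zcomm z (fst (std_pair z :: (complex^'p^'p) \<times> _)) (snd (std_pair z))"
proof -
  obtain A C :: "complex^'p^'p" where "A \<in> SU" "C \<in> SU" "zcomm z A C"
    using zcomm_pair_exists[OF assms] by blast
  then have "\<exists>P :: (complex^'p^'p) \<times> (complex^'p^'p). fst P \<in> SU \<and> snd P \<in> SU \<and> zcomm z (fst P) (snd P)"
    by (intro exI[of _ "(A, C)"]) simp
  from someI_ex[OF this] show "fst (std_pair z :: (complex^'p^'p) \<times> _) \<in> SU" "snd (std_pair z :: (complex^'p^'p) \<times> _) \<in> SU"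
    "zcomm z (fst (std_pair z :: (complex^'p^'p) \<times> _)) (snd (std_pair z))"
    by (auto simp: std_pair_def)
qed

definition word :: "complex \<Rightarrow> nat \<times> nat \<Rightarrow> complex^'p^'p::finite" where
  "word z uv = mpow (fst (std_pair z)) (fst uv) ** mpow (snd (std_pair z)) (snd uv)"

lemma word_SU: "z ^ CARD('p::finite) = 1 \<Longrightarrow> (word z uv :: complex^'p^'p) \<in> SU"
  by (simp add: word_def SU_mult mpow_SU std_pair)

lemma root_of_unity_nonzero: "z ^ CARD('p::finite) = 1 \<Longrightarrow> (z::complex) \<noteq> 0"
  using root_of_unity_norm[where 'p='p, of z] by auto

text \<open>The standard symplectic form u v' - v u' in the exponent, written as a quotient because
  exponents are natural numbers.\<close>

lemma zcomm_word:
  assumes z: "z ^ CARD('p::finite) = 1"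
  shows "zcomm (z ^ (u * v') / z ^ (v * u')) (word z (u, v) :: complex^'p^'p) (word z (u', v'))"
proof -
  let ?A = "fst (std_pair z) :: complex^'p^'p" and ?C = "snd (std_pair z) :: complex^'p^'p"
  have z0: "z \<noteq> 0" using root_of_unity_nonzero[OF z] .
  have AC: "zcomm z ?A ?C" using std_pair(3)[OF z] .
  have 1: "zcomm (z ^ (u * v')) (mpow ?A u) (mpow ?C v')"
    unfolding power_mult using zcomm_mpow_right[OF zcomm_mpow_left[OF AC]] z0 by simp
  have 2: "zcomm ((1 / z) ^ (v * u')) (mpow ?C v) (mpow ?A u')"
    unfolding power_mult using zcomm_mpow_right[OF zcomm_mpow_left[OF zcomm_sym[OF AC z0]]] z0 by simp
  have same: "zcomm 1 (mpow X a) (mpow X b)" for X :: "complex^'p^'p" and a b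
    using zcomm_mpow_right[OF zcomm_mpow_left[OF zcomm_self[of X]]] by simp
  have A: "zcomm (1 * z ^ (u * v')) (mpow ?A u) (word z (u', v'))"
    unfolding word_def fst_conv snd_conv using z0 by (intro zcomm_mult_right same 1) auto
  have C: "zcomm ((1 / z) ^ (v * u') * 1) (mpow ?C v) (word z (u', v'))"
    unfolding word_def fst_conv snd_conv using z0 by (intro zcomm_mult_right same 2) auto
  show ?thesis
    using zcomm_mult_left[OF A C] z0 by (simp add: word_def power_one_over)
qed

definition nform :: "complex \<Rightarrow> nat \<times> nat \<Rightarrow> ('m \<Rightarrow> complex) \<Rightarrow> ('p::finite,'m::finite) elt" where
  "nform z uv c = (\<chi> k. mat (c k) ** word z uv)"

lemma nform_SUm:
  assumes "z ^ CARD('p) = 1" "\<And>k. c k ^ CARD('p) = 1"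
  shows "(nform z uv c :: ('p::finite,'m::finite) elt) \<in> SUm"
  using assms by (simp add: nform_def SUm_def SU_mult SU_mat word_SU)

lemma zcommg_nform:
  assumes z: "z ^ CARD('p::finite) = 1" and c: "\<And>k. c k ^ CARD('p) = 1" "\<And>k. c' k ^ CARD('p) = 1"
  shows "zcommg (z ^ (fst a * snd b) / z ^ (snd a * fst b)) (nform z a c :: ('p,'m::finite) elt) (nform z b c')"
  unfolding zcommg_def
proof
  fix k
  have z0: "z \<noteq> 0" using root_of_unity_nonzero[OF z] .
  let ?w = "z ^ (fst a * snd b) / z ^ (snd a * fst b)"
  have 1: "zcomm ?w (word z a :: complex^'p^'p) (word z b)"
    using zcomm_word[OF z, of "fst a" "snd b" "snd a" "fst b"] by simp
  have 2: "zcomm 1 X (mat d)" for X :: "complex^'p^'p" and d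
    using zcomm_sym[OF zcomm_mat_left[of d X]] by simp
  have "zcomm (1 * (1 * ?w)) (mat (c k) ** word z a :: complex^'p^'p) (mat (c' k) ** word z b)"
    using z0 by (intro zcomm_mult_left zcomm_mat_left zcomm_mult_right 1 2) auto
  then show "zcomm ?w ((nform z a c :: ('p,'m) elt) $ k) (nform z b c' $ k)"
    by (simp add: nform_def)
qed

text \<open>Neither conjugation nor scalars change a commutator, so the commutators are invariants
  of a point of the representation space.\<close>

lemma conj_orbit_commutator:
  fixes g h :: "'n \<Rightarrow> ('p::finite,'m::finite) elt"
  assumes "\<And>i. g i \<in> SUm" "\<And>i. h i \<in> SUm"
    and "conj_orbit (\<lambda>i. gclass (g i)) = conj_orbit (\<lambda>i. gclass (h i))"
  shows "zcommg w (g i) (g j) \<longleftrightarrow> zcommg w (h i) (h j)"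
proof -
  obtain x where x: "x \<in> SUm" "\<And>i. gclass (g i) = gclass (gconj x (h i))"
    using assms conj_orbit_eq_iff[of g h] by blast
  then obtain a where a: "\<And>i. a i ^ CARD('p) = 1" "\<And>i. g i = smul (a i) (gconj x (h i))"
    unfolding gclass_eq_iff by metis
  have "a i \<noteq> 0" for i using root_of_unity_nonzero[OF a(1)] .
  then show ?thesis by (simp add: a(2) zcommg_smul zcommg_gconj x(1))
qed

text \<open>Lifts that truly commute are diagonalized separately in each factor, and the conjugating
  matrices together form one element of \<open>SUm\<close>. Conversely, diagonal lifts commute and
  commutators are invariants.\<close>

lemma conj_orbit_in_Phi_iff:
  fixes g :: "'n \<Rightarrow> ('p::finite,'m::finite) elt"
  assumes g: "\<And>i. g i \<in> SUm"
  shows "conj_orbit (\<lambda>i. gclass (g i)) \<in> Phi ` topspace TWTop \<longleftrightarrow> (\<forall>i j. zcommg 1 (g i) (g j))"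
proof
  assume "conj_orbit (\<lambda>i. gclass (g i)) \<in> Phi ` topspace TWTop"
  then obtain t where t: "t \<in> topspace Tn_top" "conj_orbit (\<lambda>i. gclass (g i)) = conj_orbit t"
    by (auto simp: topspace_TWTop Phi_weyl_orbit)
  obtain h where h: "t = (\<lambda>i. gclass (h i))" "\<And>i. h i \<in> DSUm" using Tn_cases[OF t(1)] by blast
  have hS: "h i \<in> SUm" for i using h DSUm_subset by blast
  have "zcommg 1 (h i) (h j)" for i j
    using h(2)[of i] h(2)[of j] by (simp add: zcommg_def zcomm_def DSUm_def diag_mat_commute)
  then show "\<forall>i j. zcommg 1 (g i) (g j)"
    using conj_orbit_commutator[of g h] g hS t(2) h(1) by simp
next
  assume comm: "\<forall>i j. zcommg 1 (g i) (g j)"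
  have "\<exists>U\<in>SU. \<forall>i. diag_mat (U ** g i $ k ** ctrans U)" for k
    using comm g by (intro commuting_SU_diagonalizable) (simp_all add: zcommg_def zcomm_def SUm_def)
  then obtain U where U: "\<And>k. U k \<in> SU" "\<And>k i. diag_mat (U k ** g i $ k ** ctrans (U k))" by metis
  let ?x = "(\<chi> k. U k) :: ('p,'m) elt"
  have x: "?x \<in> SUm" using U by (simp add: SUm_def)
  have D: "gconj ?x (g i) \<in> DSUm" for i
    using U(2) gconj_SUm[OF x g[of i]] by (simp add: DSUm_def) (simp add: gconj_def)
  let ?t = "\<lambda>i. gclass (gconj ?x (g i))"
  have t: "?t \<in> topspace Tn_top" using D by (auto simp: topspace_Tn_top Tcarrier_DSUm)
  have "conj_orbit ?t = conj_orbit (\<lambda>i. gclass (g i))"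
    using x g by (subst conj_orbit_eq_iff) (auto simp: gconj_SUm)
  then show "conj_orbit (\<lambda>i. gclass (g i)) \<in> Phi ` topspace TWTop"
    using t Phi_weyl_orbit[OF t] by (auto simp: topspace_TWTop)
qed

text \<open>Reduced echelon form for the exponents: rows \<open>r < s\<close> are the pivots, row \<open>i\<close> holds the
  exponents of the two standard generators in the \<open>i\<close>-th member of the tuple.\<close>

definition ech :: "nat \<Rightarrow> nat \<Rightarrow> nat \<Rightarrow> nat \<Rightarrow> (nat \<times> nat) set" where
  "ech p r s i = (if i < r then {(0, 0)} else if i = r then {(1, 0)} else if i < s then {..<p} \<times> {0}
     else if i = s then {(0, 1)} else {..<p} \<times> {..<p})"

definition roots :: "nat \<Rightarrow> complex set" where
  "roots p = {w. w ^ p = 1}"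

text \<open>Scalars are normalised to 1 in the factor \<open>k0\<close>, which uses up the freedom
  of \<open>Delta\<close>, and at the two pivots, where conjugation reaches the standard pair
  exactly.\<close>

definition scal :: "('n \<Rightarrow> nat) \<Rightarrow> 'm \<Rightarrow> nat \<Rightarrow> nat \<Rightarrow> nat \<Rightarrow> ('n \<Rightarrow> 'm \<Rightarrow> complex) set" where
  "scal e k0 p r s = PiE UNIV (\<lambda>i. PiE UNIV (\<lambda>k. if k = k0 \<or> e i = r \<or> e i = s then {1} else roots p))"

text \<open>The order of the tuple, needed to speak of pivots, comes from the enumeration
  \<open>e\<close> of the index type. The root \<open>z\<close> is the commutator of the two pivot
  members, hence different from 1.\<close>

definition nf_data :: "('n::finite \<Rightarrow> nat) \<Rightarrow> 'm \<Rightarrow> nat \<Rightarrow>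
    (nat \<times> nat \<times> complex \<times> ('n \<Rightarrow> nat \<times> nat) \<times> ('n \<Rightarrow> 'm \<Rightarrow> complex)) set" where
  "nf_data e k0 p = (SIGMA s:{..<CARD('n)}. SIGMA r:{..<s}. (roots p - {1}) \<times> PiE UNIV (\<lambda>i. ech p r s (e i)) \<times> scal e k0 p r s)"

definition nf_lift :: "nat \<times> nat \<times> complex \<times> ('n \<Rightarrow> nat \<times> nat) \<times> ('n \<Rightarrow> 'm \<Rightarrow> complex) \<Rightarrow> 'n \<Rightarrow> ('p::finite,'m::finite) elt" where
  "nf_lift = (\<lambda>(s, r, z, uv, c) i. nform z (uv i) (c i))"

definition nf_comm :: "nat \<times> nat \<times> complex \<times> ('n \<Rightarrow> nat \<times> nat) \<times> ('n \<Rightarrow> 'm \<Rightarrow> complex) \<Rightarrow> 'n \<Rightarrow> 'n \<Rightarrow> complex" where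
  "nf_comm = (\<lambda>(s, r, z, uv, c) i j. z ^ (fst (uv i) * snd (uv j)) / z ^ (snd (uv i) * fst (uv j)))"

lemma nf_dataD:
  fixes e :: "'n::finite \<Rightarrow> nat"
  assumes "(s, r, z, uv, c) \<in> nf_data e k0 p"
  shows "r < s" "s < CARD('n)" "z ^ p = 1" "z \<noteq> 1" "uv i \<in> ech p r s (e i)"
    "c i k \<in> (if k = k0 \<or> e i = r \<or> e i = s then {1} else roots p)" "c i k ^ p = 1"
proof -
  show "r < s" "s < CARD('n)" "z ^ p = 1" "z \<noteq> 1" "uv i \<in> ech p r s (e i)"
    using assms by (auto simp: nf_data_def roots_def PiE_UNIV_domain Pi_iff)
  show 1: "c i k \<in> (if k = k0 \<or> e i = r \<or> e i = s then {1} else roots p)"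
    using assms by (auto simp: nf_data_def scal_def PiE_UNIV_domain Pi_iff)
  then show "c i k ^ p = 1" by (auto simp: roots_def split: if_splits)
qed

lemma nf_lift_SUm:
  assumes "d \<in> nf_data e k0 CARD('p)"
  shows "(nf_lift d i :: ('p::finite,'m::finite) elt) \<in> SUm"
  using assms by (cases d) (auto simp: nf_lift_def dest: nf_dataD(3,7) intro!: nform_SUm)

lemma nf_lift_comm:
  assumes "d \<in> nf_data e k0 CARD('p)"
  shows "zcommg (nf_comm d i j) (nf_lift d i :: ('p::finite,'m::finite) elt) (nf_lift d j)"
  using assms by (cases d) (auto simp: nf_lift_def nf_comm_def dest: nf_dataD(3,7) intro!: zcommg_nform)

lemma ech_less: "p \<ge> 2 \<Longrightarrow> uv \<in> ech p r s i \<Longrightarrow> fst uv < p \<and> snd uv < p"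
  by (auto simp: ech_def split: if_splits)

lemma conj_mult_SU:
  assumes "x \<in> SU"
  shows "x ** (X ** Y) ** ctrans x = (x ** X ** ctrans x) ** (x ** Y ** ctrans x)"
proof -
  have "(x ** X ** ctrans x) ** (x ** Y ** ctrans x) = x ** X ** (ctrans x ** x) ** Y ** ctrans x"
    by (simp only: matrix_mul_assoc)
  then show ?thesis using assms by (simp add: SU_inverse matrix_mul_assoc)
qed

lemma conj_mpow:
  assumes x: "x \<in> SU" and "A = mat a ** (x ** A ** ctrans x)"
  shows "mpow A n = mat (a ^ n) ** (x ** mpow A n ** ctrans x)"
proof (induction n)
  case 0
  show ?case using x by (simp add: SU_inverse)
next
  case (Suc n)
  have "mpow A (Suc n) = (mat a ** (x ** A ** ctrans x)) ** (mat (a ^ n) ** (x ** mpow A n ** ctrans x))"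
    using assms(2) Suc by simp
  also have "\<dots> = mat a ** ((x ** A ** ctrans x) ** mat (a ^ n)) ** (x ** mpow A n ** ctrans x)"
    by (simp only: matrix_mul_assoc)
  also have "\<dots> = mat a ** mat (a ^ n) ** ((x ** A ** ctrans x) ** (x ** mpow A n ** ctrans x))"
    unfolding mat_commute[of "a ^ n" "x ** A ** ctrans x", symmetric] by (simp only: matrix_mul_assoc)
  finally show ?case
    unfolding conj_mult_SU[OF x, symmetric] mat_mat mpow.simps power_Suc .
qed

text \<open>A conjugation that fixes the generators up to scalars \<open>a\<close> and
  \<open>b\<close> fixes every word up to the corresponding monomial. Scalars of different members
  of a tuple are therefore linked through the pivots.\<close>

lemma conj_word:
  fixes x :: "complex^'p^'p::finite"
  assumes x: "x \<in> SU" and A: "word z (1, 0) = mat a ** (x ** word z (1, 0) ** ctrans x)"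
    and C: "word z (0, 1) = mat b ** (x ** word z (0, 1) ** ctrans x)"
  shows "word z (u, v) = mat (a ^ u * b ^ v) ** (x ** word z (u, v) ** ctrans x)"
proof -
  let ?A = "fst (std_pair z) :: complex^'p^'p" and ?C = "snd (std_pair z) :: complex^'p^'p"
  have 1: "mpow ?A u = mat (a ^ u) ** (x ** mpow ?A u ** ctrans x)"
    using A by (intro conj_mpow[OF x]) (simp add: word_def)
  have 2: "mpow ?C v = mat (b ^ v) ** (x ** mpow ?C v ** ctrans x)"
    using C by (intro conj_mpow[OF x]) (simp add: word_def)
  have "word z (u, v) = (mat (a ^ u) ** (x ** mpow ?A u ** ctrans x)) ** (mat (b ^ v) ** (x ** mpow ?C v ** ctrans x))"
    using 1 2 by (simp add: word_def)
  also have "\<dots> = mat (a ^ u) ** ((x ** mpow ?A u ** ctrans x) ** mat (b ^ v)) ** (x ** mpow ?C v ** ctrans x)"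
    by (simp only: matrix_mul_assoc)
  also have "\<dots> = mat (a ^ u) ** mat (b ^ v) ** ((x ** mpow ?A u ** ctrans x) ** (x ** mpow ?C v ** ctrans x))"
    unfolding mat_commute[of "b ^ v" "x ** mpow ?A u ** ctrans x", symmetric] by (simp only: matrix_mul_assoc)
  finally show ?thesis
    unfolding conj_mult_SU[OF x, symmetric] mat_mat word_def fst_conv snd_conv .
qed

text \<open>The commutators determine the pivots: \<open>r\<close> is the first position with a
  nontrivial commutator and \<open>s\<close> the first one not commuting with position
  \<open>r\<close>. A smaller pivot on the other side would make the commutator \<open>z'\<close>
  trivial.\<close>

lemma nf_pivots_le:
  fixes e :: "'n::finite \<Rightarrow> nat"
  assumes e: "bij_betw e UNIV {..<CARD('n)}"
    and d: "(s, r, z, uv, c) \<in> nf_data e k0 p" "(s', r', z', uv', c') \<in> nf_data e k0' p"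
    and eq: "\<And>i j. nf_comm (s, r, z, uv, c) i j = nf_comm (s', r', z', uv', c') i j"
  shows "r \<le> r' \<and> (r = r' \<longrightarrow> s \<le> s')"
proof -
  note D = nf_dataD[OF d(1)] and D' = nf_dataD[OF d(2)]
  have ex: "\<exists>i. e i = a" if "a < CARD('n)" for a
    using that e by (metis bij_betw_imp_surj_on imageE lessThan_iff)
  obtain i where i: "e i = r'" using ex D' by (meson order_less_trans)
  obtain j where j: "e j = s'" using ex D' by blast
  have B: "nf_comm (s', r', z', uv', c') i j = z'"
    using D'(5)[of i] D'(5)[of j] i j D'(1) by (simp add: nf_comm_def ech_def)
  have "\<not> r' < r"
  proof
    assume "r' < r"
    then have "nf_comm (s, r, z, uv, c) i j = 1"
      using D(5)[of i] i by (simp add: nf_comm_def ech_def)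
    then show False using B eq D'(4) by simp
  qed
  moreover have "\<not> s' < s" if "r = r'"
  proof
    assume "s' < s"
    then have "snd (uv j) = 0" "uv i = (1, 0)"
      using D(5)[of i] D(5)[of j] i j that by (auto simp: ech_def split: if_splits)
    then have "nf_comm (s, r, z, uv, c) i j = 1"
      by (simp add: nf_comm_def)
    then show False using B eq D'(4) by simp
  qed
  ultimately show ?thesis by auto
qed

text \<open>Commutators recover the pivots, the root and the exponents. Only the scalars are left,
  and these are compared through the effect of the conjugating element on words.\<close>

lemma nf_inj:
  fixes e :: "'n::finite \<Rightarrow> nat" and k0 :: "'m::finite"
  assumes p: "prime CARD('p::finite)" and e: "bij_betw e UNIV {..<CARD('n)}"
    and d: "d \<in> nf_data e k0 CARD('p)" "d' \<in> nf_data e k0 CARD('p)"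
    and eq: "conj_orbit (\<lambda>i. gclass (nf_lift d i :: ('p,'m) elt)) = conj_orbit (\<lambda>i. gclass (nf_lift d' i :: ('p,'m) elt))"
  shows "d = d'"
proof -
  let ?p = "CARD('p)"
  let ?g = "\<lambda>i. nf_lift d i :: ('p,'m) elt" and ?h = "\<lambda>i. nf_lift d' i :: ('p,'m) elt"
  note S = nf_lift_SUm[OF d(1)] nf_lift_SUm[OF d(2)]
  have comm: "nf_comm d i j = nf_comm d' i j" for i j
  proof (rule zcommg_unique[OF S(1) S(1)])
    show "zcommg (nf_comm d i j) (?g i) (?g j)" by (rule nf_lift_comm[OF d(1)])
    show "zcommg (nf_comm d' i j) (?g i) (?g j)"
      unfolding conj_orbit_commutator[OF S eq] by (rule nf_lift_comm[OF d(2)])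
  qed
  obtain s r z uv c where d1: "d = (s, r, z, uv, c)" by (cases d)
  obtain s' r' z' uv' c' where d2: "d' = (s', r', z', uv', c')" by (cases d')
  note D = nf_dataD[OF d(1)[unfolded d1]] and D' = nf_dataD[OF d(2)[unfolded d2]]
  have rs: "r' = r" "s' = s"
    using nf_pivots_le[OF e d(1)[unfolded d1] d(2)[unfolded d2]] nf_pivots_le[OF e d(2)[unfolded d2] d(1)[unfolded d1]]
      comm unfolding d1 d2 by (metis order_antisym)+
  have ex: "\<exists>i. e i = a" if "a < CARD('n)" for a
    using that e by (metis bij_betw_imp_surj_on imageE lessThan_iff)
  obtain i0 where i0: "e i0 = r" using ex D by (meson order_less_trans)
  obtain j0 where j0: "e j0 = s" using ex D by blast
  have piv: "uv i0 = (1, 0)" "uv' i0 = (1, 0)" "uv j0 = (0, 1)" "uv' j0 = (0, 1)"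
    using D(5)[of i0] D'(5)[of i0] D(5)[of j0] D'(5)[of j0] D(1) i0 j0 by (auto simp: ech_def rs)
  have z: "z' = z"
    using comm[of i0 j0] piv unfolding d1 d2 by (simp add: nf_comm_def)
  have p2: "2 \<le> ?p" using p prime_ge_2_nat by blast
  have lt: "fst (uv i) < ?p" "snd (uv i) < ?p" "fst (uv' i) < ?p" "snd (uv' i) < ?p" for i
    using ech_less[OF p2 D(5)] ech_less[OF p2 D'(5)] by auto
  \<comment> \<open>Pairing with the pivots reads off coordinates: against (0, 1) the commutator is
    \<open>z\<close> to the first exponent, and (1, 0) against the row gives \<open>z\<close> to the
    second.\<close>
  have uv: "uv' i = uv i" for i
  proof (rule prod_eqI)
    have "z ^ fst (uv i) = z ^ fst (uv' i)"
      using comm[of i j0] piv unfolding d1 d2 by (simp add: nf_comm_def z)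
    then show "fst (uv' i) = fst (uv i)"
      using prime_root_of_unity_inj[OF p D(3,4)] lt by (auto simp: inj_on_def)
    have "z ^ snd (uv i) = z ^ snd (uv' i)"
      using comm[of i0 i] piv unfolding d1 d2 by (simp add: nf_comm_def z)
    then show "snd (uv' i) = snd (uv i)"
      using prime_root_of_unity_inj[OF p D(3,4)] lt by (auto simp: inj_on_def)
  qed
  obtain x where x: "x \<in> SUm" "\<And>i. gclass (?g i) = gclass (gconj x (?h i))"
    using eq conj_orbit_eq_iff[of ?g ?h] S by blast
  then obtain a where a: "\<And>i. a i ^ ?p = 1" "\<And>i. ?g i = smul (a i) (gconj x (?h i))"
    unfolding gclass_eq_iff by metis
  have main: "mat (c i k) ** word z (uv i) = mat (a i * c' i k) ** (x $ k ** word z (uv i) ** ctrans (x $ k))" for i k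
  proof -
    have "?g i = smul (a i) (smul 1 (gconj x (?h i)))" using a(2)[of i] by simp
    then have "mat (c i k) ** word z (uv i) = mat (a i) ** (x $ k ** (mat (c' i k) ** word z (uv i)) ** ctrans (x $ k))"
      by (simp add: d1 d2 nf_lift_def nform_def smul_def gconj_def vec_eq_iff[where 'b='m] z uv)
    also have "x $ k ** (mat (c' i k) ** word z (uv i)) ** ctrans (x $ k) = mat (c' i k) ** (x $ k ** word z (uv i) ** ctrans (x $ k))"
      by (simp only: matrix_mul_assoc mat_commute[of "c' i k" "x $ k"])
    finally show ?thesis by (simp only: matrix_mul_assoc mat_mat)
  qed
  have c1: "c i0 k = 1" "c' i0 k = 1" "c j0 k = 1" "c' j0 k = 1" for k
    using D(6)[of i0 k] D'(6)[of i0 k] D(6)[of j0 k] D'(6)[of j0 k] by (simp_all add: i0 j0 rs)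
  have xk: "x $ k \<in> SU" for k using x(1) by (simp add: SUm_def)
  have cc: "c i k * (a i0 ^ fst (uv i) * a j0 ^ snd (uv i)) = a i * c' i k" for i k
  proof -
    let ?y = "x $ k ** word z (uv i) ** ctrans (x $ k)"
    have w: "word z (uv i) = mat (a i0 ^ fst (uv i) * a j0 ^ snd (uv i)) ** ?y"
      using conj_word[OF xk[of k], of z "a i0" "a j0" "fst (uv i)" "snd (uv i)"] main[of i0 k] main[of j0 k]
      by (simp add: piv c1)
    have "mat (c i k * (a i0 ^ fst (uv i) * a j0 ^ snd (uv i))) ** ?y = mat (c i k) ** word z (uv i)"
      by (subst w) (simp add: matrix_mul_assoc mat_mat)
    also have "\<dots> = mat (a i * c' i k) ** ?y" by (rule main)
    finally show ?thesis
      by (intro mat_cancel[of ?y]) (use xk word_SU[OF D(3)] in \<open>auto simp: SU_mult SU_ctrans\<close>)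
  qed
  \<comment> \<open>In the factor \<open>k0\<close> both scalars are 1, which identifies the
    monomial in the pivot scalars with \<open>a i\<close>. This nonzero number then cancels in every
    other factor.\<close>
  have c: "c' i k = c i k" for i k
  proof -
    have "a i0 ^ fst (uv i) * a j0 ^ snd (uv i) = a i"
      using cc[of i k0] D(6)[of i k0] D'(6)[of i k0] by simp
    then show ?thesis using cc[of i k] root_of_unity_nonzero[OF a(1)[of i]] by simp
  qed
  show ?thesis unfolding d1 d2 using rs z uv c by (simp add: fun_eq_iff)
qed

lemma nf_nontrivial:
  fixes e :: "'n::finite \<Rightarrow> nat" and k0 :: "'m::finite"
  assumes p: "prime CARD('p::finite)" and e: "bij_betw e UNIV {..<CARD('n)}"
    and d: "d \<in> nf_data e k0 CARD('p)"
  shows "(\<lambda>i. gclass (nf_lift d i :: ('p,'m) elt)) \<in> Hom_set"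
    "conj_orbit (\<lambda>i. gclass (nf_lift d i :: ('p,'m) elt)) \<notin> Phi ` topspace TWTop"
proof -
  let ?g = "\<lambda>i. nf_lift d i :: ('p,'m) elt"
  note S = nf_lift_SUm[OF d]
  obtain s r z uv c where d1: "d = (s, r, z, uv, c)" by (cases d)
  note D = nf_dataD[OF d[unfolded d1]]
  have "nf_comm d i j ^ CARD('p) = 1" for i j
  proof -
    have "(z ^ l) ^ CARD('p) = 1" for l by (metis D(3) mult.commute power_mult power_one)
    then show ?thesis by (simp add: d1 nf_comm_def power_divide)
  qed
  then show "(\<lambda>i. gclass (?g i)) \<in> Hom_set"
    using S nf_lift_comm[OF d] by (subst gclass_Hom_set_iff) blast+
  have ex: "\<exists>i. e i = a" if "a < CARD('n)" for a
    using that e by (metis bij_betw_imp_surj_on imageE lessThan_iff)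
  obtain i0 where i0: "e i0 = r" using ex D by (meson order_less_trans)
  obtain j0 where j0: "e j0 = s" using ex D by blast
  have piv: "uv i0 = (1, 0)" "uv j0 = (0, 1)"
    using D(5)[of i0] D(5)[of j0] D(1) i0 j0 by (auto simp: ech_def)
  have "nf_comm d i0 j0 \<noteq> 1" using piv D(4) by (simp add: d1 nf_comm_def)
  then have "\<not> zcommg 1 (?g i0) (?g j0)"
    using zcommg_unique[OF S S nf_lift_comm[OF d]] by metis
  then show "conj_orbit (\<lambda>i. gclass (?g i)) \<notin> Phi ` topspace TWTop"
    using S by (subst conj_orbit_in_Phi_iff) auto
qed

text \<open>Pivots are chosen by leastness, conjugation makes them the standard pair in every
  factor, and Schur's lemma writes each other member as a scalar times the word with the same
  commutators against the pivots.\<close>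

lemma nf_surj:
  fixes e :: "'n::finite \<Rightarrow> nat" and k0 :: "'m::finite" and t :: "'n \<Rightarrow> ('p::finite,'m) elt set"
  assumes p: "prime CARD('p)" and e: "bij_betw e UNIV {..<CARD('n)}"
    and t: "t \<in> Hom_set" "conj_orbit t \<notin> Phi ` topspace TWTop"
  shows "\<exists>d\<in>nf_data e k0 CARD('p). conj_orbit t = conj_orbit (\<lambda>i. gclass (nf_lift d i))"
proof -
  let ?p = "CARD('p)" and ?n = "CARD('n)"
  obtain g where g: "t = (\<lambda>i. gclass (g i))" "\<And>i. g i \<in> SUm" using Hom_set_cases[OF t(1)] by blast
  obtain b where b: "\<And>i j. b i j ^ ?p = 1" "\<And>i j. zcommg (b i j) (g i) (g j)"
    using t(1) gclass_Hom_set_iff[of g] g by metis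
  have b0: "b i j \<noteq> 0" for i j using root_of_unity_nonzero[OF b(1)] .
  have buniq: "b i j = w" if "zcommg w (g i) (g j)" for i j w
    using zcommg_unique[OF g(2) g(2) b(2) that] .
  have bii: "b i i = 1" for i by (rule buniq) (simp add: zcommg_def zcomm_self)
  have bsym: "b j i = 1" if "b i j = 1" for i j
    by (rule buniq) (use b(2)[of i j] that in \<open>simp add: zcommg_def zcomm_def\<close>)
  define I where "I = inv_into UNIV e"
  have eI: "e (I a) = a" if "a < ?n" for a
    unfolding I_def using e that by (intro f_inv_into_f) (simp add: bij_betw_def)
  have Ie: "I (e i) = i" for i
    unfolding I_def using e by (intro inv_into_f_f) (auto simp: bij_betw_def)
  have elt: "e i < ?n" for i using e by (auto simp: bij_betw_def)
  have "\<exists>i j. b i j \<noteq> 1"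
  proof (rule ccontr)
    assume "\<nexists>i j. b i j \<noteq> 1"
    then have "\<forall>i j. zcommg 1 (g i) (g j)" using b(2) by metis
    then show False using t(2) g conj_orbit_in_Phi_iff[of g] by simp
  qed
  then have ex1: "\<exists>r. r < ?n \<and> (\<exists>j. b (I r) j \<noteq> 1)" by (metis Ie elt)
  define r where "r = (LEAST r. r < ?n \<and> (\<exists>j. b (I r) j \<noteq> 1))"
  have r: "r < ?n" "\<exists>j. b (I r) j \<noteq> 1" using LeastI_ex[OF ex1] unfolding r_def by auto
  have rmin: "b i j = 1" if "e i < r" for i j
    using not_less_Least[OF that[unfolded r_def]] elt Ie by metis
  have ex2: "\<exists>s. s < ?n \<and> b (I r) (I s) \<noteq> 1" using r(2) by (metis Ie elt)
  define s where "s = (LEAST s. s < ?n \<and> b (I r) (I s) \<noteq> 1)"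
  have s: "s < ?n" "b (I r) (I s) \<noteq> 1" using LeastI_ex[OF ex2] unfolding s_def by auto
  have smin: "b (I r) i = 1" if "e i < s" for i
    using not_less_Least[OF that[unfolded s_def]] elt Ie by metis
  \<comment> \<open>Equality is excluded because a member commutes with itself, and
    \<open>s < r\<close> because members before \<open>r\<close> commute with everything.\<close>
  have rs: "r < s"
  proof (rule ccontr)
    assume "\<not> r < s"
    then consider "s = r" | "s < r" by linarith
    then show False
    proof cases
      case 1 then show ?thesis using s(2) bii by simp
    next
      case 2
      then have "b (I s) (I r) = 1" using rmin[of "I s"] eI s(1) by simp
      then show ?thesis using bsym s(2) by blast
    qed
  qed
  define z where "z = b (I r) (I s)"
  have z: "z ^ ?p = 1" "z \<noteq> 1" using b(1) s(2) by (auto simp: z_def)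
  let ?A = "fst (std_pair z) :: complex^'p^'p" and ?C = "snd (std_pair z) :: complex^'p^'p"
  note std = std_pair[where 'p='p, OF z(1)]
  have gk: "g i $ k \<in> SU" for i k using g(2) by (simp add: SUm_def)
  have "\<exists>U\<in>SU. U ** g (I r) $ k ** ctrans U = ?A \<and> U ** g (I s) $ k ** ctrans U = ?C" for k
  proof -
    have "zcomm z (g (I r) $ k) (g (I s) $ k)" using b(2) by (simp add: z_def zcommg_def)
    from zcomm_pair_conjugate[OF p z this std(3) gk gk std(1,2)] show ?thesis by metis
  qed
  then obtain U where U: "\<And>k. U k \<in> SU" "\<And>k. U k ** g (I r) $ k ** ctrans (U k) = ?A"
    "\<And>k. U k ** g (I s) $ k ** ctrans (U k) = ?C" by metis
  let ?x = "(\<chi> k. U k) :: ('p,'m) elt"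
  have x: "?x \<in> SUm" using U by (simp add: SUm_def)
  define h where "h i = gconj ?x (g i)" for i
  have hS: "h i \<in> SUm" for i using gconj_SUm[OF x g(2)] by (simp add: h_def)
  have hr: "h (I r) $ k = ?A" and hs: "h (I s) $ k = ?C" for k
    using U by (simp_all add: h_def gconj_def)
  have hb: "zcomm (b i j) (h i $ k) (h j $ k)" for i j k
    using b(2)[of i j] zcommg_gconj[OF x, of "b i j" "g i" "g j"] by (simp add: h_def zcommg_def)
  have orb: "conj_orbit t = conj_orbit (\<lambda>i. gclass (h i))"
    unfolding g(1) using x g(2) hS by (subst eq_commute, subst conj_orbit_eq_iff) (auto simp: h_def)
  have pow: "\<exists>u. u < ?p \<and> w = z ^ u" if w: "w ^ ?p = 1" for w
    using prime_root_of_unity_eq_power[OF p z w] by blast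
  \<comment> \<open>Both exponents come from commutators with the pivots: A^u C^v against C gives
    z^u, and A against A^u C^v gives z^v. They do not depend on the factor, so one word serves all
    factors.\<close>
  have "\<forall>i. \<exists>u. u < ?p \<and> b i (I s) = z ^ u" using pow b(1) by blast
  then obtain u where u: "\<And>i. u i < ?p" "\<And>i. b i (I s) = z ^ u i" by metis
  have "\<forall>i. \<exists>v. v < ?p \<and> b (I r) i = z ^ v" using pow b(1) by blast
  then obtain v where v: "\<And>i. v i < ?p" "\<And>i. b (I r) i = z ^ v i" by metis
  have p1: "1 < ?p" using p prime_gt_1_nat by blast
  have zinj: "a = a'" if "z ^ a = z ^ a'" "a < ?p" "a' < ?p" for a a'
    using prime_root_of_unity_inj[OF p z] that by (auto simp: inj_on_def)
  have uv1: "u (I r) = 1" "v (I r) = 0" "u (I s) = 0" "v (I s) = 1"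
  proof -
    have "z ^ u (I r) = z ^ 1" "z ^ v (I r) = z ^ 0" "z ^ u (I s) = z ^ 0" "z ^ v (I s) = z ^ 1"
      using u(2)[of "I r"] u(2)[of "I s"] v(2)[of "I r"] v(2)[of "I s"] by (simp_all add: bii z_def[symmetric])
    then show "u (I r) = 1" "v (I r) = 0" "u (I s) = 0" "v (I s) = 1"
      using zinj u(1) v(1) p1 by (meson order_less_trans zero_less_one)+
  qed
  let ?w = "\<lambda>i. word z (u i, v i) :: complex^'p^'p"
  have wS: "?w i \<in> SU" for i by (rule word_SU[OF z(1)])
  have z0: "z \<noteq> 0" using root_of_unity_nonzero[OF z(1)] .
  have wA: "word z (Suc 0, 0) = ?A" "word z (0, Suc 0) = ?C" by (simp_all add: word_def)
  have "\<exists>c. c ^ ?p = 1 \<and> h i $ k = mat c ** ?w i" for i k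
  proof -
    let ?X = "h i $ k ** ctrans (?w i)"
    have C: "?X ** ?C = ?C ** ?X"
    proof (rule zcomm_quotient_commute[where a = "z ^ u i"])
      show "zcomm (z ^ u i) (h i $ k) ?C" using hb[of i "I s" k] by (simp add: hs u(2))
      show "zcomm (z ^ u i) (?w i) ?C"
        using zcomm_word[OF z(1), of "u i" 1 "v i" 0] by (simp add: wA)
    qed (use z0 wS in auto)
    \<comment> \<open>The reciprocal appears because \<open>v i\<close> was read off with the pivot
      on the left.\<close>
    have A: "?X ** ?A = ?A ** ?X"
    proof (rule zcomm_quotient_commute[where a = "1 / z ^ v i"])
      show "zcomm (1 / z ^ v i) (h i $ k) ?A"
        using zcomm_sym[OF hb[of "I r" i k]] z0 by (simp add: hr v(2))
      show "zcomm (1 / z ^ v i) (?w i) ?A"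
        using zcomm_word[OF z(1), of "u i" 0 "v i" 1] by (simp add: wA)
    qed (use z0 wS in auto)
    obtain c where c: "?X = mat c"
      using zcomm_schur[OF p z std(3) _ _ A C] std by (metis SU_iff)
    have "?X \<in> SU" using hS[of i] wS by (simp add: SUm_def SU_mult SU_ctrans)
    then have "c ^ ?p = 1" using c SU_mat_iff[where 'p='p, of c] by simp
    moreover have "h i $ k = ?X ** ?w i"
      by (simp add: SU_inverse wS flip: matrix_mul_assoc)
    ultimately show ?thesis using c by auto
  qed
  then obtain c where c: "\<And>i k. c i k ^ ?p = 1" "\<And>i k. h i $ k = mat (c i k) ** ?w i" by metis
  have c0: "c i k \<noteq> 0" for i k using root_of_unity_nonzero[OF c(1)] .
  \<comment> \<open>Division by the scalar in factor \<open>k0\<close> changes the lift by an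
    element of \<open>Delta\<close> only, so the class is unchanged.\<close>
  define c' where "c' i k = c i k / c i k0" for i k
  define d where "d = (s, r, z, (\<lambda>i. (u i, v i)), c')"
  have cr: "c (I r) k = 1" for k
  proof -
    have "mat (c (I r) k) ** ?A = mat 1 ** ?A" using c(2)[of "I r" k] by (simp add: hr uv1 wA)
    then show ?thesis using mat_cancel[OF std(1)] by blast
  qed
  have cs: "c (I s) k = 1" for k
  proof -
    have "mat (c (I s) k) ** ?C = mat 1 ** ?C" using c(2)[of "I s" k] by (simp add: hs uv1 wA)
    then show ?thesis using mat_cancel[OF std(2)] by blast
  qed
  have "d \<in> nf_data e k0 ?p"
  proof -
    have "(u i, v i) \<in> ech ?p r s (e i)" for i
    proof -
      \<comment> \<open>The zeros of the echelon form are the leastness of the pivots: before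
        \<open>r\<close> all commutators are trivial, before \<open>s\<close> those with the first
        pivot.\<close>
      have 1: "u i = 0 \<and> v i = 0" if "e i < r"
        using zinj[of "u i" 0] zinj[of "v i" 0] u[of i] v[of i] p1 rmin[OF that] bsym[OF rmin[OF that]]
        by simp
      have 2: "v i = 0" if "e i < s"
        using zinj[of "v i" 0] v[of i] p1 smin[OF that] by simp
      have 3: "i = I r" if "e i = r" using Ie[of i] that by simp
      have 4: "i = I s" if "e i = s" using Ie[of i] that by simp
      show ?thesis
        using 1 2 3 4 uv1 u(1)[of i] v(1)[of i] rs by (auto simp: ech_def)
    qed
    moreover have "c' i k \<in> (if k = k0 \<or> e i = r \<or> e i = s then {1} else roots ?p)" for i k
    proof -
      have "c' i k = 1" if "e i = r" using that cr Ie[of i] by (auto simp: c'_def)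
      moreover have "c' i k = 1" if "e i = s" using that cs Ie[of i] by (auto simp: c'_def)
      moreover have "c' i k = 1" if "k = k0" using that c0 by (simp add: c'_def)
      ultimately show ?thesis
        using c(1) by (auto simp: roots_def c'_def power_divide)
    qed
    ultimately show ?thesis
      using rs s z by (simp add: d_def nf_data_def scal_def roots_def PiE_UNIV_domain Pi_iff)
  qed
  moreover have "gclass (h i) = gclass (nf_lift d i)" for i
  proof -
    have "h i = smul (c i k0) (nf_lift d i)"
      using c0[of i k0] c(2)[of i]
      by (simp add: d_def nf_lift_def nform_def smul_def vec_eq_iff[where 'b='m] matrix_mul_assoc mat_mat c'_def)
    then show ?thesis using c(1) gclass_eq_iff by blast
  qed
  ultimately show ?thesis using orb by (intro bexI[of _ d]) simp_all
qed

section \<open>Counting the normal forms\<close>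

text \<open>The s - r - 1 positions strictly between the pivots have one free exponent, the n - 1 -
  s positions after the second pivot have two, all others none.\<close>

lemma prod_card_ech:
  assumes "r < s" "s < n"
  shows "(\<Prod>i<n. card (ech p r s i)) = p ^ (s - r - 1) * p ^ (2 * (n - 1 - s))"
proof -
  have c: "card (ech p r s i) = (if i \<le> r then 1 else if i < s then p else if i = s then 1 else p\<^sup>2)" for i
    by (auto simp: ech_def card_cartesian_product power2_eq_square)
  have "{..<n} = {..r} \<union> {r<..<s} \<union> {s} \<union> {s<..<n}" using assms by auto
  then have "(\<Prod>i<n. card (ech p r s i)) = (\<Prod>i\<in>{..r} \<union> {r<..<s} \<union> {s} \<union> {s<..<n}. card (ech p r s i))"
    by simp
  also have "\<dots> = (\<Prod>i\<in>{..r}. card (ech p r s i)) * (\<Prod>i\<in>{r<..<s}. card (ech p r s i)) * card (ech p r s s) * (\<Prod>i\<in>{s<..<n}. card (ech p r s i))"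
    using assms by (subst prod.union_disjoint, simp, simp, force)+ simp
  also have "(\<Prod>i\<in>{..r}. card (ech p r s i)) = 1"
    by (intro prod.neutral) (simp add: c)
  also have "(\<Prod>i\<in>{r<..<s}. card (ech p r s i)) = (\<Prod>i\<in>{r<..<s}. p)"
    by (intro prod.cong) (auto simp: c)
  also have "card (ech p r s s) = 1" using assms by (simp add: c)
  also have "(\<Prod>i\<in>{s<..<n}. card (ech p r s i)) = (\<Prod>i\<in>{s<..<n}. p\<^sup>2)"
    using assms by (intro prod.cong) (auto simp: c)
  finally show ?thesis using assms by (simp add: power_mult)
qed

lemma card_roots: "p > 0 \<Longrightarrow> card (roots p) = p" "p > 0 \<Longrightarrow> finite (roots p)"
  unfolding roots_def by (simp_all add: card_roots_unity_eq finite_roots_unity)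

text \<open>Free roots occur in all factors but \<open>k0\<close> and at all positions but the two
  pivots, hence the exponent (m - 1)(n - 2).\<close>

lemma card_scal:
  fixes e :: "'n::finite \<Rightarrow> nat" and k0 :: "'m::finite"
  assumes e: "bij_betw e UNIV {..<CARD('n)}" and p: "p > 0" and rs: "r < s" "s < CARD('n)"
  shows "card (scal e k0 p r s) = p ^ ((CARD('m) - 1) * (CARD('n) - 2))"
proof -
  let ?m = "CARD('m)" and ?n = "CARD('n)"
  have 1: "card (PiE UNIV (\<lambda>k. if k = k0 \<or> P then {1} else roots p)) = (if P then 1 else p ^ (?m - 1))" for P
  proof -
    have "card (PiE UNIV (\<lambda>k. if k = k0 \<or> P then {1} else roots p)) = (\<Prod>k\<in>(UNIV::'m set). if k = k0 \<or> P then 1 else p)"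
      by (subst card_PiE) (auto intro!: prod.cong simp: card_roots p)
    also have "\<dots> = (if P then 1 else (\<Prod>k\<in>(UNIV::'m set). if k = k0 then 1 else p))" by simp
    also have "(\<Prod>k\<in>(UNIV::'m set). if k = k0 then 1 else p) = (\<Prod>k\<in>UNIV - {k0}. p)"
      by (subst prod.remove[of UNIV k0]) (auto intro!: prod.cong)
    finally show ?thesis by (simp add: card_Diff_singleton)
  qed
  have "card (scal e k0 p r s) = (\<Prod>i\<in>UNIV. if e i = r \<or> e i = s then 1 else p ^ (?m - 1))"
    unfolding scal_def by (subst card_PiE) (auto simp: 1)
  also have "\<dots> = (\<Prod>i<?n. if i = r \<or> i = s then 1 else p ^ (?m - 1))"
    by (rule prod.reindex_bij_betw[OF e])
  also have "\<dots> = (\<Prod>i\<in>{..<?n} - {r, s}. p ^ (?m - 1))"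
    by (rule prod.mono_neutral_cong_right) auto
  also have "\<dots> = p ^ ((?m - 1) * (?n - 2))"
    using rs by (simp add: card_Diff_subset power_mult numeral_2_eq_2)
  finally show ?thesis .
qed

lemma card_nf_data:
  fixes e :: "'n::finite \<Rightarrow> nat" and k0 :: "'m::finite"
  assumes e: "bij_betw e UNIV {..<CARD('n)}" and p: "p > 0"
  shows "finite (nf_data e k0 p)"
    "card (nf_data e k0 p) = (\<Sum>s<CARD('n). \<Sum>r<s. (p - 1) * (p ^ (s - r - 1) * p ^ (2 * (CARD('n) - 1 - s)) * p ^ ((CARD('m) - 1) * (CARD('n) - 2))))"
proof -
  have fech: "finite (ech p r s i)" for r s i by (simp add: ech_def)
  have fscal: "finite (scal e k0 p r s)" for r s
    unfolding scal_def using p by (intro finite_PiE) (auto simp: card_roots)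
  have fin: "finite ((roots p - {1}) \<times> PiE UNIV (\<lambda>i. ech p r s (e i)) \<times> scal e k0 p r s)" for r s
    using p by (intro finite_cartesian_product finite_PiE fscal fech) (auto simp: card_roots)
  show "finite (nf_data e k0 p)"
    unfolding nf_data_def by (intro finite_SigmaI fin) auto
  have "card ((roots p - {1}) \<times> PiE UNIV (\<lambda>i. ech p r s (e i)) \<times> scal e k0 p r s)
     = (p - 1) * (p ^ (s - r - 1) * p ^ (2 * (CARD('n) - 1 - s)) * p ^ ((CARD('m) - 1) * (CARD('n) - 2)))"
    if "r < s" "s < CARD('n)" for r s
  proof -
    have "card (PiE UNIV (\<lambda>i. ech p r s (e i))) = (\<Prod>i\<in>UNIV. card (ech p r s (e i)))"
      by (rule card_PiE) simp
    also have "\<dots> = (\<Prod>i<CARD('n). card (ech p r s i))"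
      by (rule prod.reindex_bij_betw[OF e])
    finally have "card (PiE UNIV (\<lambda>i. ech p r s (e i))) = p ^ (s - r - 1) * p ^ (2 * (CARD('n) - 1 - s))"
      using prod_card_ech[OF that] by simp
    moreover have "card (roots p - {1}) = p - 1"
    proof -
      have "1 \<in> roots p" by (simp add: roots_def)
      then show ?thesis using p by (simp add: card_Diff_singleton card_roots)
    qed
    ultimately show ?thesis
      using card_scal[OF e p that, of k0] by (simp add: card_cartesian_product)
  qed
  then show "card (nf_data e k0 p) = (\<Sum>s<CARD('n). \<Sum>r<s. (p - 1) * (p ^ (s - r - 1) * p ^ (2 * (CARD('n) - 1 - s)) * p ^ ((CARD('m) - 1) * (CARD('n) - 2))))"
    unfolding nf_data_def by (simp add: card_SigmaI fin finite_SigmaI)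
qed

text \<open>For prime \<open>p\<close> the sum is p - 1 times the number of planes in F_p^n, counted
  by reduced echelon bases. The factor p - 1 turns the geometric sum over \<open>r\<close> into p^s
  - 1, and the sum over \<open>s\<close> is evaluated by induction on \<open>n\<close>.\<close>

lemma echelon_sum:
  fixes p :: nat
  assumes "p \<ge> 1"
  shows "(\<Sum>s<n. \<Sum>r<s. real ((p - 1) * (p ^ (s - r - 1) * p ^ (2 * (n - 1 - s))))) * (real p ^ 2 - 1)
     = (real p ^ n - 1) * (real p ^ (n - 1) - 1)"
proof -
  let ?q = "real p"
  have inner: "(\<Sum>r<s. real ((p - 1) * (p ^ (s - r - 1) * p ^ (2 * (n - 1 - s))))) = (?q ^ s - 1) * ?q ^ (2 * (n - 1 - s))" for s n
  proof -
    have "(\<Sum>r<s. real ((p - 1) * (p ^ (s - r - 1) * p ^ (2 * (n - 1 - s))))) = (?q - 1) * (\<Sum>r<s. ?q ^ (s - Suc r)) * ?q ^ (2 * (n - 1 - s))"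
      using assms by (simp add: of_nat_diff sum_distrib_left sum_distrib_right mult_ac)
    also have "(\<Sum>r<s. ?q ^ (s - Suc r)) = (\<Sum>r<s. ?q ^ r)"
      by (rule sum.nat_diff_reindex)
    also have "(?q - 1) * (\<Sum>r<s. ?q ^ r) = ?q ^ s - 1"
      by (simp add: power_diff_1_eq)
    finally show ?thesis .
  qed
  show ?thesis
    unfolding inner
  proof (induction n)
    case 0 show ?case by simp
  next
    case (Suc n)
    show ?case
    \<comment> \<open>The case n = 0 is separated because there \<open>n - 1\<close> is truncated,
      while the final identity needs q^2 q^(n-1) = q^(n+1).\<close>
    proof (cases n)
      case 0 then show ?thesis by simp
    next
      case (Suc k)
      \<comment> \<open>Lengthening the tuple by one position adds two free exponents to every old
        form; the only new term is \<open>s = n\<close>.\<close>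
      have "(\<Sum>s<n. (?q ^ s - 1) * ?q ^ (2 * (n - s))) = ?q ^ 2 * (\<Sum>s<n. (?q ^ s - 1) * ?q ^ (2 * (n - 1 - s)))"
        unfolding sum_distrib_left
      proof (rule sum.cong[OF refl])
        fix s assume "s \<in> {..<n}"
        then have "2 * (n - s) = 2 + 2 * (n - 1 - s)" by auto
        then show "(?q ^ s - 1) * ?q ^ (2 * (n - s)) = ?q ^ 2 * ((?q ^ s - 1) * ?q ^ (2 * (n - 1 - s)))"
          by (simp only: power_add mult_ac)
      qed
      then have "(\<Sum>s<Suc n. (?q ^ s - 1) * ?q ^ (2 * (Suc n - 1 - s))) * (?q ^ 2 - 1)
        = ?q ^ 2 * ((\<Sum>s<n. (?q ^ s - 1) * ?q ^ (2 * (n - 1 - s))) * (?q ^ 2 - 1)) + (?q ^ n - 1) * (?q ^ 2 - 1)"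
        by (simp add: algebra_simps)
      also have "\<dots> = ?q ^ 2 * ((?q ^ n - 1) * (?q ^ (n - 1) - 1)) + (?q ^ n - 1) * (?q ^ 2 - 1)"
        unfolding Suc.IH ..
      also have "\<dots> = (?q ^ Suc n - 1) * (?q ^ (Suc n - 1) - 1)"
        by (simp add: Suc algebra_simps power2_eq_square)
      finally show ?thesis .
    qed
  qed
qed

theorem theorem1p2:
  fixes p m n :: nat
  assumes "prime p" and "CARD('p::finite) = p" and "CARD('m::finite) = m"
    and "CARD('n::finite) = n"
  defines "N \<equiv> real p powi ((int m - 1) * (int n - 2)) * (real p ^ n - 1)
                 * (real p ^ (n - 1) - 1) / (real p ^ 2 - 1) + 1"
  shows "finite (path_components_of (RepTop :: ('n \<Rightarrow> ('p,'m) elt set) set topology))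
       \<and> real (card (path_components_of (RepTop :: ('n \<Rightarrow> ('p,'m) elt set) set topology))) = N
       \<and> (\<exists>X :: nat set. finite X \<and> real (card X) = N - 1
            \<and> (RepTop :: ('n \<Rightarrow> ('p,'m) elt set) set topology) homeomorphic_space
                dunion (TWTop :: ('n \<Rightarrow> ('p,'m) elt set) set topology) (discrete_topology X))"
proof -
  let ?R = "RepTop :: ('n \<Rightarrow> ('p,'m) elt set) set topology"
  let ?TW = "TWTop :: ('n \<Rightarrow> ('p,'m) elt set) set topology"
  have p: "prime CARD('p)" using assms by simp
  have p2: "p \<ge> 2" using assms prime_ge_2_nat by blast
  obtain e :: "'n \<Rightarrow> nat" where e: "bij_betw e UNIV {..<CARD('n)}" by (rule nat_enum)
  fix k0 :: 'm
  define P where "P = conj_orbit ` Hom_set - Phi ` topspace ?TW"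
  let ?f = "\<lambda>d. conj_orbit (\<lambda>i. gclass (nf_lift d i :: ('p,'m) elt))"
  have bij: "bij_betw ?f (nf_data e k0 CARD('p)) P"
    unfolding bij_betw_def
  proof
    show "inj_on ?f (nf_data e k0 CARD('p))"
      using nf_inj[OF p e] by (intro inj_onI) blast
    show "?f ` nf_data e k0 CARD('p) = P"
    proof
      show "?f ` nf_data e k0 CARD('p) \<subseteq> P"
        unfolding P_def using nf_nontrivial[OF p e] by blast
      show "P \<subseteq> ?f ` nf_data e k0 CARD('p)"
        unfolding P_def using nf_surj[OF p e, of _ k0] by blast
    qed
  qed
  have finP: "finite P"
    using bij_betw_finite[OF bij] card_nf_data(1)[OF e, of p k0] p2 assms(2) by simp
  have cardP: "real (card P) = N - 1"
  proof -
    have "card P = card (nf_data e k0 p)"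
      using bij_betw_same_card[OF bij] assms(2) by simp
    then have "card P = (\<Sum>s<n. \<Sum>r<s. (p - 1) * (p ^ (s - r - 1) * p ^ (2 * (n - 1 - s)) * p ^ ((m - 1) * (n - 2))))"
      using card_nf_data(2)[OF e, of p k0] p2 assms by simp
    also have "\<dots> = (\<Sum>s<n. \<Sum>r<s. (p - 1) * (p ^ (s - r - 1) * p ^ (2 * (n - 1 - s)))) * p ^ ((m - 1) * (n - 2))"
      by (simp only: sum_distrib_right mult.assoc)
    finally have 1: "real (card P) = (\<Sum>s<n. \<Sum>r<s. real ((p - 1) * (p ^ (s - r - 1) * p ^ (2 * (n - 1 - s))))) * real p ^ ((m - 1) * (n - 2))"
      by simp
    have q: "real p ^ 2 - 1 \<noteq> 0"
    proof -
      have "1 < real p ^ 2" using p2 by (intro one_less_power) auto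
      then show ?thesis by simp
    qed
    have 2: "(\<Sum>s<n. \<Sum>r<s. real ((p - 1) * (p ^ (s - r - 1) * p ^ (2 * (n - 1 - s))))) = (real p ^ n - 1) * (real p ^ (n - 1) - 1) / (real p ^ 2 - 1)"
      using echelon_sum[of p n] p2 q by (simp add: eq_divide_eq)
    have m1: "m \<ge> 1" and n1: "n \<ge> 1" using assms(3,4) by (auto simp: Suc_le_eq)
    \<comment> \<open>For n = 1 the integer exponent may be negative while the natural one is
      truncated to 0; the factor p^(n-1) - 1 = 0 makes both sides vanish, in accordance with a
      single tuple member having no nontrivial commutator.\<close>
    have 3: "real p powi ((int m - 1) * (int n - 2)) * (real p ^ (n - 1) - 1) = real p ^ ((m - 1) * (n - 2)) * (real p ^ (n - 1) - 1)"
    proof (cases "n \<ge> 2")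
      case True
      then have "(int m - 1) * (int n - 2) = int ((m - 1) * (n - 2))"
        using m1 by (simp add: of_nat_diff)
      then show ?thesis by (simp only: power_int_of_nat)
    next
      case False
      then have "n = 1" using n1 by simp
      then show ?thesis by simp
    qed
    have "X * Q * R = Q * R * Y" if "X * R = Y * R" for X Y Q R :: real
      using that by (metis mult.assoc mult.commute)
    from this[OF 3, of "real p ^ n - 1"] show ?thesis
      unfolding N_def 1 2 by auto
  qed
  have top: "topspace ?R = Phi ` topspace ?TW \<union> P" "Phi ` topspace ?TW \<inter> P = {}"
  proof -
    have "Phi ` topspace ?TW \<subseteq> topspace ?R"
      by (rule continuous_map_image_subset_topspace[OF continuous_map_Phi])
    then show "topspace ?R = Phi ` topspace ?TW \<union> P" "Phi ` topspace ?TW \<inter> P = {}"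
      unfolding P_def by auto
  qed
  have clP: "closedin ?R {x}" if "x \<in> P" for x
    using that closedin_RepTop_point unfolding P_def by blast
  have clZ: "closedin ?R (Phi ` topspace ?TW)"
    using closed_map_Phi unfolding closed_map_def by blast
  have neZ: "Phi ` topspace ?TW \<noteq> {}"
  proof -
    have "gone \<in> (DSUm :: ('p,'m) elt set)"
      using gone_SUm by (simp add: DSUm_def) (simp add: gone_def diag_mat_def mat_def)
    then have "(\<lambda>_. gclass gone) \<in> topspace (Tn_top :: ('n \<Rightarrow> ('p,'m) elt set) topology)"
      by (auto simp: topspace_Tn_top Tcarrier_DSUm)
    then show ?thesis unfolding topspace_TWTop by blast
  qed
  have pc: "path_components_of ?R = insert (Phi ` topspace ?TW) ((\<lambda>x. {x}) ` P)"
    by (rule path_components_of_isolated_points[OF finP clP clZ path_connectedin_TW neZ top])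
  have "card (path_components_of ?R) = Suc (card P)"
  proof -
    have "Phi ` topspace ?TW \<notin> (\<lambda>x. {x}) ` P" using top(2) by auto
    then show ?thesis
      unfolding pc using finP by (simp add: card_image)
  qed
  then have 1: "real (card (path_components_of ?R)) = N" using cardP by simp
  have 2: "finite (path_components_of ?R)" unfolding pc using finP by simp
  obtain h where h: "bij_betw h {..<card P} P"
    using ex_bij_betw_nat_finite[OF finP] by (auto simp: atLeast0LessThan)
  have "?R homeomorphic_space dunion ?TW (discrete_topology {..<card P})"
    by (rule homeomorphic_dunion_discrete[OF continuous_map_Phi closed_map_Phi inj_Phi finP clP top h])
  then show ?thesis
    using 1 2 cardP by (intro conjI exI[of _ "{..<card P}"]) auto
qed

end
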